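(* Let $d\ge3$ and let $V:(0,1)\to\mathbb{C}$ be measurable with $\int_0^1 r|V(r)|\,dr<\infty$. For $m\in\mathbb{N}_0$ let $\mathcal{S}_m(\mathbb{B}^d)$ be the space of formal spherical polynomials of degree $m$ and $\mathcal{V}_j^{(m)}(x)=r^m\alpha_m(r)Y_j^{(m)}(\xi)$, $j=1,\dots,d_m$. (i) If $m\ne n$, then $\mathcal{S}_m(\mathbb{B}^d)$ and $\mathcal{S}_n(\mathbb{B}^d)$ are orthogonal in $W^{1,2}(\mathbb{B}^d)$. (ii) For each $m$, the set $\{\mathcal{V}_j^{(m)}\}_{j=1}^{d_m}$ is an orthogonal basis of $\mathcal{S}_m(\mathbb{B}^d)$ with respect to the $W^{1,2}(\mathbb{B}^d)$ inner product.
   Context: $\mathbb{B}^d$ and $\mathbb{S}^{d-1}$ are the open unit ball and unit sphere of $\mathbb{R}^d$; points are written $x=r\xi$, $r=|x|$, $\xi\in\mathbb{S}^{d-1}$; $\mathbb{N}_0=\{0,1,2,\dots\}$. The inner product of $W^{1,2}(\mathbb{B}^d)$ is $\langle u,v\rangle=\int_{\mathbb{B}^d}u\overline v+\int_{\mathbb{B}^d}\nabla u\cdot\overline{\nabla v}$. $\mathcal{H}_m(\mathbb{S}^{d-1})$ is the space of spherical harmonics of degree $m$ (restrictions to $\mathbb{S}^{d-1}$ of complex homogeneous harmonic polynomials of degree $m$), $d_m$ its dimension, and $\{Y_j^{(m)}\}_{j=1}^{d_m}$ a fixed orthonormal basis of it in $L^2(\mathbb{S}^{d-1})$ with respect to surface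 measure. Radial functions: for $m\in\mathbb{N}_0$ put $\ell_m=m+\frac{d-3}{2}$ and let $y_m$ be the regular solution of $$-y_m''+\frac{\ell_m(\ell_m+1)}{r^2}y_m+V(r)y_m=0\ \text{ a.e. on }(0,1),\qquad y_m(r)\sim r^{\ell_m+1},\ \ y_m'(r)\sim(\ell_m+1)r^{\ell_m}\ (r\to0^+),$$ given explicitly by $y_m=\sum_{k\ge0}\psi_k$, $\psi_0(r)=r^{\ell_m+1}$, $\psi_k(r)=\int_0^r\frac{1}{2\ell_m+1}\left(\frac{r^{\ell_m+1}}{s^{\ell_m}}-\frac{s^{\ell_m+1}}{r^{\ell_m}}\right)V(s)\psi_{k-1}(s)\,ds$ for $k\ge1$. Define $\alpha_m(r)=y_m(r)/r^{\ell_m+1}$ for $r\in(0,1]$ and $\alpha_m(0)=1$. A formal spherical polynomial of degree $m$ is a function $U_m(x)=r^m\alpha_m(r)p(\xi)$ with $p\in\mathcal{H}_m(\mathbb{S}^{d-1})$; $\mathcal{S}_m(\mathbb{B}^d)$ is the set of these. *)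

theory Defs
  imports "HOL-Analysis.Analysis" "HOL-Library.Function_Algebras"
begin

text \<open>Complex-valued functions as a vector space over the complex numbers.\<close>

definition cscale :: "complex \<Rightarrow> ('a \<Rightarrow> complex) \<Rightarrow> 'a \<Rightarrow> complex" where
  "cscale c f = (\<lambda>x. c * f x)"

global_interpretation cfun: vector_space "cscale :: complex \<Rightarrow> ('a \<Rightarrow> complex) \<Rightarrow> 'a \<Rightarrow> complex"
  by standard (auto simp: cscale_def fun_eq_iff algebra_simps)

text \<open>The forms used below are inner products only after identifying functions that agree
  almost everywhere. The condition that \<open>ip (b i) (b i)\<close> is nonzero says that \<open>b i\<close> does not
  become zero under this identification; together with orthogonality it gives linear
  independence of the equivalence classes.\<close>

definition orthogonal_basis ::
  "(('a \<Rightarrow> complex) \<Rightarrow> ('a \<Rightarrow> complex) \<Rightarrow> complex) \<Rightarrow> 'i set \<Rightarrow> ('i \<Rightarrow> 'a \<Rightarrow> complex)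
    \<Rightarrow> ('a \<Rightarrow> complex) set \<Rightarrow> bool" where
  "orthogonal_basis ip I b S \<longleftrightarrow>
     inj_on b I \<and> cfun.independent (b ` I) \<and> cfun.span (b ` I) = S \<and>
     (\<forall>i\<in>I. ip (b i) (b i) \<noteq> 0) \<and>
     (\<forall>i\<in>I. \<forall>j\<in>I. i \<noteq> j \<longrightarrow> ip (b i) (b j) = 0)"

definition orthonormal_basis ::
  "(('a \<Rightarrow> complex) \<Rightarrow> ('a \<Rightarrow> complex) \<Rightarrow> complex) \<Rightarrow> 'i set \<Rightarrow> ('i \<Rightarrow> 'a \<Rightarrow> complex)
    \<Rightarrow> ('a \<Rightarrow> complex) set \<Rightarrow> bool" where
  "orthonormal_basis ip I b S \<longleftrightarrow>
     orthogonal_basis ip I b S \<and> (\<forall>i\<in>I. ip (b i) (b i) = 1)"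


definition partial :: "'n \<Rightarrow> (real^'n \<Rightarrow> complex) \<Rightarrow> real^'n \<Rightarrow> complex" where
  "partial i f x = vector_derivative (\<lambda>t. f (x + t *\<^sub>R axis i 1)) (at 0)"

definition laplacian :: "(real^'n \<Rightarrow> complex) \<Rightarrow> real^'n \<Rightarrow> complex" where
  "laplacian f x = (\<Sum>i\<in>UNIV. partial i (partial i f) x)"

primrec Ck :: "nat \<Rightarrow> (real^'n \<Rightarrow> complex) \<Rightarrow> bool" where
  "Ck 0 f \<longleftrightarrow> continuous_on UNIV f"
| "Ck (Suc k) f \<longleftrightarrow> continuous_on UNIV f \<and>
     (\<forall>i x. (\<lambda>t. f (x + t *\<^sub>R axis i 1)) differentiable (at (0::real))) \<and>
     (\<forall>i. Ck k (partial i f))"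

definition test_function :: "(real^'n) set \<Rightarrow> (real^'n \<Rightarrow> complex) \<Rightarrow> bool" where
  "test_function S \<phi> \<longleftrightarrow> (\<forall>k. Ck k \<phi>) \<and>
     compact (closure {x. \<phi> x \<noteq> 0}) \<and> closure {x. \<phi> x \<noteq> 0} \<subseteq> S"


text \<open>The Sobolev space on the unit ball. Only the values of a function on the ball matter.\<close>

definition L2_ball :: "(real^'n \<Rightarrow> complex) set" where
  "L2_ball = {u. u \<in> borel_measurable (lebesgue_on (ball 0 1)) \<and>
                 integrable (lebesgue_on (ball 0 1)) (\<lambda>x. (cmod (u x))\<^sup>2)}"

definition is_weak_gradient :: "(real^'n \<Rightarrow> complex) \<Rightarrow> (real^'n \<Rightarrow> complex^'n) \<Rightarrow> bool" where
  "is_weak_gradient u g \<longleftrightarrow>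
     (\<forall>i K. compact K \<and> K \<subseteq> ball 0 1 \<longrightarrow> (\<lambda>x. g x $ i) absolutely_integrable_on K) \<and>
     (\<forall>\<phi> i. test_function (ball 0 1) \<phi> \<longrightarrow>
        (LINT x|lebesgue_on (ball 0 1). u x * partial i \<phi> x) =
        - (LINT x|lebesgue_on (ball 0 1). g x $ i * \<phi> x))"

definition W12_ball :: "(real^'n \<Rightarrow> complex) set" where
  "W12_ball = {u \<in> L2_ball. \<exists>g. is_weak_gradient u g \<and> (\<forall>i. (\<lambda>x. g x $ i) \<in> L2_ball)}"

text \<open>The choice of a representative is immaterial: weak gradients are unique up to a null set.\<close>

definition weak_gradient :: "(real^'n \<Rightarrow> complex) \<Rightarrow> real^'n \<Rightarrow> complex^'n" where
  "weak_gradient u = (SOME g. is_weak_gradient u g)"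

definition W12_inner :: "(real^'n \<Rightarrow> complex) \<Rightarrow> (real^'n \<Rightarrow> complex) \<Rightarrow> complex" where
  "W12_inner u v =
     (LINT x|lebesgue_on (ball 0 1). u x * cnj (v x)) +
     (LINT x|lebesgue_on (ball 0 1).
        (\<Sum>i\<in>UNIV. weak_gradient u x $ i * cnj (weak_gradient v x $ i)))"


text \<open>Surface measure on the unit sphere of dimension \<open>d - 1\<close>: a Borel set \<open>A\<close> gets
  \<open>d\<close> times the volume of the cone \<open>{r \<xi> | 0 < r < 1, \<xi> \<in> A}\<close>, since
  \<open>1 / d\<close> is the integral of \<open>r^(d-1)\<close> over \<open>(0,1)\<close>.\<close>

definition surface_measure :: "(real^'n) measure" where
  "surface_measure = scale_measure (of_nat CARD('n))
     (distr (restrict_space lborel (ball 0 1 - {0})) (restrict_space borel (sphere 0 1))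
        (\<lambda>x. x /\<^sub>R norm x))"

definition sphere_inner :: "(real^'n \<Rightarrow> complex) \<Rightarrow> (real^'n \<Rightarrow> complex) \<Rightarrow> complex" where
  "sphere_inner p q = (LINT \<xi>|surface_measure. p \<xi> * cnj (q \<xi>))"

definition homogeneous_harmonic_polys :: "nat \<Rightarrow> (real^'n \<Rightarrow> complex) set" where
  "homogeneous_harmonic_polys m =
     {P. polynomial_function P \<and> (\<forall>t x. P (t *\<^sub>R x) = of_real (t ^ m) * P x) \<and>
         (\<forall>x. laplacian P x = 0)}"

text \<open>A function on the sphere is represented by its extension by zero, so that equality,
  span and dimension are those of functions on the sphere. The same is done for functions on
  the ball in \<open>formal_sph_fun\<close>.\<close>

definition spherical_harmonics :: "nat \<Rightarrow> (real^'n \<Rightarrow> complex) set" where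
  "spherical_harmonics m =
     (\<lambda>P \<xi>. if \<xi> \<in> sphere 0 1 then P \<xi> else 0) ` homogeneous_harmonic_polys m"


definition ell :: "nat \<Rightarrow> nat \<Rightarrow> real" where
  "ell d m = real m + (real d - 3) / 2"

primrec psi :: "real \<Rightarrow> (real \<Rightarrow> complex) \<Rightarrow> nat \<Rightarrow> real \<Rightarrow> complex" where
  "psi l V 0 = (\<lambda>r. of_real (r powr (l + 1)))"
| "psi l V (Suc k) = (\<lambda>r. LINT s:{0<..<r}|lebesgue.
     of_real (1 / (2 * l + 1) * (r powr (l + 1) / s powr l - s powr (l + 1) / r powr l))
       * V s * psi l V k s)"

definition regular_solution :: "real \<Rightarrow> (real \<Rightarrow> complex) \<Rightarrow> real \<Rightarrow> complex" where
  "regular_solution l V r = (\<Sum>k. psi l V k r)"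

definition alpha :: "nat \<Rightarrow> (real \<Rightarrow> complex) \<Rightarrow> nat \<Rightarrow> real \<Rightarrow> complex" where
  "alpha d V m r =
     (if r = 0 then 1
      else regular_solution (ell d m) V r / of_real (r powr (ell d m + 1)))"


text \<open>For \<open>x = 0\<close> an arbitrary unit vector is chosen. The value \<open>r^m * p \<xi>\<close> at the origin does
  not depend on the choice, as \<open>p\<close> is constant for \<open>m = 0\<close>.\<close>

definition direction :: "real^'n \<Rightarrow> real^'n" where
  "direction x = (SOME \<xi>. \<xi> \<in> sphere 0 1 \<and> x = norm x *\<^sub>R \<xi>)"

lemma direction_nonzero:
  assumes "x \<noteq> 0"
  shows "direction x = x /\<^sub>R norm x"
  unfolding direction_def
proof (rule some_equality)
  show "x /\<^sub>R norm x \<in> sphere 0 1 \<and> x = norm x *\<^sub>R (x /\<^sub>R norm x)"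
    using assms by simp
next
  fix \<xi> assume "\<xi> \<in> sphere 0 1 \<and> x = norm x *\<^sub>R \<xi>"
  then have "x /\<^sub>R norm x = (norm x *\<^sub>R \<xi>) /\<^sub>R norm x" by simp
  then show "\<xi> = x /\<^sub>R norm x" using assms by simp
qed

lemma direction_polar:
  fixes x :: "real^'n"
  shows "direction x \<in> sphere 0 1 \<and> x = norm x *\<^sub>R direction x"
proof (cases "x = 0")
  case True
  have "\<exists>\<xi>::real^'n. \<xi> \<in> sphere 0 1 \<and> x = norm x *\<^sub>R \<xi>"
    using True by (intro exI[of _ "axis undefined 1"]) simp
  then show ?thesis unfolding direction_def by (rule someI_ex)
qed (simp add: direction_nonzero)

definition formal_sph_fun ::
  "(real \<Rightarrow> complex) \<Rightarrow> nat \<Rightarrow> (real^'n \<Rightarrow> complex) \<Rightarrow> real^'n \<Rightarrow> complex" where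
  "formal_sph_fun V m p x =
     (if x \<in> ball 0 1
      then of_real (norm x ^ m) * alpha CARD('n) V m (norm x) * p (direction x) else 0)"

definition formal_sph_polys :: "(real \<Rightarrow> complex) \<Rightarrow> nat \<Rightarrow> (real^'n \<Rightarrow> complex) set" where
  "formal_sph_polys V m = formal_sph_fun V m ` spherical_harmonics m"

end

theory Submission imports Defs begin

text \<open>
  A formal spherical polynomial of degree \<open>m\<close> is \<open>u(x) = \<alpha>(|x|) P(x)\<close> with \<open>P\<close> a homogeneous harmonic
  polynomial of degree \<open>m\<close> and \<open>\<alpha>\<close> radial. The proof computes its Sobolev inner products from
  radial integrals and from means over the sphere.

  The radial factor. Division of the recursion for \<open>\<psi>\<^sub>k\<close> by \<open>r\<^sup>\<ell>\<^sup>+\<^sup>1\<close> gives a Volterra equation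
  \<open>\<alpha> = 1 + T(s V \<alpha>)\<close> whose kernel involves only the integer power \<open>q = 2\<ell> + 1 = 2m + d - 2\<close>.
  In a weighted supremum norm the operator is a contraction, so the series for \<open>\<alpha>\<close> converges, and the
  equation shows that \<open>\<alpha>\<close> is continuously differentiable on \<open>(0,1)\<close>, that \<open>\<alpha>(r) \<rightarrow> 1\<close> as \<open>r \<rightarrow> 0\<close>,
  and that \<open>\<alpha>'(r)\<close> is at most a multiple of \<open>1/r\<close> (\<open>profile_properties\<close>, \<open>alpha_properties\<close>).

  The Sobolev space. Away from the origin \<open>u\<close> therefore has a classical gradient of size \<open>O(1/|x|)\<close>.
  For \<open>d \<ge> 3\<close> this is square integrable and the origin can be cut out at no cost, so the classical
  gradient is a weak gradient (\<open>punctured_ball_gradient\<close>). Weak gradients are unique up to null sets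
  (\<open>weak_gradient_unique\<close>), hence the inner product may be computed with it.

  Orthogonality. By Euler's identity the integrand of the inner product of \<open>\<alpha>\<^sub>m(|x|) P(x)\<close> and
  \<open>\<alpha>\<^sub>n(|x|) Q(x)\<close> is a radial function times \<open>P \<xi> * cnj (Q \<xi>)\<close> plus a radial function times the
  Hermitian product of \<open>\<nabla>P(\<xi>)\<close> and \<open>\<nabla>Q(\<xi>)\<close>, with \<open>\<xi> = x / |x|\<close>. Radial and angular
  integration separate (\<open>radial_integral\<close>), so it suffices that both angular means vanish. A Green identity with
  a weight that is zero on the sphere proves this for different degrees, and for equal degrees when
  \<open>P\<close> and \<open>Q\<close> are orthogonal on the sphere (\<open>harmonic_sphere_means\<close>).

  The basis. Since \<open>\<alpha>\<close> does not vanish near \<open>0\<close>, the linear map that takes a spherical harmonic to its formal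
  spherical polynomial is injective and takes unit vectors to functions of positive norm.
\<close>

section \<open>Partial derivatives along coordinate axes\<close>

lemma has_vector_derivative_iff_quotient:
  "(f has_vector_derivative D) (at x) \<longleftrightarrow> ((\<lambda>y. (f y - f x) /\<^sub>R (y - x)) \<longlongrightarrow> D) (at x)"
proof -
  have "norm (f y - f x - (y - x) *\<^sub>R D) / norm (y - x) = norm ((f y - f x) /\<^sub>R (y - x) - D)"
    if "y \<noteq> x" for y
  proof -
    have "(f y - f x) /\<^sub>R (y - x) - D = (f y - f x - (y - x) *\<^sub>R D) /\<^sub>R (y - x)"
      using that by (simp add: scaleR_diff_right)
    then show ?thesis by (simp add: divide_inverse_commute)
  qed
  then have "((\<lambda>y. norm (f y - f x - (y - x) *\<^sub>R D) / norm (y - x)) \<longlongrightarrow> 0) (at x) \<longleftrightarrow>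
    ((\<lambda>y. norm ((f y - f x) /\<^sub>R (y - x) - D)) \<longlongrightarrow> 0) (at x)"
    by (intro filterlim_cong refl) (auto simp: eventually_at_filter)
  also have "\<dots> \<longleftrightarrow> ((\<lambda>y. (f y - f x) /\<^sub>R (y - x)) \<longlongrightarrow> D) (at x)"
    by (simp add: tendsto_norm_zero_iff flip: LIM_zero_iff[of _ D])
  finally show ?thesis
    by (simp add: has_vector_derivative_def has_derivative_iff_norm bounded_linear_scaleR_left)
qed

text \<open>The value of \<open>partial\<close> at a point says nothing about differentiability there; this relation carries
  existence and value together.\<close>

definition has_partial :: "(real^'n \<Rightarrow> complex) \<Rightarrow> 'n \<Rightarrow> real^'n \<Rightarrow> complex \<Rightarrow> bool" where
  "has_partial f i x D \<longleftrightarrow>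
     ((\<lambda>t. f (x + t *\<^sub>R axis i 1)) has_vector_derivative D) (at 0)"

lemma has_partial_imp_partial: "has_partial f i x D \<Longrightarrow> partial i f x = D"
  unfolding has_partial_def partial_def by (rule vector_derivative_at)

lemma has_partial_along_line:
  assumes "has_partial f i (x + t *\<^sub>R axis i 1) D"
  shows "((\<lambda>s. f (x + s *\<^sub>R axis i 1)) has_vector_derivative D) (at t)"
proof -
  have 1: "((\<lambda>s. s - t) has_vector_derivative 1) (at t)"
    by (auto intro!: derivative_eq_intros)
  have 2: "((\<lambda>s. f (x + t *\<^sub>R axis i 1 + s *\<^sub>R axis i 1)) has_vector_derivative D) (at (t - t))"
    using assms by (simp add: has_partial_def)
  have "((\<lambda>s. f (x + t *\<^sub>R axis i 1
      + s *\<^sub>R axis i 1)) \<circ> (\<lambda>s. s - t) has_vector_derivative 1 *\<^sub>R D) (at t)"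
    by (rule vector_diff_chain_at[OF 1 2])
  then show ?thesis
    by (simp add: o_def algebra_simps)
qed

lemma has_partial_const: "has_partial (\<lambda>_. c) i x 0"
  by (simp add: has_partial_def)

lemma has_partial_mult:
  "has_partial f i x D \<Longrightarrow> has_partial g i x E \<Longrightarrow>
   has_partial (\<lambda>x. f x * g x) i x (f x * E + D * g x)"
  unfolding has_partial_def
  by (drule (1) has_vector_derivative_mult) simp

lemma has_partial_cnj: "has_partial f i x D \<Longrightarrow> has_partial (\<lambda>x. cnj (f x)) i x (cnj D)"
  unfolding has_partial_def by (rule has_vector_derivative_cnj)

lemma has_partial_cong_open:
  fixes x :: "real^'n"
  assumes "has_partial f i x D" "open S" "x \<in> S" "\<And>y. y \<in> S \<Longrightarrow> f y = g y"
  shows "has_partial g i x D"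
proof -
  let ?l = "\<lambda>t. x + t *\<^sub>R axis i 1 :: real^'n"
  have "continuous_on UNIV ?l" by (intro continuous_intros)
  then have "open (?l -` S)" using \<open>open S\<close> by (rule open_vimage[rotated])
  with assms(1) show ?thesis
    unfolding has_partial_def
    by (rule has_vector_derivative_transform_within_open) (use assms in auto)
qed

lemma has_partial_radial:
  fixes x :: "real^'n"
  assumes "(f has_vector_derivative D) (at (norm x))" "x \<noteq> 0"
  shows "has_partial (\<lambda>x. f (norm x)) i x (of_real (x $ i / norm x) * D)"
proof -
  let ?l = "\<lambda>t. x + t *\<^sub>R axis i 1 :: real^'n"
  have l: "(?l has_derivative (\<lambda>t. t *\<^sub>R axis i 1)) (at 0)"
    by (auto intro!: derivative_eq_intros)
  have n: "(norm has_derivative (\<bullet>) (sgn x)) (at (?l 0))"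
    using has_derivative_norm[OF assms(2)] by (simp add: inner_commute[of _ "sgn x"])
  have "((\<lambda>t. norm (?l t)) has_derivative (\<lambda>t. t * (x $ i / norm x))) (at 0)"
    using has_derivative_compose[OF l n]
    by (simp add: sgn_div_norm inner_axis divide_inverse mult_ac)
  then have "((\<lambda>t. norm (?l t)) has_vector_derivative x $ i / norm x) (at 0)"
    by (simp add: has_vector_derivative_def)
  from vector_diff_chain_at[OF this] assms(1)
  show ?thesis
    by (simp add: has_partial_def o_def flip: scaleR_conv_of_real del: of_real_divide)
qed

lemma partial_bound_along_axis:
  assumes "\<And>x. has_partial f i x (f' x)" and "\<And>x. cmod (f' x) \<le> C"
  shows "cmod (f (x + t *\<^sub>R axis i 1) - f x) \<le> C * \<bar>t\<bar>"
proof -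
  let ?f = "\<lambda>s. f (x + s *\<^sub>R axis i 1)"
  have "norm (?f t - ?f 0) \<le> C * norm (t - 0)"
  proof (rule differentiable_bound)
    show "convex (UNIV::real set)" by simp
    show "(?f has_derivative (\<lambda>h. h *\<^sub>R f' (x + s *\<^sub>R axis i 1))) (at s within UNIV)" for s
      using has_partial_along_line[OF assms(1)] by (simp add: has_vector_derivative_def)
    show "onorm (\<lambda>h. h *\<^sub>R f' (x + s *\<^sub>R axis i 1)) \<le> C" for s
      by (rule onorm_le) (use assms(2) in \<open>simp add: mult.commute[of C] mult_left_mono\<close>)
  qed auto
  then show ?thesis by simp
qed

lemma partial_difference_quotient:
  assumes "has_partial f i x D"
  shows "(\<lambda>n. (f (x + (1 / real (Suc n)) *\<^sub>R axis i 1) - f x) * of_nat (Suc n)) \<longlonglongrightarrow> D"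
proof -
  let ?f = "\<lambda>s. f (x + s *\<^sub>R axis i 1)"
  have "((\<lambda>y. (?f y - ?f 0) /\<^sub>R (y - 0)) \<longlongrightarrow> D) (at 0)"
    using assms unfolding has_partial_def has_vector_derivative_iff_quotient .
  moreover have "filterlim (\<lambda>n. 1 / real (Suc n)) (at 0) sequentially"
    unfolding filterlim_at
    using LIMSEQ_inverse_real_of_nat by (auto simp: inverse_eq_divide)
  ultimately have "(\<lambda>n. (?f (1 / real (Suc n)) - ?f 0) /\<^sub>R (1 / real (Suc n) - 0)) \<longlonglongrightarrow> D"
    by (rule filterlim_compose)
  then show ?thesis
    by (simp add: scaleR_conv_of_real mult_ac del: of_nat_Suc)
qed

text \<open>Lebesgue measure is invariant under translations, so every difference quotient of \<open>f\<close> has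
  integral zero. The bound on the partial derivative dominates the quotients, which gives the limit.\<close>

lemma integral_partial_eq_0:
  fixes f :: "real^'n \<Rightarrow> complex"
  assumes meas: "f \<in> borel_measurable borel"
    and supp: "\<And>x. norm x \<ge> R \<Longrightarrow> f x = 0"
    and bdd: "\<And>x. cmod (f x) \<le> B"
    and der: "\<And>x. has_partial f i x (f' x)"
    and bound: "\<And>x. cmod (f' x) \<le> C"
  shows "f' \<in> borel_measurable borel" "(LINT x|lborel. f' x) = 0"
proof -
  define e where "e n = (1 / real (Suc n)) *\<^sub>R (axis i 1 :: real^'n)" for n :: nat
  define F where "F n x = (f (x + e n) - f x) * of_nat (Suc n)" for n x
  note [measurable] = meas
  have F_meas [measurable]: "F n \<in> borel_measurable borel" for n
    unfolding F_def by measurable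
  have lim: "(\<lambda>n. F n x) \<longlonglongrightarrow> f' x" for x
    using partial_difference_quotient[OF der] by (simp add: F_def e_def)
  show f'_meas [measurable]: "f' \<in> borel_measurable borel"
    by (rule borel_measurable_LIMSEQ_metric[OF F_meas lim])
  have C: "0 \<le> C" using bound[of undefined] by (rule order_trans[OF norm_ge_zero])
  have int: "integrable lborel f"
  proof (rule Bochner_Integration.integrable_bound)
    show "integrable lborel (\<lambda>x::real^'n. indicator (ball 0 R) x * B)"
      by (intro integrable_mult_left integrable_real_indicator)
        (use emeasure_lborel_ball_finite in \<open>auto simp: less_top\<close>)
    show "AE x in lborel. norm (f x) \<le> norm (indicator (ball 0 R) x * B)"
    proof (rule AE_I2)
      fix x
      show "norm (f x) \<le> norm (indicator (ball 0 R) x * B)"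
        using supp[of x] bdd[of x] by (cases "norm x < R") (auto simp: indicator_def)
    qed
  qed simp
  have shift: "(LINT x|lborel. f (x + e n)) = (LINT x|lborel. f x)" "integrable lborel (\<lambda>x. f (x
      + e n))" for n
  proof -
    have "(LINT x|lborel. f x) = (LINT x|distr lborel borel ((+) (e n)). f x)"
      by (simp add: lborel_distr_plus)
    also have "\<dots> = (LINT x|lborel. f (x + e n))"
      by (subst integral_distr) (auto simp: add.commute)
    finally show "(LINT x|lborel. f (x + e n)) = (LINT x|lborel. f x)" ..
    have "integrable (distr lborel borel ((+) (e n))) f"
      using int by (simp add: lborel_distr_plus)
    then show "integrable lborel (\<lambda>x. f (x + e n))"
      by (subst (asm) integrable_distr_eq) (auto simp: add.commute)
  qed
  have F0: "(LINT x|lborel. F n x) = 0" for n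
    unfolding F_def using shift[of n] int by simp
  have "(\<lambda>n. LINT x|lborel. F n x) \<longlonglongrightarrow> (LINT x|lborel. f' x)"
  proof (rule integral_dominated_convergence)
    show "integrable lborel (\<lambda>x::real^'n. indicator (ball 0 (R + 1)) x * C)"
      by (intro integrable_mult_left integrable_real_indicator)
        (use emeasure_lborel_ball_finite in \<open>auto simp: less_top\<close>)
    show "AE x in lborel. norm (F n x) \<le> indicator (ball 0 (R + 1)) x * C" for n
    proof (rule AE_I2)
      fix x :: "real^'n"
      show "norm (F n x) \<le> indicator (ball 0 (R + 1)) x * C"
      proof (cases "norm x < R + 1")
        case True
        have "cmod (f (x + e n) - f x) \<le> C * \<bar>1 / real (Suc n)\<bar>"
          unfolding e_def by (rule partial_bound_along_axis[OF der bound])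
        then have "cmod (F n x) \<le> C * (1 / real (Suc n)) * real (Suc n)"
          unfolding F_def norm_mult norm_of_nat by (intro mult_right_mono) auto
        then show ?thesis using True by simp
      next
        case False
        have "norm (e n) \<le> 1" by (simp add: e_def)
        then have "norm (x + e n) \<ge> R" using False norm_triangle_ineq4[of "x + e n" "e n"] by simp
        then show ?thesis using False C by (simp add: F_def supp)
      qed
    qed
  qed (auto simp: lim)
  then show "(LINT x|lborel. f' x) = 0" unfolding F0 by (simp add: LIMSEQ_const_iff)
qed

section \<open>A supply of test functions\<close>

text \<open>The derivative occurs as a witness, so that closure properties follow by induction on the order.\<close>

primrec smooth_line :: "nat \<Rightarrow> (real \<Rightarrow> complex) \<Rightarrow> bool" where
  "smooth_line 0 f \<longleftrightarrow> continuous_on UNIV f"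
| "smooth_line (Suc k) f \<longleftrightarrow>
     (\<exists>f'. (\<forall>t. (f has_vector_derivative f' t) (at t)) \<and> smooth_line k f')"

lemma smooth_line_continuous: "smooth_line k f \<Longrightarrow> continuous_on UNIV f"
  by (cases k)
    (auto intro!: continuous_at_imp_continuous_on intro: has_vector_derivative_continuous)

lemma smooth_line_SucD: "smooth_line (Suc k) f \<Longrightarrow> smooth_line k f"
proof (induction k arbitrary: f)
  case 0
  then show ?case using smooth_line_continuous[of "Suc 0"] by simp
next
  case (Suc k)
  from Suc.prems obtain f' where "\<forall>t. (f has_vector_derivative f' t) (at t)" "smooth_line (Suc k) f'"
    by auto
  then show ?case using Suc.IH[of f'] by auto
qed

lemma smooth_line_add: "smooth_line k f \<Longrightarrow> smooth_line k g \<Longrightarrow> smooth_line k (\<lambda>t. f t + g t)"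
proof (induction k arbitrary: f g)
  case 0
  then show ?case by (auto intro: continuous_on_add)
next
  case (Suc k)
  then obtain f' g' where "\<forall>t. (f has_vector_derivative f' t) (at t)" "smooth_line k f'"
    "\<forall>t. (g has_vector_derivative g' t) (at t)" "smooth_line k g'" by auto
  then show ?case
    by (auto intro!: exI[of _ "\<lambda>t. f' t + g' t"] has_vector_derivative_add Suc.IH)
qed

lemma smooth_line_mult: "smooth_line k f \<Longrightarrow> smooth_line k g \<Longrightarrow> smooth_line k (\<lambda>t. f t * g t)"
proof (induction k arbitrary: f g)
  case 0
  then show ?case by (auto intro: continuous_on_mult)
next
  case (Suc k)
  from Suc.prems obtain f' g' where d: "\<And>t. (f has_vector_derivative f' t) (at t)" "smooth_line k f'"
    "\<And>t. (g has_vector_derivative g' t) (at t)" "smooth_line k g'" by auto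
  have "smooth_line k f" "smooth_line k g" using Suc.prems smooth_line_SucD by blast+
  then have "smooth_line k (\<lambda>t. f t * g' t + f' t * g t)"
    using d by (intro smooth_line_add Suc.IH)
  moreover have "\<And>t. ((\<lambda>t. f t * g t) has_vector_derivative f t * g' t + f' t * g t) (at t)"
    using d by (intro has_vector_derivative_mult)
  ultimately show ?case
    by (auto intro!: exI[of _ "\<lambda>t. f t * g' t + f' t * g t"])
qed

lemma smooth_line_const: "smooth_line k (\<lambda>_. c)"
  by (induction k arbitrary: c) (auto intro!: exI[of _ "\<lambda>_. 0"])

lemma smooth_line_affine: "smooth_line k f \<Longrightarrow> smooth_line k (\<lambda>t. f (a * t + b))"
proof (induction k arbitrary: f)
  case 0
  then show ?case
    by (auto intro!: continuous_intros continuous_on_compose2[of UNIV f])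
next
  case (Suc k)
  then obtain f' where d: "\<And>t. (f has_vector_derivative f' t) (at t)" and f': "smooth_line k f'" by auto
  have "((\<lambda>t. f (a * t + b)) has_vector_derivative of_real a * f' (a * t + b)) (at t)" for t
  proof -
    have "((\<lambda>t. a * t + b) has_vector_derivative a) (at t)"
      by (auto intro!: derivative_eq_intros simp: has_vector_derivative_def)
    from vector_diff_chain_at[OF this d] show ?thesis
      by (simp add: o_def scaleR_conv_of_real)
  qed
  moreover have "smooth_line k (\<lambda>t. of_real a * f' (a * t + b))"
    by (intro smooth_line_mult smooth_line_const Suc.IH f')
  ultimately show ?case
    by (auto intro!: exI[of _ "\<lambda>t. of_real a * f' (a * t + b)"])
qed

text \<open>The polynomial factor makes this family closed under differentiation. Smoothness of the flat
  function \<open>exp (-1/t)\<close> is then an induction over all polynomials at once.\<close>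

definition flat :: "real poly \<Rightarrow> real \<Rightarrow> complex" where
  "flat p t = (if t > 0 then of_real (poly p (1 / t) * exp (- 1 / t)) else 0)"

lemma poly_div_exp_tendsto_0: "((\<lambda>x::real. poly p x / exp x) \<longlongrightarrow> 0) at_top"
proof -
  have "((\<lambda>x::real. \<Sum>i\<le>degree p. coeff p i * (x ^ i / exp x)) \<longlongrightarrow> (\<Sum>i\<le>degree p. coeff p i * 0)) at_top"
    by (intro tendsto_intros tendsto_power_div_exp_0)
  then show ?thesis by (simp add: poly_altdef sum_divide_distrib)
qed

text \<open>At \<open>t = 0\<close> the difference quotient is \<open>q(1/t) exp (-1/t)\<close> with \<open>q = X p\<close>, and this tends to \<open>0\<close>
  from the right.\<close>

lemma flat_has_vector_derivative:
  "(flat p has_vector_derivative flat ([:0, 0, 1:] * (p - pderiv p)) t) (at t)"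
proof -
  consider "t < 0" | "t = 0" | "t > 0" by linarith
  then show ?thesis
  proof cases
    case 1
    have "((\<lambda>_. 0) has_vector_derivative (0::complex)) (at t)" by simp
    then have "(flat p has_vector_derivative 0) (at t)"
      by (rule has_vector_derivative_transform_within_open[of _ _ _ "{..<0}"])
        (use 1 in \<open>auto simp: flat_def\<close>)
    then show ?thesis using 1 by (simp add: flat_def)
  next
    case 3
    have "((\<lambda>t. poly p (1 / t) * exp (- 1 / t)) has_real_derivative
        poly ([:0, 0, 1:] * (p - pderiv p)) (1 / t) * exp (- 1 / t)) (at t)"
      using 3 by (auto intro!: derivative_eq_intros DERIV_chain'[OF _ poly_DERIV]
          simp: field_simps power2_eq_square)
    then have "((\<lambda>t. of_real (poly p (1 / t) * exp (- 1 / t))) has_vector_derivative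
        complex_of_real (poly ([:0, 0, 1:] * (p - pderiv p)) (1 / t) * exp (- 1 / t))) (at t)"
      by (intro has_vector_derivative_of_real) (simp add: has_real_derivative_iff_has_vector_derivative)
    then have "(flat p has_vector_derivative
        of_real (poly ([:0, 0, 1:] * (p - pderiv p)) (1 / t) * exp (- 1 / t))) (at t)"
      by (rule has_vector_derivative_transform_within_open[of _ _ _ "{0<..}"])
        (use 3 in \<open>auto simp: flat_def\<close>)
    then show ?thesis using 3 by (simp add: flat_def)
  next
    case 2
    let ?q = "\<lambda>h. cmod (flat p (0 + h) - flat p 0 - h *\<^sub>R 0) / norm h"
    have "(?q \<longlongrightarrow> 0) (at_left 0)"
      by (rule tendsto_eventually) (auto simp: eventually_at_filter flat_def)
    moreover have "(?q \<longlongrightarrow> 0) (at_right 0)"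
    proof (rule Lim_transform_eventually)
      have "((\<lambda>x. \<bar>poly ([:0, 1:] * p) x / exp x\<bar>) \<longlongrightarrow> \<bar>0\<bar>) at_top"
        by (intro tendsto_rabs poly_div_exp_tendsto_0)
      then show "((\<lambda>h. \<bar>poly ([:0, 1:] * p) (inverse h) / exp (inverse h)\<bar>) \<longlongrightarrow> 0) (at_right (0::real))"
        using filterlim_compose[OF _ filterlim_inverse_at_top_right] by force
      have "\<bar>poly ([:0, 1:] * p) (inverse h) / exp (inverse h)\<bar> = ?q h" if "h > 0" for h
        using that
        by (simp add: flat_def exp_minus field_simps abs_mult norm_mult norm_divide)
      then show "\<forall>\<^sub>F h in at_right 0. \<bar>poly ([:0, 1:] * p) (inverse h) / exp (inverse h)\<bar> = ?q h"
        by (auto simp: eventually_at_filter)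
    qed
    ultimately have "(?q \<longlongrightarrow> 0) (at 0)" by (simp add: filterlim_at_split)
    then have "(flat p has_vector_derivative 0) (at 0)"
      unfolding has_vector_derivative_def has_derivative_at by simp
    then show ?thesis using 2 by (simp add: flat_def)
  qed
qed

lemma smooth_line_flat: "smooth_line k (flat p)"
proof (induction k arbitrary: p)
  case 0
  then show ?case
    by (auto intro!: continuous_at_imp_continuous_on
        has_vector_derivative_continuous[OF flat_has_vector_derivative])
next
  case (Suc k)
  then show ?case using flat_has_vector_derivative by auto
qed

lemma has_partial_coordinate_product:
  fixes f :: "'n::finite \<Rightarrow> real \<Rightarrow> complex" and x :: "real^'n"
  assumes "(f j has_vector_derivative D (x $ j)) (at (x $ j))"
  shows "has_partial (\<lambda>x. \<Prod>i\<in>UNIV. f i (x $ i)) j x (\<Prod>i\<in>UNIV. (f(j := D)) i (x $ i))"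
proof -
  let ?l = "\<lambda>t. x + t *\<^sub>R axis j 1 :: real^'n"
  let ?c = "\<Prod>i\<in>UNIV - {j}. f i (x $ i)"
  have "((\<lambda>t. x $ j + t) has_vector_derivative 1) (at 0)"
    by (auto intro!: derivative_eq_intros)
  moreover have "(f j has_vector_derivative D (x $ j)) (at (x $ j + 0))" using assms by simp
  ultimately have "(f j \<circ> (\<lambda>t. x $ j + t) has_vector_derivative 1 *\<^sub>R D (x $ j)) (at 0)"
    by (rule vector_diff_chain_at)
  then have "((\<lambda>t. f j (x $ j + t) * ?c) has_vector_derivative D (x $ j) * ?c) (at 0)"
    by (intro has_vector_derivative_mult_left) (simp add: o_def)
  moreover have eq1: "(\<Prod>i\<in>UNIV. f i (?l t $ i)) = f j (x $ j + t) * ?c" for t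
  proof -
    have "(\<Prod>i\<in>UNIV. f i (?l t $ i)) = f j (?l t $ j) * (\<Prod>i\<in>UNIV - {j}. f i (?l t $ i))"
      by (simp add: prod.remove[of _ j])
    also have "(\<Prod>i\<in>UNIV - {j}. f i (?l t $ i)) = ?c"
      by (rule prod.cong) (auto simp: axis_def)
    finally show ?thesis by (simp add: axis_def)
  qed
  moreover have eq2: "(\<Prod>i\<in>UNIV. (f(j := D)) i (x $ i)) = D (x $ j) * ?c"
  proof -
    have "(\<Prod>i\<in>UNIV. (f(j := D)) i (x $ i)) = D (x $ j) * (\<Prod>i\<in>UNIV - {j}. (f(j := D)) i (x $ i))"
      by (simp add: prod.remove[of _ j])
    also have "(\<Prod>i\<in>UNIV - {j}. (f(j := D)) i (x $ i)) = ?c"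
      by (rule prod.cong) auto
    finally show ?thesis .
  qed
  ultimately show ?thesis unfolding has_partial_def by (simp only: eq1 eq2)
qed

lemma continuous_on_coordinate_product:
  fixes f :: "'n::finite \<Rightarrow> real \<Rightarrow> complex"
  assumes "\<And>i. continuous_on UNIV (f i)"
  shows "continuous_on UNIV (\<lambda>x::real^'n. \<Prod>i\<in>UNIV. f i (x $ i))"
proof (rule continuous_on_prod)
  fix i
  show "continuous_on UNIV (\<lambda>x::real^'n. f i (x $ i))"
    by (rule continuous_on_compose2[OF assms, of _ "\<lambda>x. x $ i"]) (auto intro: continuous_intros)
qed

text \<open>A partial derivative of a product of functions of single coordinates is again such a product, with
  one factor replaced by its derivative. Smoothness in several variables thus reduces to the line.\<close>

lemma Ck_coordinate_product:
  fixes f :: "'n::finite \<Rightarrow> real \<Rightarrow> complex"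
  assumes "\<And>i. smooth_line k (f i)"
  shows "Ck k (\<lambda>x::real^'n. \<Prod>i\<in>UNIV. f i (x $ i))"
  using assms
proof (induction k arbitrary: f)
  case 0
  then show ?case by (simp add: continuous_on_coordinate_product)
next
  case (Suc k)
  have cont: "continuous_on UNIV (\<lambda>x::real^'n. \<Prod>i\<in>UNIV. f i (x $ i))"
    using Suc.prems[THEN smooth_line_continuous] by (rule continuous_on_coordinate_product)
  have "\<forall>i. \<exists>f'. (\<forall>t. (f i has_vector_derivative f' t) (at t)) \<and> smooth_line k f'"
    using Suc.prems by simp
  then obtain f' where f': "\<And>i t. (f i has_vector_derivative f' i t) (at t)" "\<And>i. smooth_line k (f' i)"
    by metis
  have der: "has_partial (\<lambda>x. \<Prod>i\<in>UNIV. f i (x $ i)) j x (\<Prod>i\<in>UNIV. (f(j := f' j)) i (x $ i))"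
    for j and x :: "real^'n"
    by (rule has_partial_coordinate_product) (rule f')
  have "partial j (\<lambda>x. \<Prod>i\<in>UNIV. f i (x $ i)) = (\<lambda>x. \<Prod>i\<in>UNIV. (f(j := f' j)) i (x $ i))" for j
    by (rule ext) (rule has_partial_imp_partial[OF der])
  moreover have "Ck k (\<lambda>x. \<Prod>i\<in>UNIV. (f(j := f' j)) i (x $ i))" for j
    by (rule Suc.IH) (use Suc.prems[THEN smooth_line_SucD] f'(2) in auto)
  moreover have "(\<lambda>t. \<Prod>i\<in>UNIV. f i ((x + t *\<^sub>R axis j 1) $ i)) differentiable at 0"
      for j and x :: "real^'n"
    using der[of j x] unfolding has_partial_def by (rule differentiableI_vector)
  ultimately show ?case
    unfolding Ck.simps using cont by (simp only: simp_thms)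
qed

text \<open>For \<open>t > 0\<close> the values \<open>exp (-1/(n t))\<close> tend to \<open>1\<close>, so these functions converge to the
  indicator of the open box while their supports stay in the closed box.\<close>

definition box_bump :: "real^'n \<Rightarrow> real^'n \<Rightarrow> nat \<Rightarrow> real^'n \<Rightarrow> complex" where
  "box_bump a b n x
      = (\<Prod>i\<in>UNIV. flat 1 (real (Suc n) * (x $ i - a $ i)) * flat 1 (real (Suc n) * (b $ i - x $ i)))"

lemma box_bump_nonzero_iff: "box_bump a b n x \<noteq> 0 \<longleftrightarrow> x \<in> box a b"
  by (auto simp: box_bump_def flat_def mem_box_cart zero_less_mult_iff)

lemma box_bump_norm_le_1: "cmod (box_bump a b n x) \<le> 1"
proof -
  have "cmod (flat 1 t) \<le> 1" for t
    by (auto simp: flat_def)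
  then show ?thesis unfolding box_bump_def
    by (auto intro!: order_trans[OF norm_prod_le] prod_le_1 simp: norm_mult mult_le_one)
qed

lemma box_bump_tendsto_indicator:
  "(\<lambda>n. box_bump a b n x) \<longlonglongrightarrow> indicator (box a b) x"
proof (cases "x \<in> box a b")
  case True
  have *: "(\<lambda>n. flat 1 (real (Suc n) * t)) \<longlonglongrightarrow> 1" if "t > 0" for t
  proof -
    have "(\<lambda>n. - (1 / t) * (1 / real (Suc n))) \<longlonglongrightarrow> - (1 / t) * 0"
      using LIMSEQ_inverse_real_of_nat by (intro tendsto_intros) (simp add: inverse_eq_divide)
    then have "(\<lambda>n. exp (- (1 / t) * (1 / real (Suc n)))) \<longlonglongrightarrow> exp 0"
      by (intro tendsto_exp) simp
    then have "(\<lambda>n. complex_of_real (exp (- (1 / t) * (1 / real (Suc n))))) \<longlonglongrightarrow> of_real (exp 0)"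
      by (rule tendsto_of_real)
    moreover have "flat 1 (real (Suc n) * t) = of_real (exp (- (1 / t) * (1 / real (Suc n))))" for n
      using that by (simp add: flat_def mult.commute zero_less_mult_iff)
    ultimately show ?thesis by simp
  qed
  have "(\<lambda>n. box_bump a b n x) \<longlonglongrightarrow> (\<Prod>i\<in>(UNIV::'a set). 1 * 1)"
    unfolding box_bump_def
    using True by (intro tendsto_prod tendsto_mult *) (auto simp: mem_box_cart)
  then show ?thesis using True by simp
next
  case False
  then have "box_bump a b n x = 0" for n using box_bump_nonzero_iff by metis
  then show ?thesis using False by simp
qed

lemma test_function_box_bump:
  assumes "cbox a b \<subseteq> S"
  shows "test_function S (box_bump a b n)"
proof -
  have "smooth_line k (\<lambda>t. flat 1 (real (Suc n) * (t - a $ i)) * flat 1 (real (Suc n) * (b $ i - t)))"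
      for i k
    using smooth_line_affine[OF smooth_line_flat, of k 1 "real (Suc n)" "- real (Suc n) * a $ i"]
      smooth_line_affine[OF smooth_line_flat, of k 1 "- real (Suc n)" "real (Suc n) * b $ i"]
    by (intro smooth_line_mult) (simp_all add: algebra_simps)
  then have "Ck k (box_bump a b n)" for k
    unfolding box_bump_def
    by (rule Ck_coordinate_product[where f
        = "\<lambda>i t. flat 1 (real (Suc n) * (t - a $ i)) * flat 1 (real (Suc n) * (b $ i - t))"])
  moreover have supp: "closure {x. box_bump a b n x \<noteq> 0} \<subseteq> cbox a b"
    by (rule closure_minimal) (use box_subset_cbox in \<open>auto simp: box_bump_nonzero_iff\<close>)
  moreover have "compact (closure {x. box_bump a b n x \<noteq> 0})"
    using supp bounded_subset[OF bounded_cbox] by (auto simp: compact_eq_bounded_closed)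
  ultimately show ?thesis using assms unfolding test_function_def by auto
qed

section \<open>Uniqueness of weak gradients\<close>

text \<open>Open boxes generate the Borel sets and are stable under intersections, so the integrals over all Borel
  sets vanish. A Borel representative of \<open>f\<close> is used because the generated sets are Borel sets.\<close>

lemma AE_eq_0_if_box_integrals_eq_0:
  fixes f :: "'a::euclidean_space \<Rightarrow> complex"
  assumes f: "integrable lebesgue f" and bdd: "bounded {x. f x \<noteq> 0}"
    and box: "\<And>a b. (LINT x:box a b|lebesgue. f x) = 0"
  shows "AE x in lebesgue. f x = 0"
proof -
  have "(\<lambda>x. Re (f x)) \<in> borel_measurable lebesgue" "(\<lambda>x. Im (f x)) \<in> borel_measurable lebesgue"
    using f by measurable
  from this[THEN completion_ex_borel_measurable_real]
  obtain g1 g2 :: "'a \<Rightarrow> real" where g [measurable]: "g1 \<in> borel_measurable lborel" "g2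
      \<in> borel_measurable lborel"
    and eq: "AE x in lborel. Re (f x) = g1 x" "AE x in lborel. Im (f x) = g2 x"
    by blast
  define g where "g x = Complex (g1 x) (g2 x)" for x
  have g_meas [measurable]: "g \<in> borel_measurable lborel" unfolding g_def Complex_eq by measurable
  have "AE x in lborel. f x = g x"
    using eq by eventually_elim (simp add: g_def complex_eq_iff)
  then have fg: "AE x in lebesgue. f x = g x" by (rule AE_completion)
  have "integrable lebesgue g"
    using f by (rule integrable_cong_AE_imp) (use g_meas fg in \<open>auto intro: measurable_completion\<close>)
  then have int: "integrable lborel g" by (simp add: integrable_completion)
  have set_eq: "(LINT x:A|lborel. g x) = (LINT x:A|lebesgue. f x)" if "A \<in> sets borel" for A
  proof -
    have "(LINT x:A|lborel. g x) = (LINT x:A|lebesgue. g x)"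
      unfolding set_lebesgue_integral_def using that by (subst integral_completion) auto
    also have "\<dots> = (LINT x:A|lebesgue. f x)"
      by (rule set_lebesgue_integral_cong_AE)
        (use that fg f in \<open>auto intro: measurable_completion\<close>)
    finally show ?thesis .
  qed
  have g_box: "(LINT x:box a b|lborel. g x) = 0" for a b
    using set_eq[of "box a b"] box by simp
  obtain c :: 'a where c: "{x. f x \<noteq> 0} \<subseteq> box (- c) c"
    using bounded_subset_box_symmetric[OF bdd] by blast
  have "(LINT x|lebesgue. f x) = (LINT x:box (- c) c|lebesgue. f x)"
    unfolding set_lebesgue_integral_def using c
        by (intro Bochner_Integration.integral_cong) (auto simp: indicator_def)
  then have "(LINT x|lebesgue. f x) = 0" by (simp add: box)
  moreover have "(LINT x|lebesgue. f x) = (LINT x|lborel. g x)"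
    using set_eq[of UNIV] by (simp add: set_lebesgue_integral_def)
  ultimately have g_UNIV: "(LINT x|lborel. g x) = 0" by simp
  have g_int: "set_integrable lborel A g" if "A \<in> sets borel" for A
    using int that by (simp add: set_integrable_def integrable_mult_indicator)
  have "(LINT x:A|lborel. g x) = 0" if "A \<in> sets lborel" for A
  proof -
    have "A \<in> sigma_sets UNIV (range (\<lambda>(a::'a, b). box a b))"
      using that borel_eq_box[where 'a='a] by (metis sets_lborel sets_measure_of top_greatest Pow_UNIV)
    moreover have borel: "B \<in> sets borel" if "B \<in> sigma_sets UNIV (range (\<lambda>(a::'a, b). box a b))" for B
      using that borel_eq_box[where 'a='a] by (metis sets_measure_of top_greatest Pow_UNIV)
    ultimately show ?thesis
    proof (induction rule: sigma_sets_induct_disjoint[rotated 2, consumes 1])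
      case 1
      then show ?case by (auto simp: g_box)
    next
      case 2
      then show ?case by (simp add: set_lebesgue_integral_def)
    next
      case (3 A)
      have A: "A \<in> sets borel" using 3(1) borel by blast
      have "(LINT x:(UNIV - A) \<union> A|lborel. g x) = (LINT x:UNIV - A|lborel. g x)
          + (LINT x:A|lborel. g x)"
        by (rule set_integral_Un) (use A g_int in auto)
      then show ?case using g_UNIV 3 by (simp add: set_lebesgue_integral_def)
    next
      case (4 A)
      have A: "A i \<in> sets borel" for i using 4(2) borel by blast
      have "(LINT x:(\<Union>i. A i)|lborel. g x) = (\<Sum>i. LINT x:A i|lborel. g x)"
        by (rule lebesgue_integral_countable_add)
          (use A 4(1) in \<open>auto simp: disjoint_family_on_def intro!: g_int\<close>)
      then show ?case using 4 by simp
    next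
      case 5
      show "Int_stable (range (\<lambda>(a::'a, b). box a b))"
        by (auto simp: Int_stable_def box_Int_box intro!: image_eqI)
    qed auto
  qed
  then have "AE x in lborel. g x = (\<lambda>_. 0) x"
    by (intro sigma_finite_measure.density_unique_banach int sigma_finite_lborel)
      (simp_all add: set_lebesgue_integral_def)
  then have "AE x in lebesgue. g x = 0" by (intro AE_completion) simp
  with fg show ?thesis by eventually_elim simp
qed

text \<open>The fundamental lemma of the calculus of variations: the bumps of a box turn orthogonality to test functions
  into vanishing integrals over boxes, and countably many closed boxes exhaust \<open>S\<close>.\<close>

lemma AE_eq_0_if_orthogonal_to_test_functions:
  fixes g :: "real^'n \<Rightarrow> complex"
  assumes S: "open S"
    and loc: "\<And>K. compact K \<Longrightarrow> K \<subseteq> S \<Longrightarrow> g absolutely_integrable_on K"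
    and test: "\<And>\<phi>. test_function S \<phi> \<Longrightarrow> (LINT x|lebesgue_on S. g x * \<phi> x) = 0"
  shows "AE x in lebesgue_on S. g x = 0"
proof -
  have box0: "(LINT x:box a b|lebesgue. g x) = 0" if ab: "cbox a b \<subseteq> S" for a b
  proof -
    have g: "integrable lebesgue (\<lambda>x. indicator (cbox a b) x *\<^sub>R g x)"
      using loc[of "cbox a b"] ab by (simp add: set_integrable_def)
    let ?F = "\<lambda>n x. (indicator (cbox a b) x *\<^sub>R g x) * box_bump a b n x"
    have supp: "box_bump a b n x = 0" if "x \<notin> cbox a b" for n x
      using that box_bump_nonzero_iff box_subset_cbox by blast
    have F0: "(LINT x|lebesgue. ?F n x) = 0" for n
    proof -
      have "(LINT x|lebesgue_on S. g x * box_bump a b n x) = 0"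
        by (intro test test_function_box_bump ab)
      moreover have "(LINT x|lebesgue_on S. g x * box_bump a b n x) = (LINT x|lebesgue. ?F n x)"
        using S ab supp
        by (subst integral_restrict_space)
          (auto simp: borel_open indicator_def intro!: Bochner_Integration.integral_cong)
      ultimately show ?thesis by simp
    qed
    have bump_meas: "box_bump a b n \<in> borel_measurable lebesgue" for n
    proof -
      have "Ck 0 (box_bump a b n)"
        using test_function_box_bump[of a b UNIV n] unfolding test_function_def by blast
      then have "continuous_on UNIV (box_bump a b n)" by simp
      then have "box_bump a b n \<in> borel_measurable borel" by (rule borel_measurable_continuous_onI)
      then show ?thesis by (intro measurable_completion) simp
    qed
    have "(\<lambda>n. LINT x|lebesgue. ?F n x)
        \<longlonglongrightarrow> (LINT x|lebesgue. (indicator (cbox a b) x *\<^sub>R g x) * indicator (box a b) x)"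
    proof (rule integral_dominated_convergence)
      show "integrable lebesgue (\<lambda>x. norm (indicator (cbox a b) x *\<^sub>R g x))"
        using g by (rule integrable_norm)
      show "AE x in lebesgue. (\<lambda>n. ?F n x) \<longlonglongrightarrow> (indicator (cbox a b) x *\<^sub>R g x) * indicator (box a b) x"
        by (intro AE_I2 tendsto_intros box_bump_tendsto_indicator)
      show "AE x in lebesgue. norm (?F n x) \<le> norm (indicator (cbox a b) x *\<^sub>R g x)" for n
        by (intro AE_I2) (simp only: norm_mult mult_left_le[OF box_bump_norm_le_1] norm_ge_zero)
      show "?F n \<in> borel_measurable lebesgue" for n
        using borel_measurable_integrable[OF g] bump_meas by (rule borel_measurable_times)
      show "(\<lambda>x. (indicator (cbox a b) x *\<^sub>R g x) * indicator (box a b) x) \<in> borel_measurable lebesgue"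
        using borel_measurable_integrable[OF g]
        by (rule borel_measurable_times) (auto intro!: borel_measurable_indicator)
    qed
    then have "(LINT x|lebesgue. (indicator (cbox a b) x *\<^sub>R g x) * indicator (box a b) x) = 0"
      unfolding F0 by (simp add: LIMSEQ_const_iff)
    moreover have "(indicator (cbox a b) x *\<^sub>R g x) * indicator (box a b) x
        = indicator (box a b) x *\<^sub>R g x" for x
      using box_subset_cbox[of a b] by (auto simp: indicator_def)
    ultimately show ?thesis by (simp add: set_lebesgue_integral_def)
  qed
  have cbox_AE: "AE x in lebesgue. x \<in> cbox a b \<longrightarrow> g x = 0" if ab: "cbox a b \<subseteq> S" for a b
  proof -
    let ?f = "\<lambda>x. indicator (box a b) x *\<^sub>R g x"
    have "AE x in lebesgue. ?f x = 0"
    proof (rule AE_eq_0_if_box_integrals_eq_0)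
      have "integrable lebesgue (\<lambda>x. indicator (cbox a b) x *\<^sub>R g x)"
        using loc[of "cbox a b"] ab by (simp add: set_integrable_def)
      then have "integrable lebesgue (\<lambda>x. indicator (box a b) x *\<^sub>R (indicator (cbox a b) x *\<^sub>R g x))"
        by (rule integrable_mult_indicator[rotated]) auto
      moreover have "(\<lambda>x. indicator (box a b) x *\<^sub>R (indicator (cbox a b) x *\<^sub>R g x)) = ?f"
        using box_subset_cbox[of a b] by (auto simp: indicator_def fun_eq_iff)
      ultimately show "integrable lebesgue ?f" by (simp only:)
      show "bounded {x. ?f x \<noteq> 0}"
        by (rule bounded_subset[OF bounded_box[of a b]]) (auto simp: indicator_def)
      fix c d
      obtain a' b' where ab': "box a b \<inter> box c d = box a' b'" using box_Int_box by blast
      have "(LINT x:box c d|lebesgue. ?f x) = (LINT x:box a b \<inter> box c d|lebesgue. g x)"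
        unfolding set_lebesgue_integral_def
        by (intro Bochner_Integration.integral_cong) (auto simp: indicator_def)
      also have "\<dots> = (LINT x:box a' b'|lebesgue. g x)" by (simp only: ab')
      also have "\<dots> = 0"
      proof (cases "box a' b' = {}")
        case True
        then show ?thesis by (simp add: set_lebesgue_integral_def)
      next
        case False
        then have "cbox a' b' = closure (box a' b')" by (simp add: closure_box)
        also have "\<dots> \<subseteq> cbox a b"
          by (rule closure_minimal) (use ab' box_subset_cbox[of a b] in auto)
        finally show ?thesis using ab by (intro box0) auto
      qed
      finally show "(LINT x:box c d|lebesgue. ?f x) = 0" .
    qed
    moreover have "AE x in lebesgue. x \<notin> cbox a b - box a b"
      using AE_not_in[OF null_sets_cbox_Diff_box] by (rule AE_completion)
    ultimately show ?thesis by eventually_elim (auto simp: indicator_def split: if_splits)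
  qed
  obtain D where D: "countable D" "D \<subseteq> Pow S" "\<And>X. X \<in> D \<Longrightarrow> \<exists>a b. X = cbox a b" "\<Union> D = S"
    using open_countable_Union_open_cbox[OF S] by metis
  have "AE x in lebesgue. \<forall>X\<in>D. x \<in> X \<longrightarrow> g x = 0"
    unfolding AE_ball_countable[OF D(1)]
  proof
    fix X assume X: "X \<in> D"
    then obtain a b where "X = cbox a b" using D(3) by blast
    then show "AE x in lebesgue. x \<in> X \<longrightarrow> g x = 0" using cbox_AE D(2) X by blast
  qed
  then have "AE x in lebesgue. x \<in> S \<longrightarrow> g x = 0"
    by eventually_elim (use D(4) in blast)
  then show ?thesis using S by (subst AE_restrict_space_iff) (auto simp: borel_open)
qed

lemma weak_gradient_unique:
  assumes "is_weak_gradient u g" "is_weak_gradient u h"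
  shows "AE x in lebesgue_on (ball 0 1). g x = h x"
proof -
  have "AE x in lebesgue_on (ball 0 1). g x $ i - h x $ i = 0" for i
  proof (rule AE_eq_0_if_orthogonal_to_test_functions)
    show "(\<lambda>x. g x $ i - h x $ i) absolutely_integrable_on K" if "compact K" "K \<subseteq> ball 0 1" for K
      using assms that unfolding is_weak_gradient_def by (intro set_integral_diff) blast+
    fix \<phi> :: "real^'a \<Rightarrow> complex"
    assume t: "test_function (ball 0 1) \<phi>"
    define K where "K = closure {x. \<phi> x \<noteq> 0}"
    have K: "compact K" "K \<subseteq> ball 0 1" using t unfolding test_function_def K_def by auto
    have z: "x \<notin> K \<Longrightarrow> \<phi> x = 0" for x
      using closure_subset[of "{x. \<phi> x \<noteq> 0}"] unfolding K_def by auto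
    have "Ck 0 \<phi>" using t unfolding test_function_def by blast
    then have cont: "continuous_on UNIV \<phi>" by simp
    have int: "integrable (lebesgue_on (ball 0 1)) (\<lambda>x. k x $ i * \<phi> x)" if "is_weak_gradient u k" for k
    proof -
      have "(\<lambda>x. \<phi> x * k x $ i) absolutely_integrable_on K"
      proof (rule absolutely_integrable_bounded_measurable_product[OF bilinear_times])
        show "K \<in> sets lebesgue" using K(1) by (simp add: borel_compact)
        then show "\<phi> \<in> borel_measurable (lebesgue_on K)"
          by (intro continuous_imp_measurable_on_sets_lebesgue continuous_on_subset[OF cont]) auto
        show "bounded (\<phi> ` K)"
          by (intro compact_imp_bounded compact_continuous_image continuous_on_subset[OF cont] K) auto
        show "(\<lambda>x. k x $ i) absolutely_integrable_on K"
          using that K unfolding is_weak_gradient_def by blast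
      qed
      moreover have "(\<lambda>x. indicator K x *\<^sub>R (\<phi> x * k x $ i))
          = (\<lambda>x. indicator (ball 0 1) x *\<^sub>R (k x $ i * \<phi> x))"
        using K(2) z by (auto simp: indicator_def fun_eq_iff)
      ultimately show ?thesis
        by (subst integrable_restrict_space) (simp_all add: set_integrable_def del: mult_scaleR_left)
    qed
    have parts: "(LINT x|lebesgue_on (ball 0 1). k x $ i * \<phi> x) =
        - (LINT x|lebesgue_on (ball 0 1). u x * partial i \<phi> x)" if "is_weak_gradient u k" for k
      using that t unfolding is_weak_gradient_def by simp
    have "(LINT x|lebesgue_on (ball 0 1). g x $ i * \<phi> x)
        = (LINT x|lebesgue_on (ball 0 1). h x $ i * \<phi> x)"
      using parts[OF assms(1)] parts[OF assms(2)] by (simp only:)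
    then show "(LINT x|lebesgue_on (ball 0 1). (g x $ i - h x $ i) * \<phi> x) = 0"
      using int[OF assms(1)] int[OF assms(2)] by (simp add: left_diff_distrib)
  qed auto
  then have "AE x in lebesgue_on (ball 0 1). \<forall>i. g x $ i - h x $ i = 0"
    by (simp add: AE_all_countable)
  then show ?thesis by eventually_elim (simp add: vec_eq_iff)
qed

text \<open>Any explicit weak gradient may thus replace the chosen one under an integral.\<close>

lemma weak_gradient_AE_eq:
  assumes "is_weak_gradient u g"
  shows "AE x in lebesgue_on (ball 0 1). weak_gradient u x = g x"
proof -
  have "is_weak_gradient u (weak_gradient u)"
    unfolding weak_gradient_def using assms by (rule someI[where P = "is_weak_gradient u"])
  then show ?thesis using assms by (rule weak_gradient_unique)
qed

section \<open>Gradients on the punctured ball\<close>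

lemma integral_lebesgue_on_eq_lborel:
  fixes f :: "'a::euclidean_space \<Rightarrow> 'b::{banach, second_countable_topology}"
  assumes [measurable]: "f \<in> borel_measurable borel" "S \<in> sets borel"
  shows "(LINT x|lebesgue_on S. f x) = (LINT x:S|lborel. f x)"
    "integrable (lebesgue_on S) f \<longleftrightarrow> set_integrable lborel S f"
proof -
  show "(LINT x|lebesgue_on S. f x) = (LINT x:S|lborel. f x)"
    by (subst integral_restrict_space) (auto simp: set_lebesgue_integral_def integral_completion)
  show "integrable (lebesgue_on S) f \<longleftrightarrow> set_integrable lborel S f"
    by (subst integrable_restrict_space) (auto simp: set_integrable_def integrable_completion)
qed

text \<open>On the shell \<open>2\<^sup>-\<^sup>k\<^sup>-\<^sup>1 \<le> |x| < 2\<^sup>-\<^sup>k\<close> the function is at most \<open>4\<^sup>k\<^sup>+\<^sup>1\<close>, and the ball around the shell has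
  volume proportional to \<open>2\<^sup>-\<^sup>k\<^sup>d\<close>. For \<open>d \<ge> 3\<close> the products are bounded by a geometric series.\<close>

lemma integrable_norm_minus_2_ball:
  assumes d: "CARD('n::finite) \<ge> 3"
  shows "integrable lborel (\<lambda>x::real^'n. indicator (ball 0 1) x * (1 / norm x)\<^sup>2)"
proof (rule integrableI_nonneg)
  have [measurable]: "ball (0::real^'n) r \<in> sets borel" for r by simp
  show "(\<lambda>x::real^'n. indicator (ball 0 1) x * (1 / norm x)\<^sup>2) \<in> borel_measurable lborel"
    by measurable
  show "AE x::real^'n in lborel. 0 \<le> indicator (ball 0 1) x * (1 / norm x)\<^sup>2" by simp
  define v where "v = unit_ball_vol (real DIM(real^'n))"
  have v: "v \<ge> 0" by (simp add: v_def)
  let ?t = "\<lambda>k x. ennreal (4 ^ Suc k) * indicator (ball 0 ((1/2) ^ k)) (x::real^'n)"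
  have le: "ennreal (indicator (ball 0 1) x * (1 / norm x)\<^sup>2) \<le> (\<Sum>k. ?t k x)" for x :: "real^'n"
  proof (cases "x = 0 \<or> norm x \<ge> 1")
    case True
    then have "indicator (ball 0 1) x * (1 / norm x)\<^sup>2 = (0::real)" by auto
    then show ?thesis by (simp only: ennreal_0 zero_le)
  next
    case False
    then have x: "0 < norm x" "norm x < 1" by auto
    \<comment> \<open>\<open>n = k + 1\<close> for the index \<open>k\<close> of the dyadic shell that contains \<open>x\<close>.\<close>
    define n where "n = (LEAST n. (1/2) ^ n \<le> norm x)"
    obtain n' where "(1/2) ^ n' < norm x" using real_arch_pow_inv[of "norm x" "1/2"] x by auto
    then have "\<exists>n. (1/2) ^ n \<le> norm x" by (intro exI[of _ n']) simp
    then have n: "(1/2) ^ n \<le> norm x" unfolding n_def by (rule LeastI_ex)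
    then obtain k where k: "n = Suc k" using x by (cases n) auto
    have "k < n" using k by simp
    then have "\<not> (1/2) ^ k \<le> norm x" unfolding n_def by (rule not_less_Least)
    then have "indicator (ball 0 ((1/2) ^ k)) x = (1::ennreal)" by (auto simp: indicator_def)
    moreover have "(1 / norm x)\<^sup>2 \<le> 4 ^ Suc k"
    proof -
      have "1 / norm x \<le> 1 / (1/2) ^ n" using n x by (intro divide_left_mono) auto
      then have "1 / norm x \<le> 2 ^ n" by (simp add: power_one_over)
      then have "(1 / norm x)\<^sup>2 \<le> (2 ^ n)\<^sup>2" using x by (intro power_mono) auto
      also have "\<dots> = 4 ^ Suc k"
        unfolding k power2_eq_square power_mult_distrib[symmetric] by simp
      finally show ?thesis .
    qed
    moreover have "indicator (ball 0 1) x = (1::real)" using x by simp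
    ultimately have "ennreal (indicator (ball 0 1) x * (1 / norm x)\<^sup>2) \<le> ?t k x"
      by (simp only: mult_1_left mult_1_right ennreal_leI)
    also have "\<dots> \<le> (\<Sum>k. ?t k x)"
      using sum_le_suminf[of "\<lambda>k. ?t k x" "{k}"]
          by (simp only: summableI finite.intros zero_le ball_simps sum.insert sum.empty empty_iff add_0_right simp_thms)
    finally show ?thesis .
  qed
  have "(\<integral>\<^sup>+x. ennreal (indicator (ball 0 1) (x::real^'n) * (1 / norm x)\<^sup>2) \<partial>lborel)
      \<le> (\<integral>\<^sup>+x. (\<Sum>k. ?t k x) \<partial>lborel)"
    by (intro nn_integral_mono le)
  also have "\<dots> = (\<Sum>k. \<integral>\<^sup>+x. ?t k x \<partial>lborel)"
    by (rule nn_integral_suminf) measurable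
  also have "\<dots> = (\<Sum>k. ennreal (4 ^ Suc k * (v * ((1/2) ^ k) ^ CARD('n))))"
    by (intro suminf_cong)
      (simp add: nn_integral_cmult_indicator emeasure_ball v_def ennreal_mult')
  also have "\<dots> \<le> (\<Sum>k. ennreal (4 * v * (1/2) ^ k))"
  proof (intro suminf_le ennreal_leI allI)
    fix k
    have "((1/2::real) ^ k) ^ CARD('n) \<le> ((1/2) ^ k) ^ 3"
      by (rule power_decreasing[OF d]) (auto simp: power_le_one)
    then have "4 ^ Suc k * (v * ((1/2) ^ k) ^ CARD('n)) \<le> 4 ^ Suc k * (v * ((1/2) ^ k) ^ 3)"
      by (intro mult_left_mono v) auto
    also have "((1/2::real) ^ k) ^ 3 = (1/8) ^ k"
      unfolding power3_eq_cube power_mult_distrib[symmetric] by simp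
    also have "4 ^ Suc k * (v * (1/8) ^ k) = 4 * v * (4 ^ k * (1/8) ^ k)" by simp
    also have "(4::real) ^ k * (1/8) ^ k = (1/2) ^ k"
      unfolding power_mult_distrib[symmetric] by simp
    finally show "4 ^ Suc k * (v * ((1/2) ^ k) ^ CARD('n)) \<le> 4 * v * (1/2) ^ k" .
  qed (simp_all only: summableI)
  also have "\<dots> = ennreal (\<Sum>k. 4 * v * (1/2) ^ k)"
    using v by (intro suminf_ennreal2 summable_mult summable_geometric) simp_all
  also have "\<dots> < \<infinity>" by simp
  finally show "(\<integral>\<^sup>+x. ennreal (indicator (ball 0 1) (x::real^'n) * (1 / norm x)\<^sup>2) \<partial>lborel) < \<infinity>" .
qed

lemma integrable_if_inverse_square_bound:
  fixes f :: "real^'n \<Rightarrow> 'b::{banach, second_countable_topology}"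
  assumes d: "CARD('n) \<ge> 3" and f: "f \<in> borel_measurable borel"
    and zero: "\<And>x. norm x \<ge> 1 \<Longrightarrow> f x = 0"
    and bound: "\<And>x. 0 < norm x \<Longrightarrow> norm x < 1 \<Longrightarrow> norm (f x) \<le> K / (norm x)\<^sup>2"
  shows "integrable lborel f"
proof (rule Bochner_Integration.integrable_bound)
  show "integrable lborel (\<lambda>x::real^'n. K * (indicator (ball 0 1) x * (1 / norm x)\<^sup>2))"
    by (intro integrable_mult_right integrable_norm_minus_2_ball d)
  show "AE x in lborel. norm (f x) \<le> norm (K * (indicator (ball 0 1) x * (1 / norm x)\<^sup>2))"
    using AE_lborel_singleton[of 0]
  proof eventually_elim
    case (elim x)
    then show ?case
      using zero[of x] order_trans[OF bound abs_ge_self, of x]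
      by (cases "norm x < 1") (simp_all add: power_divide)
  qed
qed (use f in simp)

text \<open>This radial factor vanishes to second order at the origin and tends to \<open>1\<close> elsewhere as
  \<open>\<epsilon> \<rightarrow> 0\<close>. Multiplication by it makes a bounded function differentiable at the origin, and its
  derivative is at most \<open>2/t\<close> for every \<open>\<epsilon>\<close>, which is what dominated convergence needs.\<close>

definition cutoff :: "real \<Rightarrow> real \<Rightarrow> real" where
  "cutoff \<epsilon> t = t\<^sup>2 / (t\<^sup>2 + \<epsilon>)"

definition cutoff_deriv :: "real \<Rightarrow> real \<Rightarrow> real" where
  "cutoff_deriv \<epsilon> t = 2 * t * \<epsilon> / (t\<^sup>2 + \<epsilon>)\<^sup>2"

lemma cutoff_has_derivative:
  assumes "\<epsilon> > 0" shows "(cutoff \<epsilon> has_real_derivative cutoff_deriv \<epsilon> t) (at t)"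
proof -
  have "t\<^sup>2 + \<epsilon> \<noteq> 0" using assms by (simp add: add_nonneg_eq_0_iff)
  then show ?thesis
    unfolding cutoff_def[abs_def] cutoff_deriv_def
    by (auto intro!: derivative_eq_intros simp: power2_eq_square algebra_simps)
qed

lemma cutoff_bounds:
  assumes e: "\<epsilon> > 0"
  shows "0 \<le> cutoff \<epsilon> t" "cutoff \<epsilon> t \<le> 1" "cutoff \<epsilon> t \<le> t\<^sup>2 / \<epsilon>"
    "t \<ge> 0 \<Longrightarrow> 0 \<le> cutoff_deriv \<epsilon> t" "t \<ge> 0 \<Longrightarrow> cutoff_deriv \<epsilon> t \<le> 2 * t / \<epsilon>"
    "t > 0 \<Longrightarrow> cutoff_deriv \<epsilon> t \<le> 2 / t"
proof -
  have p: "t\<^sup>2 + \<epsilon> > 0" using e by (simp add: add_nonneg_pos)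
  show "0 \<le> cutoff \<epsilon> t" "cutoff \<epsilon> t \<le> 1" "t \<ge> 0 \<Longrightarrow> 0 \<le> cutoff_deriv \<epsilon> t"
    using e p by (auto simp: cutoff_def cutoff_deriv_def)
  show "cutoff \<epsilon> t \<le> t\<^sup>2 / \<epsilon>"
    unfolding cutoff_def using e p by (intro divide_left_mono) auto
  have sq: "\<epsilon>\<^sup>2 \<le> (t\<^sup>2 + \<epsilon>)\<^sup>2" "t\<^sup>2 * \<epsilon> \<le> (t\<^sup>2 + \<epsilon>)\<^sup>2"
    using e unfolding power2_eq_square[of "t\<^sup>2 + \<epsilon>"]
    by (auto simp: power2_eq_square[of \<epsilon>] intro!: mult_mono)
  show "cutoff_deriv \<epsilon> t \<le> 2 * t / \<epsilon>" if "t \<ge> 0"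
  proof -
    have "2 * t * \<epsilon> * \<epsilon> \<le> 2 * t * (t\<^sup>2 + \<epsilon>)\<^sup>2"
      using mult_left_mono[OF sq(1), of "2 * t"] that by (simp add: power2_eq_square mult_ac)
    then show ?thesis using e p by (simp add: cutoff_deriv_def field_simps)
  qed
  show "cutoff_deriv \<epsilon> t \<le> 2 / t" if "t > 0"
  proof -
    have "2 * t * \<epsilon> * t \<le> 2 * (t\<^sup>2 + \<epsilon>)\<^sup>2"
      using sq(2) by (simp add: power2_eq_square[of t] mult_ac)
    then show ?thesis using e p that by (simp add: cutoff_deriv_def divide_le_eq le_divide_eq mult_ac)
  qed
qed

lemma cutoff_tendsto:
  assumes "t > 0" "\<epsilon> \<longlonglongrightarrow> 0"
  shows "(\<lambda>n. cutoff (\<epsilon> n) t) \<longlonglongrightarrow> 1" "(\<lambda>n. cutoff_deriv (\<epsilon> n) t) \<longlonglongrightarrow> 0"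
proof -
  have "(\<lambda>n. t\<^sup>2 / (t\<^sup>2 + \<epsilon> n)) \<longlonglongrightarrow> t\<^sup>2 / (t\<^sup>2 + 0)"
    using assms by (intro tendsto_intros) auto
  then show "(\<lambda>n. cutoff (\<epsilon> n) t) \<longlonglongrightarrow> 1" using assms by (simp add: cutoff_def)
  have "(\<lambda>n. 2 * t * \<epsilon> n / (t\<^sup>2 + \<epsilon> n)\<^sup>2) \<longlonglongrightarrow> 2 * t * 0 / (t\<^sup>2 + 0)\<^sup>2"
    using assms by (intro tendsto_intros) auto
  then show "(\<lambda>n. cutoff_deriv (\<epsilon> n) t) \<longlonglongrightarrow> 0" by (simp add: cutoff_deriv_def)
qed

text \<open>A gradient of size \<open>O(1/|x|)\<close> does not see the origin: multiply \<open>w\<close> by \<open>cutoff\<close>, apply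
  \<open>integral_partial_eq_0\<close> and let \<open>\<epsilon>\<close> tend to zero. Both terms of the product rule are dominated by a
  multiple of \<open>|x|\<^sup>-\<^sup>2\<close>.\<close>

lemma integral_partial_eq_0_punctured:
  fixes w :: "real^'n \<Rightarrow> complex"
  assumes d: "CARD('n) \<ge> 3"
    and meas [measurable]: "w \<in> borel_measurable borel" "D \<in> borel_measurable borel"
    and zero: "\<And>x. norm x \<ge> 1 \<Longrightarrow> D x = 0" "\<And>x. norm x \<ge> 1 \<Longrightarrow> w x = 0"
    and der: "\<And>x. x \<noteq> 0 \<Longrightarrow> has_partial w i x (D x)"
    and bdd: "\<And>x. cmod (w x) \<le> B"
    and D_bound: "\<And>x. 0 < norm x \<Longrightarrow> norm x < 1 \<Longrightarrow> cmod (D x) \<le> C / norm x"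
  shows "(LINT x|lborel. D x) = 0"
proof -
  have B: "0 \<le> B" using bdd[of 0] by (rule order_trans[OF norm_ge_zero])
  have C: "0 \<le> C"
  proof -
    have "0 \<le> cmod (D ((1/2) *\<^sub>R axis i 1))" by simp
    also have "\<dots> \<le> C / norm ((1/2) *\<^sub>R (axis i 1 :: real^'n))" by (rule D_bound) auto
    finally show ?thesis by simp
  qed
  define \<epsilon> where "\<epsilon> n = 1 / real (Suc n)" for n
  have e: "\<epsilon> n > 0" for n by (simp add: \<epsilon>_def)
  have e_lim: "\<epsilon> \<longlonglongrightarrow> 0"
    using LIMSEQ_inverse_real_of_nat by (simp add: \<epsilon>_def[abs_def] inverse_eq_divide)
  define c where "c n x = complex_of_real (cutoff (\<epsilon> n) (norm x))" for n and x :: "real^'n"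
  define c' where "c' n x = complex_of_real (x $ i / norm x * cutoff_deriv (\<epsilon> n) (norm x))"
      for n and x :: "real^'n"
  define D' where "D' n x = c n x * D x + c' n x * w x" for n x
  have c'_le: "cmod (c' n x) \<le> cutoff_deriv (\<epsilon> n) (norm x)" for n x
  proof -
    have "\<bar>x $ i\<bar> / norm x \<le> 1"
      using component_le_norm_cart[of x i] by (cases "x = 0") (auto simp: divide_le_eq_1)
    then show ?thesis
      using cutoff_bounds(4)[OF e[of n], of "norm x"]
      unfolding c'_def norm_of_real abs_mult abs_divide
      by (simp only: abs_of_nonneg abs_norm_cancel norm_ge_zero mult_left_le_one_le
          divide_nonneg_nonneg abs_ge_zero)
  qed
  have c_le: "cmod (c n x) \<le> 1" "cmod (c n x) \<le> (norm x)\<^sup>2 / \<epsilon> n" for n x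
    using cutoff_bounds(1-3)[OF e[of n], of "norm x"] by (auto simp: c_def)
  have int0: "(LINT x|lborel. D' n x) = 0" for n
  proof (rule integral_partial_eq_0(2))
    show "(\<lambda>x. c n x * w x) \<in> borel_measurable borel"
      unfolding c_def cutoff_def by measurable
    show "c n x * w x = 0" if "1 \<le> norm x" for x using zero that by simp
    show "cmod (c n x * w x) \<le> B" for x
      using mult_mono[OF c_le(1) bdd, of x] B by (simp add: norm_mult)
    show "has_partial (\<lambda>x. c n x * w x) i x (D' n x)" for x
    proof (cases "x = 0")
      case False
      have "((\<lambda>t. complex_of_real (cutoff (\<epsilon> n) t)) has_vector_derivative of_real (cutoff_deriv (\<epsilon> n) (norm x))) (at (norm x))"
        using cutoff_has_derivative[OF e]
        by (intro has_vector_derivative_of_real) (simp add: has_real_derivative_iff_has_vector_derivative)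
      from has_partial_radial[OF this False, of i]
      have "has_partial (c n) i x (c' n x)" by (simp add: c_def[abs_def] c'_def)
      from has_partial_mult[OF this der[OF False]] show ?thesis by (simp add: D'_def)
    next
      case True
      let ?f = "\<lambda>t. c n (t *\<^sub>R axis i 1) * w (t *\<^sub>R axis i 1)"
      have le: "norm (?f h) / norm h \<le> \<bar>h\<bar> * (B / \<epsilon> n)" if "h \<noteq> 0" for h
      proof -
        have "norm (?f h) \<le> (\<bar>h\<bar>\<^sup>2 / \<epsilon> n) * B"
          unfolding norm_mult using c_le(2)[of n "h *\<^sub>R axis i 1"] e[of n]
          by (intro mult_mono bdd) auto
        then show ?thesis using that e[of n] by (simp add: field_simps power2_eq_square)
      qed
      have "((\<lambda>h. norm (?f h) / norm h) \<longlongrightarrow> 0) (at 0)"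
      proof (rule Lim_null_comparison)
        show "((\<lambda>h. \<bar>h\<bar> * (B / \<epsilon> n)) \<longlongrightarrow> 0) (at 0)"
          using e[of n] by (auto intro!: tendsto_eq_intros)
        show "\<forall>\<^sub>F h in at 0. norm (norm (?f h) / norm h) \<le> \<bar>h\<bar> * (B / \<epsilon> n)"
          using le by (auto simp: eventually_at_filter)
      qed
      moreover have "c n 0 = 0" "D' n 0 = 0" by (auto simp: c_def cutoff_def D'_def c'_def)
      ultimately show ?thesis
        using True unfolding has_partial_def has_vector_derivative_def has_derivative_at by simp
    qed
    show "cmod (D' n x) \<le> (C + 2 * B) / \<epsilon> n" for x
    proof (cases "0 < norm x \<and> norm x < 1")
      case True
      have "cmod (c n x) * cmod (D x) \<le> ((norm x)\<^sup>2 / \<epsilon> n) * (C / norm x)"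
        using True e[of n] by (intro mult_mono c_le D_bound) auto
      also have "\<dots> = norm x * (C / \<epsilon> n)" using True by (simp add: power2_eq_square)
      also have "\<dots> \<le> 1 * (C / \<epsilon> n)" using True C e[of n] by (intro mult_right_mono) auto
      finally have 1: "cmod (c n x) * cmod (D x) \<le> C / \<epsilon> n" by simp
      have "cmod (c' n x) * cmod (w x) \<le> 2 * norm x / \<epsilon> n * B"
        using e[of n] B by (intro mult_mono order_trans[OF c'_le cutoff_bounds(5)] bdd) auto
      also have "\<dots> \<le> 2 * 1 / \<epsilon> n * B"
        using True e[of n] B by (intro mult_right_mono divide_right_mono) auto
      finally have 2: "cmod (c' n x) * cmod (w x) \<le> 2 * B / \<epsilon> n" by simp
      have "cmod (D' n x) \<le> cmod (c n x) * cmod (D x) + cmod (c' n x) * cmod (w x)"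
        unfolding D'_def by (metis norm_mult norm_triangle_ineq)
      then show ?thesis using 1 2 by (simp add: add_divide_distrib)
    next
      case False
      then have "D' n x = 0" using zero[of x] by (auto simp: D'_def c_def c'_def cutoff_def)
      then show ?thesis using e[of n] B C by simp
    qed
  qed
  have "(\<lambda>n. LINT x|lborel. D' n x) \<longlonglongrightarrow> (LINT x|lborel. D x)"
  proof (rule integral_dominated_convergence)
    show "integrable lborel (\<lambda>x::real^'n. (C + 2 * B) * (indicator (ball 0 1) x * (1 / norm x)\<^sup>2))"
      by (intro integrable_mult_right integrable_norm_minus_2_ball d)
    show "D' n \<in> borel_measurable lborel" for n
      unfolding D'_def c_def c'_def cutoff_def cutoff_deriv_def by measurable
    show "AE x in lborel. (\<lambda>n. D' n x) \<longlonglongrightarrow> D x"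
      using AE_lborel_singleton[of 0]
    proof (rule AE_mp, intro AE_I2 impI)
      fix x :: "real^'n" assume False: "x \<noteq> 0"
      show "(\<lambda>n. D' n x) \<longlonglongrightarrow> D x"
      proof -
        have "(\<lambda>n. c n x) \<longlonglongrightarrow> of_real 1" "(\<lambda>n. c' n x) \<longlonglongrightarrow> of_real (x $ i / norm x * 0)"
          unfolding c_def c'_def using False
          by (intro tendsto_of_real tendsto_mult tendsto_const cutoff_tendsto[OF _ e_lim]; simp)+
        then have "(\<lambda>n. D' n x) \<longlonglongrightarrow> of_real 1 * D x + of_real (x $ i / norm x * 0) * w x"
          unfolding D'_def by (intro tendsto_intros)
        then show ?thesis by simp
      qed
    qed
    show "AE x in lborel. norm (D' n x) \<le> (C + 2 * B) * (indicator (ball 0 1) x * (1 / norm x)\<^sup>2)" for n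
    proof (rule AE_I2)
      fix x
      show "norm (D' n x) \<le> (C + 2 * B) * (indicator (ball 0 1) x * (1 / norm x)\<^sup>2)"
      proof (cases "0 < norm x \<and> norm x < 1")
        case True
        have 1: "cmod (c n x) * cmod (D x) \<le> 1 * (C / norm x)"
          using True by (intro mult_mono c_le D_bound) auto
        have 2: "cmod (c' n x) * cmod (w x) \<le> 2 / norm x * B"
          using True B by (intro mult_mono order_trans[OF c'_le cutoff_bounds(6)[OF e]] bdd) auto
        have "cmod (D' n x) \<le> cmod (c n x) * cmod (D x) + cmod (c' n x) * cmod (w x)"
          unfolding D'_def by (metis norm_mult norm_triangle_ineq)
        also have "\<dots> \<le> (C + 2 * B) * (1 / norm x)"
          using 1 2 by (simp add: add_divide_distrib)
        also have "\<dots> \<le> (C + 2 * B) * (1 / norm x)\<^sup>2"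
          using True B C by (intro mult_left_mono self_le_power) (auto simp: field_simps)
        finally show ?thesis using True by simp
      next
        case False
        then have "D' n x = 0" using zero[of x] by (auto simp: D'_def c_def c'_def cutoff_def)
        then show ?thesis using B C by simp
      qed
    qed
  qed simp
  then show ?thesis unfolding int0 by (simp add: LIMSEQ_const_iff)
qed

lemma test_function_partial:
  fixes \<phi> :: "real^'n \<Rightarrow> complex"
  assumes "test_function S \<phi>"
  shows "has_partial \<phi> i x (partial i \<phi> x)" "continuous_on UNIV \<phi>" "continuous_on UNIV (partial i \<phi>)"
proof -
  have "Ck (Suc 0) \<phi>" using assms unfolding test_function_def by blast
  then have 1: "continuous_on UNIV \<phi>" "(\<lambda>t. \<phi> (x + t *\<^sub>R axis i 1)) differentiable (at (0::real))"
    "continuous_on UNIV (partial i \<phi>)" by simp_all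
  then show "continuous_on UNIV \<phi>" "continuous_on UNIV (partial i \<phi>)" by simp_all
  show "has_partial \<phi> i x (partial i \<phi> x)"
    using 1(2) unfolding has_partial_def partial_def by (simp add: vector_derivative_works)
qed

lemma continuous_on_UNIV_bounded_on_ball:
  fixes f :: "'a::euclidean_space \<Rightarrow> complex"
  assumes "continuous_on UNIV f"
  obtains B where "B \<ge> 0" "\<And>x. norm x \<le> 1 \<Longrightarrow> cmod (f x) \<le> B"
proof -
  have "compact (f ` cball 0 1)"
    by (rule compact_continuous_image[OF continuous_on_subset[OF assms]]) auto
  then obtain B where "\<And>x. x \<in> cball 0 1 \<Longrightarrow> cmod (f x) \<le> B"
    by (force dest!: compact_imp_bounded simp: bounded_iff)
  then have "\<And>x. norm x \<le> 1 \<Longrightarrow> cmod (f x) \<le> max 0 B" by (simp add: le_max_iff_disj)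
  then show ?thesis by (rule that[rotated]) simp_all
qed

lemma borel_measurable_lebesgue_on_borel:
  "f \<in> borel_measurable borel \<Longrightarrow> f \<in> borel_measurable (lebesgue_on S)"
  by (intro measurable_restrict_space1 measurable_completion) simp

text \<open>Test functions vanish near the sphere, so \<open>integral_partial_eq_0_punctured\<close> applies to the product of
  \<open>u\<close> with a test function. Square integrability of the gradient is that of \<open>1/|x|\<close>.\<close>

lemma punctured_ball_gradient:
  fixes u :: "real^'n \<Rightarrow> complex" and g :: "real^'n \<Rightarrow> complex^'n"
  assumes d: "CARD('n) \<ge> 3"
    and meas [measurable]: "u \<in> borel_measurable borel" "\<And>i. (\<lambda>x. g x $ i) \<in> borel_measurable borel"
    and zero: "\<And>x. norm x \<ge> 1 \<Longrightarrow> u x = 0" "\<And>x. norm x \<ge> 1 \<Longrightarrow> g x = 0" "g 0 = 0"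
    and bdd: "\<And>x. cmod (u x) \<le> B"
    and der: "\<And>x i. 0 < norm x \<Longrightarrow> norm x < 1 \<Longrightarrow> has_partial u i x (g x $ i)"
    and g_bound: "\<And>x i. 0 < norm x \<Longrightarrow> norm x < 1 \<Longrightarrow> cmod (g x $ i) \<le> C / norm x"
  shows "is_weak_gradient u g" "u \<in> L2_ball" "(\<lambda>x. g x $ i) \<in> L2_ball" "u \<in> W12_ball"
proof -
  have B: "0 \<le> B" using bdd[of 0] by (rule order_trans[OF norm_ge_zero])
  have C: "0 \<le> C"
  proof -
    have "0 \<le> cmod (g ((1/2) *\<^sub>R axis undefined 1) $ undefined)" by simp
    also have "\<dots> \<le> C / norm ((1/2) *\<^sub>R (axis undefined 1 :: real^'n))" by (rule g_bound) auto
    finally show ?thesis by simp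
  qed
  note integrable = integrable_if_inverse_square_bound[OF d]
  have le_inverse_square: "r \<le> K / (norm x)\<^sup>2"
    if "r \<le> K / norm x" "0 \<le> K" "0 < norm x" "norm x < 1" for r K and x :: "real^'n"
  proof -
    have "K / norm x / 1 \<le> K / norm x / norm x" using that by (intro divide_left_mono) auto
    then show ?thesis using that(1) by (simp add: power2_eq_square)
  qed
  have bound_imp: "r \<le> K / norm x"
    if "r \<le> K" "0 \<le> K" "0 < norm x" "norm x < 1" for r K and x :: "real^'n"
  proof -
    have "K / 1 \<le> K / norm x" using that by (intro divide_left_mono) auto
    then show ?thesis using that(1) by simp
  qed
  have g_int: "integrable lborel (\<lambda>x. g x $ i)" for i
    using zero(2) g_bound C by (intro integrable[where K = C] le_inverse_square) auto
  have "(cmod (u x))\<^sup>2 \<le> B\<^sup>2" for x using power_mono[OF bdd norm_ge_zero] .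
  then have u_int: "integrable lborel (\<lambda>x. (cmod (u x))\<^sup>2)"
    using zero(1) by (intro integrable[where K = "B\<^sup>2"] le_inverse_square bound_imp) auto
  then show "u \<in> L2_ball"
    unfolding L2_ball_def
    by (auto intro!: borel_measurable_lebesgue_on_borel
        simp: integral_lebesgue_on_eq_lborel(2) set_integrable_def integrable_mult_indicator
        simp del: real_scaleR_def)
  have "(cmod (g x $ i))\<^sup>2 \<le> C\<^sup>2 / (norm x)\<^sup>2" if "0 < norm x" "norm x < 1" for x i
    using power_mono[OF g_bound[OF that] norm_ge_zero, of i 2] by (simp add: power_divide)
  then have g_int2: "integrable lborel (\<lambda>x. (cmod (g x $ i))\<^sup>2)" for i
    using zero(2) by (intro integrable[where K = "C\<^sup>2"]) auto
  then show g_L2: "(\<lambda>x. g x $ i) \<in> L2_ball" for i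
    unfolding L2_ball_def
    by (auto intro!: borel_measurable_lebesgue_on_borel
        simp: integral_lebesgue_on_eq_lborel(2) set_integrable_def integrable_mult_indicator
        simp del: real_scaleR_def)
  show weak: "is_weak_gradient u g"
    unfolding is_weak_gradient_def
  proof (intro conjI allI impI)
    fix i and K :: "(real^'n) set"
    assume "compact K \<and> K \<subseteq> ball 0 1"
    then have "K \<in> sets lebesgue" by (simp add: borel_compact)
    then show "(\<lambda>x. g x $ i) absolutely_integrable_on K"
      using g_int[of i] unfolding set_integrable_def
      by (intro integrable_mult_indicator) (auto simp: integrable_completion)
  next
    fix \<phi> :: "real^'n \<Rightarrow> complex" and i
    assume t: "test_function (ball 0 1) \<phi>"
    note \<phi> = test_function_partial[OF t]
    have [measurable]: "\<phi> \<in> borel_measurable borel" "partial i \<phi> \<in> borel_measurable borel"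
      by (auto intro!: borel_measurable_continuous_onI \<phi>)
    obtain M where M: "M \<ge> 0" "\<And>x. norm x \<le> 1 \<Longrightarrow> cmod (\<phi> x) \<le> M"
      using continuous_on_UNIV_bounded_on_ball[OF \<phi>(2)] by blast
    obtain M' where M': "M' \<ge> 0" "\<And>x. norm x \<le> 1 \<Longrightarrow> cmod (partial i \<phi> x) \<le> M'"
      using continuous_on_UNIV_bounded_on_ball[OF \<phi>(3)] by blast
    let ?D = "\<lambda>x. u x * partial i \<phi> x + g x $ i * \<phi> x"
    have u_phi: "cmod (u x * partial i \<phi> x) \<le> B * M' / norm x" if x: "0 < norm x" "norm x < 1" for x
      using mult_mono[OF bdd M'(2), of x x] B M' x by (intro bound_imp) (auto simp: norm_mult)
    have g_phi: "cmod (g x $ i * \<phi> x) \<le> C * M / norm x" if x: "0 < norm x" "norm x < 1" for x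
      using mult_mono[OF g_bound[OF x] M(2), of x i] C x by (simp add: norm_mult)
    have "(LINT x|lborel. ?D x) = 0"
    proof (rule integral_partial_eq_0_punctured[OF d])
      show "cmod (u x * \<phi> x) \<le> B * M" for x
        using mult_mono[OF bdd M(2), of x x] B M zero(1)[of x]
        by (cases "norm x \<le> 1") (auto simp: norm_mult)
      show "cmod (?D x) \<le> (B * M' + C * M) / norm x" if x: "0 < norm x" "norm x < 1" for x
        using norm_triangle_ineq[of "u x * partial i \<phi> x" "g x $ i * \<phi> x"] u_phi[OF x] g_phi[OF x]
        by (simp add: add_divide_distrib)
      show "has_partial (\<lambda>x. u x * \<phi> x) i x (?D x)" if "x \<noteq> 0" for x
      proof (cases "norm x < 1")
        case True
        then show ?thesis using has_partial_mult[OF der \<phi>(1), of x] that by simp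
      next
        case False
        let ?K = "closure {x. \<phi> x \<noteq> 0}"
        have "?K \<subseteq> ball 0 1" using t unfolding test_function_def by blast
        then have x: "x \<in> - ?K" using False by auto
        have "u y * \<phi> y = 0" if "y \<in> - ?K" for y
          using that closure_subset[of "{x. \<phi> x \<noteq> 0}"] by auto
        then have "has_partial (\<lambda>x. u x * \<phi> x) i x 0"
          by (intro has_partial_cong_open[OF has_partial_const[of 0 i x]
              _ x]) (simp_all add: open_Compl)
        then show ?thesis using zero False by simp
      qed
    next
      show "(\<lambda>x. u x * \<phi> x) \<in> borel_measurable borel" "?D \<in> borel_measurable borel"
        by measurable
    qed (simp_all add: zero)
    moreover have "integrable lborel (\<lambda>x. u x * partial i \<phi> x)"
      using zero(1) u_phi B M' by (intro integrable[where K = "B * M'"] le_inverse_square) auto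
    moreover have "integrable lborel (\<lambda>x. g x $ i * \<phi> x)"
      using zero(2) g_phi C M by (intro integrable[where K = "C * M"] le_inverse_square) auto
    ultimately have "(LINT x|lborel. u x * partial i \<phi> x) + (LINT x|lborel. g x $ i * \<phi> x) = 0"
      by simp
    moreover have "(LINT x|lebesgue_on (ball 0 1). u x * partial i \<phi> x)
        = (LINT x|lborel. u x * partial i \<phi> x)"
      using zero(1) unfolding integral_lebesgue_on_eq_lborel(1)[of "\<lambda>x. u x * partial i \<phi> x" "ball 0 1",
          simplified]
      by (auto simp: set_lebesgue_integral_def indicator_def intro!: Bochner_Integration.integral_cong)
    moreover have "(LINT x|lebesgue_on (ball 0 1). g x $ i * \<phi> x) = (LINT x|lborel. g x $ i * \<phi> x)"
      using zero(2) unfolding integral_lebesgue_on_eq_lborel(1)[of "\<lambda>x. g x $ i * \<phi> x" "ball 0 1",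
          simplified]
      by (auto simp: set_lebesgue_integral_def indicator_def intro!: Bochner_Integration.integral_cong)
    ultimately show "(LINT x|lebesgue_on (ball 0 1). u x * partial i \<phi> x) =
        - (LINT x|lebesgue_on (ball 0 1). g x $ i * \<phi> x)"
      by (simp add: eq_neg_iff_add_eq_0)
  qed
  show "u \<in> W12_ball"
    unfolding W12_ball_def using \<open>u \<in> L2_ball\<close> weak g_L2 by blast
qed

section \<open>The radial Volterra equation\<close>

text \<open>The kernel of the recursion for \<open>\<psi>\<^sub>k / r\<^sup>\<ell>\<^sup>+\<^sup>1\<close>, with \<open>q = 2\<ell> + 1\<close> and with the factor \<open>s\<close> moved to the
  integrated function. It is zero at \<open>s = r\<close> and therefore Lipschitz in \<open>r\<close>, although it has a corner
  there.\<close>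

definition volterra_kernel :: "nat \<Rightarrow> real \<Rightarrow> real \<Rightarrow> real" where
  "volterra_kernel q r s = (if s < r then (1 - (s / r) ^ q) / real q else 0)"

definition volterra_kernel_deriv :: "nat \<Rightarrow> real \<Rightarrow> real \<Rightarrow> real" where
  "volterra_kernel_deriv q r s = (if s < r then (s / r) ^ q / r else 0)"

definition volterra :: "nat \<Rightarrow> (real \<Rightarrow> complex) \<Rightarrow> real \<Rightarrow> complex" where
  "volterra q g r = (LINT s|lebesgue. volterra_kernel q r s *\<^sub>R g s)"

definition volterra_deriv :: "nat \<Rightarrow> (real \<Rightarrow> complex) \<Rightarrow> real \<Rightarrow> complex" where
  "volterra_deriv q g r = (LINT s|lebesgue. volterra_kernel_deriv q r s *\<^sub>R g s)"

lemma kernel_measurable [measurable]: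
  "volterra_kernel q r \<in> borel_measurable lebesgue" "volterra_kernel_deriv q r
      \<in> borel_measurable lebesgue"
proof -
  have "volterra_kernel q r \<in> borel_measurable borel" "volterra_kernel_deriv q r
      \<in> borel_measurable borel"
    unfolding volterra_kernel_def volterra_kernel_deriv_def by measurable
  then show "volterra_kernel q r \<in> borel_measurable lebesgue" "volterra_kernel_deriv q r
      \<in> borel_measurable lebesgue"
    by (auto intro: measurable_completion)
qed

lemma kernel_bounds:
  assumes "q \<ge> 1" "0 < s" "0 < r"
  shows "\<bar>volterra_kernel q r s\<bar> \<le> indicator {0<..<r} s" "\<bar>volterra_kernel_deriv q r s\<bar>
      \<le> indicator {0<..<r} s / r"
proof -
  have p: "0 \<le> (s / r) ^ q \<and> (s / r) ^ q \<le> 1" if "s < r"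
    using assms that by (auto intro!: power_le_one simp: divide_le_eq_1)
  show "\<bar>volterra_kernel q r s\<bar> \<le> indicator {0<..<r} s"
  proof (cases "s < r")
    case True
    have "1 \<le> real q" using assms by simp
    moreover have "1 - (s / r) ^ q \<le> 1" "0 \<le> 1 - (s / r) ^ q" using p[OF True] by auto
    ultimately have "0 \<le> (1 - (s / r) ^ q) / real q" "(1 - (s / r) ^ q) / real q \<le> 1"
      by (auto simp: divide_le_eq)
    then have "\<bar>volterra_kernel q r s\<bar> \<le> 1" using True
        by (simp only: volterra_kernel_def if_True abs_of_nonneg)
    then show ?thesis using True assms by simp
  qed (simp add: volterra_kernel_def)
  show "\<bar>volterra_kernel_deriv q r s\<bar> \<le> indicator {0<..<r} s / r"
  proof (cases "s < r")
    case True
    then have "0 \<le> (s / r) ^ q / r" "(s / r) ^ q / r \<le> 1 / r"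
      using p assms by (auto intro!: divide_right_mono)
    then show ?thesis using True assms by (simp add: volterra_kernel_deriv_def)
  qed (simp add: volterra_kernel_deriv_def)
qed

lemma kernel_formula_has_derivative:
  assumes "q \<ge> 1" "0 < t"
  shows "((\<lambda>t. (1 - (s / t) ^ q) / real q) has_real_derivative (s / t) ^ q / t) (at t within A)"
proof -
  have "((\<lambda>t. (1 - (s / t) ^ q) / real q) has_real_derivative
      (0 - real q * (- (s / t\<^sup>2)) * (s / t) ^ (q - 1)) / real q) (at t within A)"
    using assms by (auto intro!: derivative_eq_intros simp: power2_eq_square)
  moreover have "(0 - real q * (- (s / t\<^sup>2)) * (s / t) ^ (q - 1)) / real q
      = (s / t * (s / t) ^ (q - 1)) / t"
    using assms by (simp add: power2_eq_square)
  moreover have "s / t * (s / t) ^ (q - 1) = (s / t) ^ q" using assms by (cases q) auto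
  ultimately show ?thesis by (simp only:)
qed

text \<open>Truncation at \<open>s = r\<close> is a maximum with \<open>0\<close>, which does not increase differences. It remains to
  estimate the derivative of the untruncated formula.\<close>

lemma kernel_Lipschitz:
  assumes q: "q \<ge> 1" and s: "0 < s" "s < 1" and r: "0 < \<rho>" "\<rho> \<le> r" "\<rho> \<le> r'"
  shows "\<bar>volterra_kernel q r s - volterra_kernel q r' s\<bar> \<le> (1 / \<rho>) ^ Suc q * \<bar>r - r'\<bar>"
proof -
  have kernel_max: "volterra_kernel q t s = max 0 ((1 - (s / t) ^ q) / real q)" if "t > 0" for t
  proof (cases "s < t")
    case True
    then have "(s / t) ^ q \<le> 1" using s that by (intro power_le_one) (auto simp: divide_le_eq_1)
    then show ?thesis using True q by (simp add: volterra_kernel_def)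
  next
    case False
    then have "(s / t) ^ q \<ge> 1" using s that by (intro one_le_power) (auto simp: le_divide_eq_1)
    then have "(1 - (s / t) ^ q) / real q \<le> 0" using q by (intro divide_nonpos_pos) auto
    then show ?thesis using False by (simp add: volterra_kernel_def)
  qed
  let ?f = "\<lambda>t. (1 - (s / t) ^ q) / real q"
  have "norm (?f r - ?f r') \<le> (1 / \<rho>) ^ Suc q * norm (r - r')"
  proof (rule field_differentiable_bound)
    show "convex {\<rho>..}" by simp
    fix t assume t: "t \<in> {\<rho>..}"
    then show "(?f has_field_derivative (s / t) ^ q / t) (at t within {\<rho>..})"
      using r q by (intro kernel_formula_has_derivative) auto
    have "(s / t) ^ q / t \<le> (1 / \<rho>) ^ q / \<rho>"
      using t s r by (intro frac_le power_mono) auto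
    then show "norm ((s / t) ^ q / t) \<le> (1 / \<rho>) ^ Suc q"
      using t s r by simp
  qed (use r in auto)
  moreover have "\<bar>max 0 a - max 0 b\<bar> \<le> \<bar>a - b\<bar>" for a b :: real by (auto simp: max_def)
  ultimately show ?thesis
    unfolding kernel_max[OF less_le_trans[OF r(1,2)]] kernel_max[OF less_le_trans[OF r(1,3)]]
    by (auto intro: order_trans)
qed

lemma kernel_has_derivative:
  assumes q: "q \<ge> 1" and s: "0 < s" and r: "0 < r" "s \<noteq> r"
  shows "((\<lambda>r. volterra_kernel q r s) has_real_derivative volterra_kernel_deriv q r s) (at r)"
proof (cases "s < r")
  case True
  have "((\<lambda>r. volterra_kernel q r s) has_field_derivative (s / r) ^ q / r) (at r)"
    by (rule has_field_derivative_transform_within_open[OF kernel_formula_has_derivative[OF q r(1)],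
        of "{s<..}"])
      (use True in \<open>auto simp: volterra_kernel_def\<close>)
  then show ?thesis using True by (simp add: volterra_kernel_deriv_def)
next
  case False
  then have "s > r" using r by simp
  have "((\<lambda>_. 0) has_field_derivative (0::real)) (at r)" by simp
  then have "((\<lambda>r. volterra_kernel q r s) has_field_derivative 0) (at r)"
    by (rule has_field_derivative_transform_within_open[of _ _ _ "{..<s}"])
      (use \<open>s > r\<close> in \<open>auto simp: volterra_kernel_def\<close>)
  then show ?thesis using \<open>s > r\<close> by (simp add: volterra_kernel_deriv_def)
qed

lemma kernel_deriv_tendsto:
  assumes "0 < r" "s \<noteq> r" "X \<longlonglongrightarrow> r"
  shows "(\<lambda>n. volterra_kernel_deriv q (X n) s) \<longlonglongrightarrow> volterra_kernel_deriv q r s"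
proof (cases "s < r")
  case True
  have "(\<lambda>n. (s / X n) ^ q / X n) \<longlonglongrightarrow> (s / r) ^ q / r"
    using assms by (intro tendsto_intros) auto
  moreover have "\<forall>\<^sub>F n in sequentially. s < X n"
    using order_tendstoD(1)[OF assms(3) True] .
  then have "\<forall>\<^sub>F n in sequentially. (s / X n) ^ q / X n = volterra_kernel_deriv q (X n) s"
    by eventually_elim (simp add: volterra_kernel_deriv_def)
  ultimately show ?thesis
    using True by (simp add: volterra_kernel_deriv_def[of q r] Lim_transform_eventually)
next
  case False
  then have "r < s" using assms by simp
  have "\<forall>\<^sub>F n in sequentially. X n < s"
    using order_tendstoD(2)[OF assms(3) \<open>r < s\<close>] .
  then have "\<forall>\<^sub>F n in sequentially. volterra_kernel_deriv q (X n) s = volterra_kernel_deriv q r s"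
    by eventually_elim (use \<open>r < s\<close> in \<open>simp add: volterra_kernel_deriv_def\<close>)
  then show ?thesis by (rule tendsto_eventually)
qed

text \<open>The function \<open>g\<close> stands for \<open>s V(s) a(s)\<close> on \<open>(0,1)\<close>, extended by zero.\<close>

locale volterra_datum =
  fixes q :: nat and g :: "real \<Rightarrow> complex"
  assumes q: "q \<ge> 1"
    and g: "integrable lebesgue g"
    and g_zero: "\<And>s. s \<notin> {0<..<1} \<Longrightarrow> g s = 0"
begin

lemma kernel_scale_bounds:
  assumes "0 < r"
  shows "norm (volterra_kernel q r s *\<^sub>R g s) \<le> indicator {0<..<r} s * norm (g s)"
    "norm (volterra_kernel_deriv q r s *\<^sub>R g s) \<le> indicator {0<..<r} s * norm (g s) / r"
proof -
  have "\<bar>volterra_kernel q r s\<bar> * norm (g s) \<le> indicator {0<..<r} s * norm (g s)"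
    "\<bar>volterra_kernel_deriv q r s\<bar> * norm (g s) \<le> indicator {0<..<r} s / r * norm (g s)" if "s > 0"
    by (rule mult_right_mono[OF _ norm_ge_zero], rule kernel_bounds[OF q that assms])+
  then show "norm (volterra_kernel q r s *\<^sub>R g s) \<le> indicator {0<..<r} s * norm (g s)"
    "norm (volterra_kernel_deriv q r s *\<^sub>R g s) \<le> indicator {0<..<r} s * norm (g s) / r"
    using g_zero[of s] by (cases "s > 0"; simp)+
qed

lemma integrable_kernel:
  assumes "0 < r"
  shows "integrable lebesgue (\<lambda>s. volterra_kernel q r s *\<^sub>R g s)"
    "integrable lebesgue (\<lambda>s. volterra_kernel_deriv q r s *\<^sub>R g s)"
proof -
  have ind: "integrable lebesgue (\<lambda>s. indicator {0<..<r} s * norm (g s))"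
    using integrable_mult_indicator[OF _ integrable_norm[OF g], of "{0<..<r}"] by simp
  note [measurable] = borel_measurable_integrable[OF g]
  show "integrable lebesgue (\<lambda>s. volterra_kernel q r s *\<^sub>R g s)"
    by (rule Bochner_Integration.integrable_bound[OF ind])
      (use kernel_scale_bounds[OF assms] in \<open>auto intro!: AE_I2\<close>)
  show "integrable lebesgue (\<lambda>s. volterra_kernel_deriv q r s *\<^sub>R g s)"
    by (rule Bochner_Integration.integrable_bound[OF integrable_divide[OF ind, of r]])
      (use kernel_scale_bounds[OF assms] assms in \<open>auto intro!: AE_I2\<close>)
qed

lemma volterra_bounds:
  assumes r: "0 < r"
  shows "norm (volterra q g r) \<le> (LINT s:{0<..<r}|lebesgue. norm (g s))"
    "norm (volterra_deriv q g r) \<le> (LINT s:{0<..<r}|lebesgue. norm (g s)) / r"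
proof -
  have ind: "integrable lebesgue (\<lambda>s. indicator {0<..<r} s * norm (g s))"
    using integrable_mult_indicator[OF _ integrable_norm[OF g], of "{0<..<r}"] by simp
  have "norm (volterra q g r) \<le> (LINT s|lebesgue. indicator {0<..<r} s * norm (g s))"
    unfolding volterra_def
    by (rule Bochner_Integration.integral_norm_bound_integral[OF integrable_kernel(1) ind])
      (use kernel_scale_bounds[OF r] r in auto)
  then show "norm (volterra q g r) \<le> (LINT s:{0<..<r}|lebesgue. norm (g s))"
    by (simp add: set_lebesgue_integral_def)
  have "norm (volterra_deriv q g r) \<le> (LINT s|lebesgue. indicator {0<..<r} s * norm (g s) / r)"
    unfolding volterra_deriv_def
    by (rule Bochner_Integration.integral_norm_bound_integral[OF integrable_kernel(2) integrable_divide[OF ind]])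
      (use kernel_scale_bounds[OF r] r in auto)
  then show "norm (volterra_deriv q g r) \<le> (LINT s:{0<..<r}|lebesgue. norm (g s)) / r"
    by (simp add: set_lebesgue_integral_def)
qed

text \<open>The derivative of the Volterra integral, the continuity of that derivative and the limit at \<open>0\<close> are
  instances of this dominated convergence. The exceptional point \<open>r\<close> allows for the corner of the kernel.\<close>

lemma kernel_integral_tendsto:
  assumes [measurable]: "\<And>n. k n \<in> borel_measurable lebesgue" "k' \<in> borel_measurable lebesgue"
    and lim: "\<And>s. 0 < s \<Longrightarrow> s \<noteq> r \<Longrightarrow> (\<lambda>n. k n s) \<longlonglongrightarrow> k' s"
    and bound: "\<And>n s. 0 < s \<Longrightarrow> s < 1 \<Longrightarrow> \<bar>k n s\<bar> \<le> M"
  shows "(\<lambda>n. LINT s|lebesgue. k n s *\<^sub>R g s) \<longlonglongrightarrow> (LINT s|lebesgue. k' s *\<^sub>R g s)"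
proof (rule integral_dominated_convergence)
  note [measurable] = borel_measurable_integrable[OF g]
  show "integrable lebesgue (\<lambda>s. M * norm (g s))" by (intro integrable_mult_right integrable_norm g)
  show "(\<lambda>s. k' s *\<^sub>R g s) \<in> borel_measurable lebesgue" "(\<lambda>s. k n s *\<^sub>R g s)
      \<in> borel_measurable lebesgue" for n
    by measurable
  have "AE s in lebesgue. s \<noteq> r" by (rule AE_completion) (rule AE_lborel_singleton)
  then show "AE s in lebesgue. (\<lambda>n. k n s *\<^sub>R g s) \<longlonglongrightarrow> k' s *\<^sub>R g s"
  proof eventually_elim
    case (elim s)
    then show ?case using lim[of s] g_zero[of s] by (cases "0 < s") (auto intro: tendsto_intros)
  qed
  show "AE s in lebesgue. norm (k n s *\<^sub>R g s) \<le> M * norm (g s)" for n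
  proof (rule AE_I2)
    fix s show "norm (k n s *\<^sub>R g s) \<le> M * norm (g s)"
      using bound[of s n] g_zero[of s] by (cases "s \<in> {0<..<1}") (auto intro: mult_right_mono)
  qed
qed

lemma volterra_has_derivative:
  assumes r: "0 < r"
  shows "(volterra q g has_vector_derivative volterra_deriv q g r) (at r)"
proof -
  note [measurable] = borel_measurable_integrable[OF g]
  let ?Q = "\<lambda>y. (volterra q g y - volterra q g r) /\<^sub>R (y - r)"
  have "(?Q \<longlongrightarrow> volterra_deriv q g r) (at r within {r / 2<..})"
    unfolding tendsto_at_iff_sequentially
  proof (intro allI impI)
    fix X :: "nat \<Rightarrow> real"
    assume X: "\<forall>n. X n \<in> {r / 2<..} - {r}" "X \<longlonglongrightarrow> r"
    have pos: "0 < X n" "r / 2 < X n" "X n \<noteq> r" for n using X(1)[rule_format, of n] r by auto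
    let ?k = "\<lambda>n s. (volterra_kernel q (X n) s - volterra_kernel q r s) / (X n - r)"
    have "(?Q \<circ> X) n = (LINT s|lebesgue. ?k n s *\<^sub>R g s)" for n
    proof -
      have "volterra q g (X n) - volterra q g r
          = (LINT s|lebesgue. (volterra_kernel q (X n) s - volterra_kernel q r s) *\<^sub>R g s)"
        unfolding volterra_def using integrable_kernel(1) pos r
        by (simp add: scaleR_diff_left)
      moreover have "?k n s *\<^sub>R g s
          = (1 / (X n - r)) *\<^sub>R ((volterra_kernel q (X n) s - volterra_kernel q r s) *\<^sub>R g s)" for s
        by simp
      ultimately show ?thesis
        by (simp only: o_def integral_scaleR_right) (simp add: inverse_eq_divide)
    qed
    moreover have "(\<lambda>n. LINT s|lebesgue. ?k n s *\<^sub>R g s) \<longlonglongrightarrow> volterra_deriv q g r"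
      unfolding volterra_deriv_def
    proof (rule kernel_integral_tendsto[of _ _ r "(1 / (r / 2)) ^ Suc q"])
      fix s :: real assume s: "0 < s" "s \<noteq> r"
      have "((\<lambda>y. (volterra_kernel q y s - volterra_kernel q r s) / (y - r)) \<longlongrightarrow> volterra_kernel_deriv q r s) (at r)"
        using kernel_has_derivative[OF q s(1) r s(2)] by (simp add: has_field_derivative_iff)
      moreover have "filterlim X (at r) sequentially"
        using X pos by (auto simp: filterlim_at)
      ultimately show "(\<lambda>n. ?k n s) \<longlonglongrightarrow> volterra_kernel_deriv q r s"
        by (rule filterlim_compose)
    next
      fix n and s :: real assume "0 < s" "s < 1"
      then have "\<bar>volterra_kernel q (X n) s - volterra_kernel q r s\<bar>
          \<le> (1 / (r / 2)) ^ Suc q * \<bar>X n - r\<bar>"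
        using pos[of n] r by (intro kernel_Lipschitz q) auto
      then show "\<bar>?k n s\<bar> \<le> (1 / (r / 2)) ^ Suc q"
        using pos[of n]
            by (simp only: abs_divide pos_divide_le_eq zero_less_abs_iff right_minus_eq not_False_eq_True)
    qed measurable
    ultimately show "(?Q \<circ> X) \<longlonglongrightarrow> volterra_deriv q g r" by presburger
  qed
  moreover have "at r within {r / 2<..} = at r" using r by (intro at_within_open) auto
  ultimately show ?thesis unfolding has_vector_derivative_iff_quotient by simp
qed

lemma continuous_on_volterra: "continuous_on {0<..<1} (volterra q g)"
proof (intro continuous_at_imp_continuous_on ballI)
  fix r :: real assume "r \<in> {0<..<1}"
  then show "isCont (volterra q g) r"
    by (intro has_vector_derivative_continuous[OF volterra_has_derivative]) simp
qed

lemma continuous_on_volterra_deriv: "continuous_on {0<..<1} (volterra_deriv q g)"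
proof (intro continuous_at_imp_continuous_on ballI)
  fix r :: real assume r': "r \<in> {0<..<1}"
  then have r: "0 < r" by simp
  note [measurable] = borel_measurable_integrable[OF g]
  have "(volterra_deriv q g \<longlongrightarrow> volterra_deriv q g r) (at r within {r / 2<..})"
    unfolding tendsto_at_iff_sequentially
  proof (intro allI impI)
    fix X :: "nat \<Rightarrow> real"
    assume X: "\<forall>n. X n \<in> {r / 2<..} - {r}" "X \<longlonglongrightarrow> r"
    have pos: "0 < X n" "r / 2 < X n" for n using X(1)[rule_format, of n] r by auto
    have "(\<lambda>n. LINT s|lebesgue. volterra_kernel_deriv q (X n) s *\<^sub>R g s)
        \<longlonglongrightarrow> (LINT s|lebesgue. volterra_kernel_deriv q r s *\<^sub>R g s)"
    proof (rule kernel_integral_tendsto[of _ _ r "1 / (r / 2)"])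
      show "(\<lambda>n. volterra_kernel_deriv q (X n) s) \<longlonglongrightarrow> volterra_kernel_deriv q r s" if "s \<noteq> r" for s
        by (rule kernel_deriv_tendsto[OF r that X(2)])
      fix n and s :: real assume s: "0 < s" "s < 1"
      have "\<bar>volterra_kernel_deriv q (X n) s\<bar> \<le> indicator {0<..<X n} s / X n"
        by (rule kernel_bounds(2)[OF q s(1) pos(1)])
      also have "\<dots> \<le> 1 / (r / 2)"
        using pos[of n] r by (intro frac_le) (auto simp: indicator_def)
      finally show "\<bar>volterra_kernel_deriv q (X n) s\<bar> \<le> 1 / (r / 2)" .
    qed measurable
    then show "(volterra_deriv q g \<circ> X) \<longlonglongrightarrow> volterra_deriv q g r"
      unfolding volterra_deriv_def o_def .
  qed
  moreover have "at r within {r / 2<..} = at r" using r by (intro at_within_open) auto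
  ultimately show "continuous (at r) (volterra_deriv q g)" by (simp add: continuous_at)
qed

lemma volterra_tendsto_0: "(volterra q g \<longlongrightarrow> 0) (at_right 0)"
proof -
  have "(volterra q g \<longlongrightarrow> 0) (at 0 within {0<..})"
    unfolding tendsto_at_iff_sequentially
  proof (intro allI impI)
    fix X :: "nat \<Rightarrow> real"
    assume X: "\<forall>n. X n \<in> {0<..} - {0}" "X \<longlonglongrightarrow> 0"
    have pos: "0 < X n" for n using X(1)[rule_format, of n] by auto
    have "(\<lambda>n. LINT s|lebesgue. volterra_kernel q (X n) s *\<^sub>R g s) \<longlonglongrightarrow> (LINT s|lebesgue. 0 *\<^sub>R g s)"
    proof (rule kernel_integral_tendsto[of _ _ 0 1])
      fix s :: real assume s: "0 < s"
      have "\<forall>\<^sub>F n in sequentially. X n < s" using order_tendstoD(2)[OF X(2) s] .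
      then have "\<forall>\<^sub>F n in sequentially. volterra_kernel q (X n) s = 0"
        by eventually_elim (simp add: volterra_kernel_def)
      then show "(\<lambda>n. volterra_kernel q (X n) s) \<longlonglongrightarrow> 0" by (rule tendsto_eventually)
    next
      fix n and s :: real assume "0 < s" "s < 1"
      from kernel_bounds(1)[OF q this(1) pos, of n] show "\<bar>volterra_kernel q (X n) s\<bar> \<le> 1"
        by (rule order_trans) (simp add: indicator_def)
    qed measurable
    then show "(volterra q g \<circ> X) \<longlonglongrightarrow> 0" unfolding volterra_def o_def by simp
  qed
  then show ?thesis .
qed

end

text \<open>These are the functions \<open>\<psi>\<^sub>k / r\<^sup>\<ell>\<^sup>+\<^sup>1\<close>; here \<open>U\<close> is \<open>s V(s)\<close>.\<close>

primrec picard :: "nat \<Rightarrow> (real \<Rightarrow> complex) \<Rightarrow> nat \<Rightarrow> real \<Rightarrow> complex" where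
  "picard q U 0 = (\<lambda>_. 1)"
| "picard q U (Suc k) = volterra q (\<lambda>s. U s * picard q U k s)"

text \<open>Bielecki's weight. Split \<open>W\<close> into a part bounded by \<open>K\<close> and a tail of integral at most \<open>1/2\<close>. With
  \<open>\<mu> = 4 K\<close> the bounded part contributes at most a quarter of \<open>exp (\<mu> r)\<close>, so one step of the
  iteration contracts by \<open>3/4\<close>. In contrast to the bound by \<open>F\<^sup>k / k!\<close> with \<open>F\<close> the primitive of
  \<open>W\<close>, this does not require that \<open>F\<close> be differentiated.\<close>

lemma exponential_weight_exists:
  fixes W :: "real \<Rightarrow> real"
  assumes W: "integrable lebesgue W" and pos: "\<And>s. W s \<ge> 0"
  obtains \<mu> where "\<mu> > 0" "\<And>r. 0 < r \<Longrightarrow> r < 1 \<Longrightarrow> (LINT s:{0<..<r}|lebesgue. W s * exp (\<mu> * s))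
      \<le> 3 / 4 * exp (\<mu> * r)"
proof -
  note [measurable] = borel_measurable_integrable[OF W]
  have "(\<lambda>n. LINT s|lebesgue. (if W s > real n then W s else 0))
      \<longlonglongrightarrow> (LINT s|(lebesgue :: real measure). (0::real))"
  proof (rule integral_dominated_convergence[OF _ _ W])
    show "AE s in lebesgue. (\<lambda>n. if W s > real n then W s else 0) \<longlonglongrightarrow> 0"
    proof (rule AE_I2)
      fix s
      have "\<forall>\<^sub>F n in sequentially. \<not> W s > real n"
        using filterlim_real_sequentially unfolding filterlim_at_top
            by (auto elim: eventually_mono simp: not_less)
      then show "(\<lambda>n. if W s > real n then W s else 0) \<longlonglongrightarrow> 0"
        by (intro tendsto_eventually) (auto elim: eventually_mono)
    qed
    show "AE s in lebesgue. norm (if W s > real n then W s else 0) \<le> W s" for n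
      using pos by (auto intro!: AE_I2)
  qed measurable
  then have "\<forall>\<^sub>F n in sequentially. (LINT s|lebesgue. (if W s > real n then W s else 0)) < 1 / 2"
    by (intro order_tendstoD(2)) auto
  then obtain N where N: "\<And>n. n \<ge> N \<Longrightarrow> (LINT s|lebesgue. (if W s > real n then W s else 0)) < 1 / 2"
    unfolding eventually_sequentially by blast
  define K where "K = real (Suc N)"
  have K: "K > 0" by (simp add: K_def)
  let ?T = "\<lambda>s. if W s > K then W s else 0"
  have T: "(LINT s|lebesgue. ?T s) \<le> 1 / 2" using N[of "Suc N"] by (simp add: K_def del: of_nat_Suc)
  have T_int: "integrable lebesgue ?T"
    by (rule Bochner_Integration.integrable_bound[OF W]) (auto intro!: AE_I2)
  define \<mu> where "\<mu> = 4 * K"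
  have l: "\<mu> > 0" using K by (simp add: \<mu>_def)
  show thesis
  proof (rule that[OF l])
    fix r :: real assume r: "0 < r" "r < 1"
    have "has_bochner_integral lborel (\<lambda>s. exp (\<mu> * s) * indicator {0..r} s) (exp (\<mu> * r) / \<mu> - exp (\<mu> * 0) / \<mu>)"
      by (rule has_bochner_integral_FTC_Icc_nonneg)
        (use r l in \<open>auto intro!: derivative_eq_intros\<close>)
    then have E: "integrable lebesgue (\<lambda>s. exp (\<mu> * s) * indicator {0..r} s)"
      "(LINT s|lebesgue. exp (\<mu> * s) * indicator {0..r} s) = exp (\<mu> * r) / \<mu> - exp (\<mu> * 0) / \<mu>"
      by (auto simp: has_bochner_integral_iff integrable_completion integral_completion)
    have "(LINT s:{0<..<r}|lebesgue. W s * exp (\<mu> * s)) \<le>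
        (LINT s|lebesgue. K * (exp (\<mu> * s) * indicator {0..r} s) + exp (\<mu> * r) * ?T s)"
      unfolding set_lebesgue_integral_def
    proof (rule integral_mono')
      show "integrable lebesgue (\<lambda>s. K * (exp (\<mu> * s) * indicator {0..r} s) + exp (\<mu> * r) * ?T s)"
        by (intro Bochner_Integration.integrable_add integrable_mult_right E T_int)
      have le: "W s * exp (\<mu> * s) \<le> K * exp (\<mu> * s) + exp (\<mu> * r) * ?T s" if "s \<in> {0<..<r}" for s
      proof (cases "W s > K")
        case True
        have "W s * exp (\<mu> * s) \<le> W s * exp (\<mu> * r)"
          using that l pos by (intro mult_left_mono) auto
        then show ?thesis using True K by (simp add: add_increasing mult.commute)
      next
        case False
        then show ?thesis by (simp add: mult_right_mono)
      qed
      show "indicator {0<..<r} s *\<^sub>R (W s * exp (\<mu> * s)) \<le>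
          K * (exp (\<mu> * s) * indicator {0..r} s) + exp (\<mu> * r) * ?T s" for s
        using le[of s] K pos[of s] by (cases "s \<in> {0<..<r}") auto
      show "0 \<le> K * (exp (\<mu> * s) * indicator {0..r} s) + exp (\<mu> * r) * ?T s" for s
        using K pos[of s] by simp
    qed
    also have "\<dots> = K * (exp (\<mu> * r) / \<mu> - exp (\<mu> * 0) / \<mu>) + exp (\<mu> * r) * (LINT s|lebesgue. ?T s)"
      using E T_int by simp
    also have "\<dots> \<le> 1 / 4 * exp (\<mu> * r) + exp (\<mu> * r) * (1 / 2)"
      using K by (intro add_mono mult_left_mono T) (auto simp: \<mu>_def field_simps)
    finally show "(LINT s:{0<..<r}|lebesgue. W s * exp (\<mu> * s)) \<le> 3 / 4 * exp (\<mu> * r)" by simp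
  qed
qed

locale radial_potential =
  fixes q :: nat and U :: "real \<Rightarrow> complex"
  assumes q: "q \<ge> 1"
    and U: "integrable lebesgue U"
    and U_zero: "\<And>s. s \<notin> {0<..<1} \<Longrightarrow> U s = 0"
begin

lemma volterra_datum_mult:
  assumes a: "continuous_on {0<..<1} a" and bdd: "\<And>s. s \<in> {0<..<1} \<Longrightarrow> norm (a s) \<le> B"
  shows "volterra_datum q (\<lambda>s. U s * a s)"
proof
  show "q \<ge> 1" by (rule q)
  show "U s * a s = 0" if "s \<notin> {0<..<1}" for s using U_zero[OF that] by simp
  show "integrable lebesgue (\<lambda>s. U s * a s)"
  proof (rule Bochner_Integration.integrable_bound[OF integrable_mult_left[OF U, of "of_real B"]])
    have "(\<lambda>s. indicator {0<..<1} s *\<^sub>R a s) \<in> borel_measurable borel"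
      using a by (intro borel_measurable_continuous_on_indicator) auto
    then have [measurable]: "(\<lambda>s. indicator {0<..<1} s *\<^sub>R a s) \<in> borel_measurable lebesgue"
      by (intro measurable_completion) simp
    note [measurable] = borel_measurable_integrable[OF U]
    have "(\<lambda>s. U s * (indicator {0<..<1} s *\<^sub>R a s)) \<in> borel_measurable lebesgue" by measurable
    moreover have "(\<lambda>s. U s * (indicator {0<..<1} s *\<^sub>R a s)) = (\<lambda>s. U s * a s)"
    proof
      fix s show "U s * (indicator {0<..<1} s *\<^sub>R a s) = U s * a s"
        using U_zero[of s] by (cases "s \<in> {0<..<1}") auto
    qed
    ultimately show "(\<lambda>s. U s * a s) \<in> borel_measurable lebesgue" by (simp only:)
    show "AE s in lebesgue. norm (U s * a s) \<le> norm (U s * of_real B)"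
    proof (rule AE_I2)
      fix s show "norm (U s * a s) \<le> norm (U s * of_real B)"
      proof (cases "s \<in> {0<..<1}")
        case True
        have "norm (a s) \<le> \<bar>B\<bar>" using bdd[OF True] by linarith
        then show ?thesis by (simp add: norm_mult mult_left_mono)
      qed (simp add: U_zero)
    qed
  qed
qed

lemma picard_bound_exists:
  obtains \<mu> where "\<mu> > 0"
    "\<And>k. continuous_on {0<..<1} (picard q U k)"
    "\<And>k r. 0 < r \<Longrightarrow> r < 1 \<Longrightarrow> norm (picard q U k r) \<le> (3 / 4) ^ k * exp (\<mu> * r)"
proof -
  obtain \<mu> where l: "\<mu> > 0" and \<mu>: "\<And>r. 0 < r \<Longrightarrow> r < 1 \<Longrightarrow>
      (LINT s:{0<..<r}|lebesgue. norm (U s) * exp (\<mu> * s)) \<le> 3 / 4 * exp (\<mu> * r)"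
    using exponential_weight_exists[OF integrable_norm[OF U]] by auto
  have "continuous_on {0<..<1} (picard q U k) \<and>
      (\<forall>r. 0 < r \<and> r < 1 \<longrightarrow> norm (picard q U k r) \<le> (3 / 4) ^ k * exp (\<mu> * r))" for k
  proof (induction k)
    case 0
    then show ?case using l by simp
  next
    case (Suc k)
    then have IH: "\<And>r. 0 < r \<Longrightarrow> r < 1 \<Longrightarrow> norm (picard q U k r) \<le> (3 / 4) ^ k * exp (\<mu> * r)" by blast
    have "norm (picard q U k s) \<le> (3 / 4) ^ k * exp \<mu>" if "s \<in> {0<..<1}" for s
    proof (rule order_trans[OF IH])
      show "(3 / 4) ^ k * exp (\<mu> * s) \<le> (3 / 4) ^ k * exp \<mu>" using that l by simp
    qed (use that in auto)
    then interpret volterra_datum q "\<lambda>s. U s * picard q U k s"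
      using Suc by (intro volterra_datum_mult) auto
    have "norm (picard q U (Suc k) r) \<le> (3 / 4) ^ Suc k * exp (\<mu> * r)" if r: "0 < r" "r < 1" for r
    proof -
      have "norm (picard q U (Suc k) r) \<le> (LINT s:{0<..<r}|lebesgue. norm (U s * picard q U k s))"
        using volterra_bounds(1)[OF r(1)] by simp
      also have "\<dots> \<le> (LINT s:{0<..<r}|lebesgue. (3 / 4) ^ k * (norm (U s) * exp (\<mu> * s)))"
      proof (rule set_integral_mono)
        show "set_integrable lebesgue {0<..<r} (\<lambda>s. norm (U s * picard q U k s))"
          unfolding set_integrable_def using g by (intro integrable_mult_indicator integrable_norm) auto
        interpret E: volterra_datum q "\<lambda>s. U s * of_real (exp (\<mu> * s))"
          by (rule volterra_datum_mult[of _ "exp \<mu>"]) (use l in \<open>auto intro!: continuous_intros\<close>)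
        have "integrable lebesgue (\<lambda>s. norm (U s * of_real (exp (\<mu> * s))))"
          by (intro integrable_norm E.g)
        then have "integrable lebesgue (\<lambda>s. (3 / 4) ^ k * (norm (U s) * exp (\<mu> * s)))"
          by (intro integrable_mult_right) (simp add: norm_mult)
        then show "set_integrable lebesgue {0<..<r} (\<lambda>s. (3 / 4) ^ k * (norm (U s) * exp (\<mu> * s)))"
          unfolding set_integrable_def by (intro integrable_mult_indicator) auto
        show "norm (U s * picard q U k s) \<le> (3 / 4) ^ k * (norm (U s) * exp (\<mu> * s))" if "s \<in> {0<..<r}"
            for s
          using mult_left_mono[OF IH[of s] norm_ge_zero[of "U s"]] that r
              by (simp add: norm_mult mult_ac)
      qed
      also have "\<dots> = (3 / 4) ^ k * (LINT s:{0<..<r}|lebesgue. norm (U s) * exp (\<mu> * s))"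
        by simp
      also have "\<dots> \<le> (3 / 4) ^ k * (3 / 4 * exp (\<mu> * r))"
        by (intro mult_left_mono \<mu> r) auto
      finally show ?thesis by simp
    qed
    moreover have "continuous_on {0<..<1} (picard q U (Suc k))" using continuous_on_volterra by simp
    ultimately show ?case by blast
  qed
  then show ?thesis using that[OF l] by blast
qed

definition profile :: "real \<Rightarrow> complex" where
  "profile r = (\<Sum>k. picard q U k r)"

definition profile_deriv :: "real \<Rightarrow> complex" where
  "profile_deriv = volterra_deriv q (\<lambda>s. U s * profile s)"

text \<open>The partial sums are bounded uniformly on \<open>(0,1)\<close>, so summation and integration may be exchanged and
  the sum is a fixed point of the Volterra equation. The remaining assertions are those for Volterra
  integrals of integrable functions.\<close>

lemma profile_properties:
  obtains C where "C \<ge> 0"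
    "\<And>r. r \<in> {0<..<1} \<Longrightarrow> norm (profile r) \<le> C"
    "\<And>r. r \<in> {0<..<1} \<Longrightarrow> norm (profile_deriv r) \<le> C / r"
    "\<And>r. r \<in> {0<..<1} \<Longrightarrow> (profile has_vector_derivative profile_deriv r) (at r)"
    "continuous_on {0<..<1} profile_deriv"
    "(profile \<longlongrightarrow> 1) (at_right 0)"
proof -
  obtain \<mu> where l: "\<mu> > 0" and cont: "\<And>k. continuous_on {0<..<1} (picard q U k)"
    and bound: "\<And>k r. 0 < r \<Longrightarrow> r < 1 \<Longrightarrow> norm (picard q U k r) \<le> (3 / 4) ^ k * exp (\<mu> * r)"
    using picard_bound_exists by blast
  define M where "M = exp \<mu>"
  have M: "M > 0" by (simp add: M_def)
  have bound': "norm (picard q U k r) \<le> (3 / 4) ^ k * M" if "r \<in> {0<..<1}" for k r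
  proof (rule order_trans[OF bound])
    show "(3 / 4) ^ k * exp (\<mu> * r) \<le> (3 / 4) ^ k * M" using that l by (simp add: M_def)
  qed (use that in auto)
  have geo: "summable (\<lambda>k. (3 / 4) ^ k * M)" by (intro summable_mult2 summable_geometric) simp
  have geo_sum: "(\<Sum>k. (3 / 4) ^ k * M) = 4 * M"
    by (subst suminf_mult2[symmetric]) (auto intro!: summable_geometric simp: suminf_geometric)
  have summ: "summable (\<lambda>k. picard q U k r)" if "r \<in> {0<..<1}" for r
    by (rule summable_comparison_test'[OF geo]) (use bound'[OF that] in auto)
  have partial_bound: "norm (\<Sum>k<N. picard q U k r) \<le> 4 * M" if r: "r \<in> {0<..<1}" for r N
  proof -
    have "norm (\<Sum>k<N. picard q U k r) \<le> (\<Sum>k<N. (3 / 4) ^ k * M)"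
      by (rule sum_norm_le) (use bound'[OF r] in auto)
    also have "\<dots> \<le> (\<Sum>k. (3 / 4) ^ k * M)"
      using M by (intro sum_le_suminf geo) auto
    finally show ?thesis unfolding geo_sum .
  qed
  have lim: "(\<lambda>N. \<Sum>k<N. picard q U k r) \<longlonglongrightarrow> profile r" if "r \<in> {0<..<1}" for r
    unfolding profile_def using summ[OF that] by (rule summable_LIMSEQ)
  have profile_bound: "norm (profile r) \<le> 4 * M" if "r \<in> {0<..<1}" for r
    using tendsto_norm[OF lim[OF that]] partial_bound[OF that] by (intro LIMSEQ_le_const2) auto
  have profile_cont: "continuous_on {0<..<1} profile"
  proof (rule uniform_limit_theorem)
    show "uniform_limit {0<..<1} (\<lambda>N r. \<Sum>k<N. picard q U k r) profile sequentially"
      unfolding profile_def by (rule Weierstrass_m_test[OF bound' geo])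
    show "\<forall>\<^sub>F N in sequentially. continuous_on {0<..<1} (\<lambda>r. \<Sum>k<N. picard q U k r)"
      by (intro always_eventually allI continuous_on_sum cont)
  qed simp
  interpret P: volterra_datum q "\<lambda>s. U s * profile s"
    by (rule volterra_datum_mult[OF profile_cont profile_bound])
  have fixpoint: "profile r = 1 + volterra q (\<lambda>s. U s * profile s) r" if r: "r \<in> {0<..<1}" for r
  proof -
    have S: "volterra_datum q (\<lambda>s. U s * (\<Sum>k<N. picard q U k s))" for N
      using partial_bound by (intro volterra_datum_mult continuous_on_sum cont)
    have D: "volterra_datum q (\<lambda>s. U s * picard q U k s)" for k
      by (rule volterra_datum_mult[OF cont bound'])
    have eq: "volterra q (\<lambda>s. U s * (\<Sum>k<N. picard q U k s)) r = (\<Sum>k<N. picard q U (Suc k) r)" for N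
    proof -
      have "volterra q (\<lambda>s. U s * (\<Sum>k<N. picard q U k s)) r =
          (LINT s|lebesgue. (\<Sum>k<N. volterra_kernel q r s *\<^sub>R (U s * picard q U k s)))"
        unfolding volterra_def by (simp add: sum_distrib_left scaleR_sum_right)
      also have "\<dots> = (\<Sum>k<N. LINT s|lebesgue. volterra_kernel q r s *\<^sub>R (U s * picard q U k s))"
        using r by (intro Bochner_Integration.integral_sum volterra_datum.integrable_kernel[OF D]) auto
      finally show ?thesis by (simp add: volterra_def)
    qed
    have "(\<lambda>N. volterra q (\<lambda>s. U s * (\<Sum>k<N. picard q U k s)) r) \<longlonglongrightarrow> volterra q (\<lambda>s. U s * profile s) r"
      unfolding volterra_def
    proof (rule integral_dominated_convergence)
      show "integrable lebesgue (\<lambda>s. norm (U s) * (4 * M))"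
        by (intro integrable_mult_left integrable_norm U)
      show "AE s in lebesgue. (\<lambda>N. volterra_kernel q r s *\<^sub>R (U s * (\<Sum>k<N. picard q U k s)))
          \<longlonglongrightarrow> volterra_kernel q r s *\<^sub>R (U s * profile s)"
      proof (rule AE_I2)
        fix s show "(\<lambda>N. volterra_kernel q r s *\<^sub>R (U s * (\<Sum>k<N. picard q U k s)))
            \<longlonglongrightarrow> volterra_kernel q r s *\<^sub>R (U s * profile s)"
          by (cases "s \<in> {0<..<1}") (auto simp: U_zero intro!: tendsto_intros lim)
      qed
      show "AE s in lebesgue. norm (volterra_kernel q r s *\<^sub>R (U s * (\<Sum>k<N. picard q U k s)))
          \<le> norm (U s) * (4 * M)" for N
      proof (rule AE_I2)
        fix s
        have "norm (volterra_kernel q r s *\<^sub>R (U s * (\<Sum>k<N. picard q U k s))) \<le>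
            indicator {0<..<r} s * norm (U s * (\<Sum>k<N. picard q U k s))"
          using r by (intro volterra_datum.kernel_scale_bounds(1)[OF S]) auto
        also have "\<dots> \<le> norm (U s) * (4 * M)"
          using r M mult_left_mono[OF partial_bound[of s N] norm_ge_zero[of "U s"]]
          by (cases "s \<in> {0<..<r}") (auto simp: norm_mult)
        finally show "norm (volterra_kernel q r s *\<^sub>R (U s * (\<Sum>k<N. picard q U k s)))
            \<le> norm (U s) * (4 * M)" .
      qed
      show "(\<lambda>s. volterra_kernel q r s *\<^sub>R (U s * profile s)) \<in> borel_measurable lebesgue"
        using P.integrable_kernel(1)[of r] r by auto
      show "(\<lambda>s. volterra_kernel q r s *\<^sub>R (U s * (\<Sum>k<N. picard q U k s))) \<in> borel_measurable lebesgue"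
          for N
        using volterra_datum.integrable_kernel(1)[OF S, of r N] r by auto
    qed
    then have "(\<lambda>N. \<Sum>k<N. picard q U (Suc k) r) \<longlonglongrightarrow> volterra q (\<lambda>s. U s * profile s) r"
      unfolding eq .
    moreover have "(\<lambda>N. \<Sum>k<N. picard q U (Suc k) r) \<longlonglongrightarrow> profile r - picard q U 0 r"
      using lim[OF r, THEN LIMSEQ_Suc] unfolding sum.lessThan_Suc_shift
      by (auto dest: tendsto_diff[OF _ tendsto_const[of "picard q U 0 r"]])
    ultimately show ?thesis using LIMSEQ_unique by fastforce
  qed
  define C where "C = max (4 * M) (LINT s|lebesgue. norm (U s * profile s))"
  show thesis
  proof (rule that)
    show "C \<ge> 0" using M by (simp add: C_def)
    show "norm (profile r) \<le> C" if "r \<in> {0<..<1}" for r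
      using profile_bound[OF that] by (simp add: C_def)
    show "norm (profile_deriv r) \<le> C / r" if r: "r \<in> {0<..<1}" for r
    proof -
      have "norm (profile_deriv r) \<le> (LINT s:{0<..<r}|lebesgue. norm (U s * profile s)) / r"
        unfolding profile_deriv_def using r by (intro P.volterra_bounds) auto
      also have "(LINT s:{0<..<r}|lebesgue. norm (U s * profile s))
          \<le> (LINT s|lebesgue. norm (U s * profile s))"
        unfolding set_lebesgue_integral_def
        by (intro Bochner_Integration.integral_mono integrable_mult_indicator integrable_norm P.g)
          (auto simp: indicator_def)
      also have "\<dots> \<le> C" by (simp add: C_def)
      finally show ?thesis using r by (simp add: divide_right_mono)
    qed
    show "(profile has_vector_derivative profile_deriv r) (at r)" if r: "r \<in> {0<..<1}" for r
    proof -
      have "((\<lambda>r. 1 + volterra q (\<lambda>s. U s * profile s) r) has_vector_derivative 0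
          + profile_deriv r) (at r)"
        unfolding profile_deriv_def using r
        by (intro has_vector_derivative_add P.volterra_has_derivative) auto
      then show ?thesis unfolding add_0_left
        by (rule has_vector_derivative_transform_within_open[of _ _ _ "{0<..<1}"])
          (use r fixpoint in auto)
    qed
    show "continuous_on {0<..<1} profile_deriv"
      unfolding profile_deriv_def by (rule P.continuous_on_volterra_deriv)
    have "((\<lambda>r. 1 + volterra q (\<lambda>s. U s * profile s) r) \<longlongrightarrow> 1 + 0) (at_right 0)"
      by (intro tendsto_intros P.volterra_tendsto_0)
    moreover have "\<forall>\<^sub>F r in at_right 0. 1 + volterra q (\<lambda>s. U s * profile s) r = profile r"
      unfolding eventually_at_right_field using fixpoint by (intro exI[of _ 1]) auto
    ultimately show "(profile \<longlongrightarrow> 1) (at_right 0)"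
      by (simp add: Lim_transform_eventually)
  qed
qed

end

lemma (in radial_potential) picard_summable:
  assumes "r \<in> {0<..<1}"
  shows "summable (\<lambda>k. picard q U k r)"
proof -
  obtain \<mu> where "\<mu> > 0" "\<And>k. continuous_on {0<..<1} (picard q U k)"
    and "\<And>k r. 0 < r \<Longrightarrow> r < 1 \<Longrightarrow> norm (picard q U k r) \<le> (3 / 4) ^ k * exp (\<mu> * r)"
    using picard_bound_exists by blast
  then have "norm (picard q U k r) \<le> (3 / 4) ^ k * exp (\<mu> * r)" for k using assms by auto
  moreover have "summable (\<lambda>k. (3 / 4) ^ k * exp (\<mu> * r))"
    by (intro summable_mult2 summable_geometric) simp
  ultimately show ?thesis by (rule summable_comparison_test'[rotated])
qed

lemma kernel_powr:
  assumes q: "2 * l + 1 = real q" and s: "0 < s" "s < r"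
  shows "1 / (2 * l + 1) * (r powr (l + 1) / s powr l - s powr (l + 1) / r powr l) * s powr (l + 1) =
    r powr (l + 1) * (volterra_kernel q r s * s)"
proof -
  have r: "0 < r" using s by simp
  have 1: "r powr (l + 1) / s powr l * s powr (l + 1) = r powr (l + 1) * s"
    using s by (simp add: powr_add)
  have "s powr (l + 1) / r powr l * s powr (l + 1) = r powr (l + 1) * s * (s powr (2 * l
      + 1) / r powr (2 * l + 1))"
  proof -
    have *: "A * s / B * (A * s) = B * r * s * (A * A * s / (B * B * r))" if "B \<noteq> 0" for A B :: real
      using that r by (simp add: divide_simps)
    show ?thesis
      unfolding mult_2 powr_add using s r *[of "r powr l" "s powr l"] by simp
  qed
  also have "s powr (2 * l + 1) / r powr (2 * l + 1) = (s / r) ^ q"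
    using s r by (simp add: q powr_realpow power_divide)
  finally have 2: "s powr (l + 1) / r powr l * s powr (l + 1) = r powr (l + 1) * s * (s / r) ^ q" .
  have "1 / (2 * l + 1) * (r powr (l + 1) / s powr l - s powr (l + 1) / r powr l) * s powr (l + 1) =
     1 / (2 * l + 1) * (r powr (l + 1) / s powr l * s powr (l + 1) - s powr (l
         + 1) / r powr l * s powr (l + 1))"
    by (simp add: algebra_simps)
  also have "\<dots> = r powr (l + 1) * ((1 - (s / r) ^ q) / real q * s)"
    unfolding 1 2 q by (simp add: algebra_simps diff_divide_distrib)
  finally show ?thesis using s by (simp add: volterra_kernel_def)
qed

text \<open>For \<open>0 < r < 1\<close> the integrals in \<open>psi\<close> see only the values of \<open>V\<close> on \<open>(0,1)\<close>.\<close>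

lemma psi_eq_picard:
  fixes V :: "real \<Rightarrow> complex"
  assumes q: "2 * l + 1 = real q"
  defines "U \<equiv> (\<lambda>s. indicator {0<..<1} s *\<^sub>R (of_real s * V s))"
  shows "0 < r \<Longrightarrow> r < 1 \<Longrightarrow> psi l V k r = of_real (r powr (l + 1)) * picard q U k r"
proof (induction k arbitrary: r)
  case (Suc k)
  have "psi l V (Suc k) r = (LINT s|lebesgue. of_real (r powr (l
      + 1)) * (volterra_kernel q r s *\<^sub>R (U s * picard q U k s)))"
    unfolding psi.simps set_lebesgue_integral_def
  proof (rule Bochner_Integration.integral_cong[OF refl])
    fix s
    show "indicator {0<..<r} s *\<^sub>R (of_real (1 / (2 * l + 1) * (r powr (l + 1) / s powr l - s powr (l
        + 1) / r powr l)) *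
        V s * psi l V k s) = of_real (r powr (l
            + 1)) * (volterra_kernel q r s *\<^sub>R (U s * picard q U k s))"
    proof (cases "s \<in> {0<..<r}")
      case True
      then have s: "0 < s" "s < r" by auto
      let ?c = "1 / (2 * l + 1) * (r powr (l + 1) / s powr l - s powr (l + 1) / r powr l)"
      have "psi l V k s = of_real (s powr (l + 1)) * picard q U k s"
        by (rule Suc.IH) (use s Suc.prems in auto)
      then have "of_real ?c * V s * psi l V k s = of_real (?c * s powr (l + 1)) * V s * picard q U k s"
        by (simp only: of_real_mult mult_ac)
      also have "\<dots> = of_real (r powr (l + 1)) * (volterra_kernel q r s *\<^sub>R (U s * picard q U k s))"
        unfolding kernel_powr[OF q s] using s Suc.prems by (simp add: U_def scaleR_conv_of_real mult_ac)
      finally show ?thesis using True by simp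
    next
      case False
      then have "s \<le> 0 \<or> r \<le> s" by auto
      then show ?thesis using False by (auto simp: volterra_kernel_def U_def)
    qed
  qed
  also have "\<dots> = of_real (r powr (l + 1)) * picard q U (Suc k) r"
    unfolding picard.simps volterra_def by (rule integral_mult_right_zero)
  finally show ?case .
qed simp

lemma alpha_properties:
  fixes V :: "real \<Rightarrow> complex"
  assumes d: "d \<ge> 3"
    and V: "V \<in> borel_measurable (lebesgue_on {0<..<1})"
    and int: "integrable (lebesgue_on {0<..<1}) (\<lambda>r. r * cmod (V r))"
  obtains \<beta> C where "C \<ge> 0"
    "\<And>r. r \<in> {0<..<1} \<Longrightarrow> cmod (alpha d V m r) \<le> C"
    "\<And>r. r \<in> {0<..<1} \<Longrightarrow> cmod (\<beta> r) \<le> C / r"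
    "\<And>r. r \<in> {0<..<1} \<Longrightarrow> (alpha d V m has_vector_derivative \<beta> r) (at r)"
    "continuous_on {0<..<1} \<beta>"
    "(alpha d V m \<longlongrightarrow> 1) (at_right 0)"
proof -
  define q where "q = 2 * m + (d - 2)"
  have q: "2 * ell d m + 1 = real q"
    using d by (simp add: ell_def q_def field_simps of_nat_diff)
  note psi_eq = psi_eq_picard[OF q]
  define U where "U s = indicator {0<..<1} s *\<^sub>R (of_real s * V s)" for s
  have V_meas: "(\<lambda>r. of_real r * V r) \<in> borel_measurable (lebesgue_on {0<..<1})"
  proof (intro borel_measurable_times V)
    have "(of_real :: real \<Rightarrow> complex) \<in> borel_measurable borel"
      by (intro borel_measurable_continuous_onI continuous_intros)
    then show "(of_real :: real \<Rightarrow> complex) \<in> borel_measurable (lebesgue_on {0<..<1})"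
      by (rule borel_measurable_lebesgue_on_borel)
  qed
  have "integrable (lebesgue_on {0<..<1}) (\<lambda>r. of_real r * V r)"
    by (rule Bochner_Integration.integrable_bound[OF int V_meas])
      (auto intro!: AE_I2 simp: norm_mult)
  then have U_int: "integrable lebesgue U"
    unfolding U_def[abs_def] by (subst (asm) integrable_restrict_space) auto
  interpret radial_potential q U
  proof
    show "q \<ge> 1" using d by (simp add: q_def)
    show "integrable lebesgue U" by (rule U_int)
    show "U s = 0" if "s \<notin> {0<..<1}" for s using that by (simp add: U_def)
  qed
  have eq: "alpha d V m r = profile r" if r: "r \<in> {0<..<1}" for r
  proof -
    have "regular_solution (ell d m) V r = (\<Sum>k. of_real (r powr (ell d m + 1)) * picard q U k r)"
      unfolding regular_solution_def
      using psi_eq[of r V] r by (simp add: U_def[abs_def])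
    also have "\<dots> = of_real (r powr (ell d m + 1)) * profile r"
      unfolding profile_def by (rule suminf_mult[OF picard_summable[OF r]])
    finally show ?thesis using r by (simp add: alpha_def)
  qed
  obtain C where C: "C \<ge> 0"
    "\<And>r. r \<in> {0<..<1} \<Longrightarrow> norm (profile r) \<le> C"
    "\<And>r. r \<in> {0<..<1} \<Longrightarrow> norm (profile_deriv r) \<le> C / r"
    "\<And>r. r \<in> {0<..<1} \<Longrightarrow> (profile has_vector_derivative profile_deriv r) (at r)"
    "continuous_on {0<..<1} profile_deriv"
    "(profile \<longlongrightarrow> 1) (at_right 0)"
    using profile_properties by blast
  show thesis
  proof (rule that[of C profile_deriv])
    show "(alpha d V m has_vector_derivative profile_deriv r) (at r)" if "r \<in> {0<..<1}" for r
      by (rule has_vector_derivative_transform_within_open[OF C(4), of _ "{0<..<1}"])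
        (use that eq in auto)
    have "\<forall>\<^sub>F r in at_right 0. profile r = alpha d V m r"
      unfolding eventually_at_right_field using eq by (intro exI[of _ 1]) auto
    then show "(alpha d V m \<longlongrightarrow> 1) (at_right 0)"
      by (rule Lim_transform_eventually[OF C(6)])
  qed (use C eq in auto)
qed

section \<open>Homogeneous polynomials and a weighted Green identity\<close>

lemma real_polynomial_partial:
  fixes f :: "real^'n \<Rightarrow> real"
  assumes "real_polynomial_function f"
  shows "\<exists>f'. real_polynomial_function f' \<and>
    (\<forall>x. ((\<lambda>t. f (x + t *\<^sub>R axis i 1)) has_real_derivative f' x) (at 0))"
  using assms
proof (induction rule: real_polynomial_function.induct)
  case (linear f)
  then interpret bounded_linear f .
  have "((\<lambda>t. f (x + t *\<^sub>R axis i 1)) has_real_derivative f (axis i 1)) (at 0)" for x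
    by (auto simp: local.add scaleR intro!: derivative_eq_intros)
  then show ?case by (intro exI[of _ "\<lambda>_. f (axis i 1)"]) (auto intro: real_polynomial_function.intros)
next
  case (const c)
  then show ?case by (intro exI[of _ "\<lambda>_. 0"]) (auto intro: real_polynomial_function.intros)
next
  case (add f g)
  then obtain f' g' where f': "real_polynomial_function f'" "real_polynomial_function g'"
    and d: "\<And>x. ((\<lambda>t. f (x + t *\<^sub>R axis i 1)) has_real_derivative f' x) (at 0)"
      "\<And>x. ((\<lambda>t. g (x + t *\<^sub>R axis i 1)) has_real_derivative g' x) (at 0)"
    by blast
  show ?case
    by (intro exI[of _ "\<lambda>x. f' x + g' x"] conjI allI DERIV_add d real_polynomial_function.intros f')
next
  case (mult f g)
  then obtain f' g' where f': "real_polynomial_function f'" "real_polynomial_function g'"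
    and d: "\<And>x. ((\<lambda>t. f (x + t *\<^sub>R axis i 1)) has_real_derivative f' x) (at 0)"
      "\<And>x. ((\<lambda>t. g (x + t *\<^sub>R axis i 1)) has_real_derivative g' x) (at 0)"
    by blast
  have "((\<lambda>t. f (x + t *\<^sub>R axis i 1) * g (x + t *\<^sub>R axis i 1)) has_real_derivative f' x * g x
      + g' x * f x) (at 0)" for x
    using DERIV_mult[OF d(1)[of x] d(2)[of x]] by simp
  moreover have "real_polynomial_function (\<lambda>x. f' x * g x + g' x * f x)"
    by (intro real_polynomial_function.intros f' mult)
  ultimately show ?case by (intro exI[of _ "\<lambda>x. f' x * g x + g' x * f x"]) simp
qed

lemma polynomial_function_complex_iff:
  "polynomial_function P \<longleftrightarrow>
     real_polynomial_function (\<lambda>x. Re (P x)) \<and> real_polynomial_function (\<lambda>x. Im (P x))"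
  for P :: "'a::euclidean_space \<Rightarrow> complex"
  unfolding polynomial_function_iff_Basis_inner Basis_complex_def by (simp add: inner_complex_def)

lemma polynomial_function_partial:
  fixes P :: "real^'n \<Rightarrow> complex"
  assumes "polynomial_function P"
  shows "polynomial_function (partial i P)" "has_partial P i x (partial i P x)"
proof -
  have re_im: "real_polynomial_function (\<lambda>x. Re (P x))" "real_polynomial_function (\<lambda>x. Im (P x))"
    using assms unfolding polynomial_function_complex_iff by auto
  obtain R I where p: "real_polynomial_function R" "real_polynomial_function I"
    and d: "\<And>x. ((\<lambda>t. Re (P (x + t *\<^sub>R axis i 1))) has_real_derivative R x) (at 0)"
      "\<And>x. ((\<lambda>t. Im (P (x + t *\<^sub>R axis i 1))) has_real_derivative I x) (at 0)"
    using real_polynomial_partial[OF re_im(1), of i] real_polynomial_partial[OF re_im(2), of i] by blast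
  have h: "has_partial P i x (Complex (R x) (I x))" for x
    using d[of x] unfolding has_partial_def
    by (simp add: has_vector_derivative_complex_iff has_real_derivative_iff_has_vector_derivative)
  then have eq: "partial i P = (\<lambda>x. Complex (R x) (I x))"
    by (intro ext has_partial_imp_partial)
  show "polynomial_function (partial i P)"
    unfolding eq polynomial_function_complex_iff using p by simp
  show "has_partial P i x (partial i P x)" using h by (simp add: eq)
qed

lemma continuous_on_polynomial: "polynomial_function P \<Longrightarrow> continuous_on S P"
  for P :: "'a::euclidean_space \<Rightarrow> complex"
  by (rule continuous_on_polymonial_function)

context
  fixes P :: "real^'n \<Rightarrow> complex" and m :: nat
  assumes poly: "polynomial_function P"
    and hom: "\<And>t x. P (t *\<^sub>R x) = of_real (t ^ m) * P x"
begin

lemma homogeneous_sgn: "P x = of_real (norm x ^ m) * P (sgn x)"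
  using hom[of "norm x" "sgn x"] by (cases "x = 0") (simp_all add: sgn_div_norm)

text \<open>For \<open>m = 0\<close> both sides vanish, because a homogeneous function of degree \<open>0\<close> in this sense is constant;
  this makes the truncated exponent \<open>m - 1\<close> correct.\<close>

lemma homogeneous_partial:
  assumes t: "t > 0"
  shows "partial i P (t *\<^sub>R x) = of_real (t ^ (m - 1)) * partial i P x"
proof (cases m)
  case 0
  then have "P x = P 0" for x using hom[of 0 x] by simp
  then have "P = (\<lambda>_. P 0)" by blast
  then have "has_partial P i x 0" for x by (metis has_partial_const)
  then have "partial i P x = 0" for x by (rule has_partial_imp_partial)
  then show ?thesis by simp
next
  case (Suc k)
  have "((\<lambda>s. t * s) has_vector_derivative t) (at 0)"
    by (auto intro!: derivative_eq_intros simp: has_vector_derivative_def)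
  moreover have "((\<lambda>s. P (t *\<^sub>R x
      + s *\<^sub>R axis i 1)) has_vector_derivative partial i P (t *\<^sub>R x)) (at (t * 0))"
    using polynomial_function_partial(2)[OF poly] by (simp add: has_partial_def)
  ultimately have "((\<lambda>s. P (t *\<^sub>R x
      + s *\<^sub>R axis i 1)) \<circ> (\<lambda>s. t * s) has_vector_derivative t *\<^sub>R partial i P (t *\<^sub>R x)) (at 0)"
    by (rule vector_diff_chain_at)
  moreover have "(\<lambda>s. P (t *\<^sub>R x + s *\<^sub>R axis i 1)) \<circ> (\<lambda>s. t * s) = (\<lambda>s. of_real (t ^ m) * P (x
      + s *\<^sub>R axis i 1))"
  proof
    fix s
    show "((\<lambda>s. P (t *\<^sub>R x + s *\<^sub>R axis i 1)) \<circ> (\<lambda>s. t * s)) s = of_real (t ^ m) * P (x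
        + s *\<^sub>R axis i 1)"
      using hom[of t "x + s *\<^sub>R axis i 1"] by (simp add: scaleR_add_right)
  qed
  moreover have "((\<lambda>s. of_real (t ^ m) * P (x
      + s *\<^sub>R axis i 1)) has_vector_derivative of_real (t ^ m) * partial i P x) (at 0)"
    using polynomial_function_partial(2)[OF poly, of i x] unfolding has_partial_def
    by (rule has_vector_derivative_mult_right)
  ultimately have "t *\<^sub>R partial i P (t *\<^sub>R x) = of_real (t ^ m) * partial i P x"
    by (auto intro: vector_derivative_unique_at)
  then show ?thesis using t by (simp add: Suc scaleR_conv_of_real)
qed

lemma homogeneous_partial_sgn:
  "x \<noteq> 0 \<Longrightarrow> partial i P x = of_real (norm x ^ (m - 1)) * partial i P (sgn x)"
  using homogeneous_partial[of "norm x" i "sgn x"] by (simp add: sgn_div_norm)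

lemma Euler_homogeneous: "(\<Sum>i\<in>UNIV. of_real (x $ i) * partial i P x) = of_nat m * P x"
proof -
  obtain D where D: "(P has_derivative D) (at x)"
    using differentiable_at_polynomial_function[OF poly, of x UNIV] unfolding differentiable_def
        by blast
  then interpret D: bounded_linear D by (rule has_derivative_bounded_linear)
  have DP: "D (axis i 1) = partial i P x" for i
  proof -
    have "((\<lambda>t. x + t *\<^sub>R axis i 1) has_derivative (\<lambda>t. t *\<^sub>R axis i 1)) (at (0::real))"
      by (auto intro!: derivative_eq_intros)
    from has_derivative_compose[OF this, of P D] D
    have "has_partial P i x (D (axis i 1))"
      unfolding has_partial_def has_vector_derivative_def by (simp add: D.scaleR)
    then show ?thesis by (simp add: has_partial_imp_partial)
  qed
  have "((\<lambda>t. t *\<^sub>R x) has_derivative (\<lambda>t. t *\<^sub>R x)) (at (1::real))"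
    by (auto intro!: derivative_eq_intros)
  from has_derivative_compose[OF this, of P D] D
  have "((\<lambda>t. P (t *\<^sub>R x)) has_vector_derivative D x) (at 1)"
    unfolding has_vector_derivative_def by (simp add: D.scaleR)
  moreover have "((\<lambda>t. t ^ m) has_real_derivative real m) (at 1)"
    by (auto intro!: derivative_eq_intros)
  then have "((\<lambda>t. of_real (t ^ m) * P x) has_vector_derivative of_real (real m) * P x) (at 1)"
    by (intro has_vector_derivative_mult_left has_vector_derivative_of_real)
  ultimately have "D x = of_nat m * P x"
    by (simp add: hom vector_derivative_unique_at)
  moreover have "D x = (\<Sum>i\<in>UNIV. of_real (x $ i) * partial i P x)"
  proof -
    have "D x = D (\<Sum>i\<in>UNIV. x $ i *\<^sub>R axis i 1)"
      by (simp add: basis_expansion flip: scalar_mult_eq_scaleR)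
    also have "\<dots> = (\<Sum>i\<in>UNIV. x $ i *\<^sub>R D (axis i 1))"
      by (simp add: D.sum D.scaleR)
    finally show ?thesis by (simp add: DP scaleR_conv_of_real)
  qed
  ultimately show ?thesis by simp
qed

end

text \<open>The square of this weight is continuously differentiable and vanishes outside the unit ball. Products
  with polynomials can therefore be integrated by parts over the whole space, without boundary terms.\<close>

definition hat :: "real^'n \<Rightarrow> real" where
  "hat x = max 0 (1 - x \<bullet> x)"

lemma hat_eq_0: "norm x \<ge> 1 \<Longrightarrow> hat x = 0"
  using one_le_power[of "norm x" 2] by (simp add: hat_def dot_square_norm)

lemma continuous_on_hat: "continuous_on S hat"
  unfolding hat_def[abs_def] by (intro continuous_intros)

lemma positive_part_square_has_derivative:
  "((\<lambda>y::real. (max 0 y)\<^sup>2) has_real_derivative 2 * max 0 y) (at y)"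
proof -
  consider "y < 0" | "y = 0" | "y > 0" by linarith
  then show ?thesis
  proof cases
    case 1
    have "((\<lambda>y. 0) has_field_derivative (0::real)) (at y)" by simp
    then have "((\<lambda>y::real. (max 0 y)\<^sup>2) has_real_derivative 0) (at y)"
      by (rule has_field_derivative_transform_within_open[of _ _ _ "{..<0}"]) (use 1 in auto)
    then show ?thesis using 1 by simp
  next
    case 3
    have "((\<lambda>y. y\<^sup>2) has_field_derivative 2 * y) (at y)" by (auto intro!: derivative_eq_intros)
    then have "((\<lambda>y::real. (max 0 y)\<^sup>2) has_real_derivative 2 * y) (at y)"
      by (rule has_field_derivative_transform_within_open[of _ _ _ "{0<..}"]) (use 3 in auto)
    then show ?thesis using 3 by simp
  next
    case 2
    have "((\<lambda>h::real. (max 0 h)\<^sup>2 / h) \<longlongrightarrow> 0) (at 0)"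
    proof (rule Lim_null_comparison)
      show "((\<lambda>h::real. \<bar>h\<bar>) \<longlongrightarrow> 0) (at 0)" by (auto intro!: tendsto_eq_intros)
      show "\<forall>\<^sub>F h::real in at 0. norm ((max 0 h)\<^sup>2 / h) \<le> \<bar>h\<bar>"
        by (auto simp: eventually_at_filter max_def power2_eq_square intro!: always_eventually)
    qed
    then show ?thesis using 2 by (simp add: has_field_derivative_iff)
  qed
qed

lemma has_partial_hat_square:
  "has_partial (\<lambda>x. of_real ((hat x)\<^sup>2)) i x (of_real (- 4 * x $ i * hat x))"
proof -
  let ?l = "\<lambda>t. x + t *\<^sub>R axis i 1 :: real^'a"
  have "((\<lambda>t. 1 - ?l t \<bullet> ?l t) has_real_derivative - 2 * x $ i) (at 0)"
  proof -
    have "?l t \<bullet> ?l t = x \<bullet> x + 2 * t * x $ i + t * t" for t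
      by (simp add: inner_add_left inner_add_right inner_axis inner_axis' inner_axis_axis algebra_simps)
    then show ?thesis by (auto intro!: derivative_eq_intros)
  qed
  then have "((\<lambda>t. (max 0 (1 - ?l t \<bullet> ?l t))\<^sup>2) has_real_derivative
      (2 * max 0 (1 - ?l 0 \<bullet> ?l 0)) * (- 2 * x $ i)) (at 0)"
    by (rule DERIV_chain2[OF positive_part_square_has_derivative])
  then have "((\<lambda>t. (hat (?l t))\<^sup>2) has_vector_derivative - 4 * x $ i * hat x) (at 0)"
    by (simp add: hat_def has_real_derivative_iff_has_vector_derivative mult_ac)
  then show ?thesis
    unfolding has_partial_def has_real_derivative_iff_has_vector_derivative[symmetric]
    by (rule has_vector_derivative_of_real)
qed

text \<open>Sum the integrals of \<open>\<partial>\<^sub>i (hat\<^sup>2 P cnj (\<partial>\<^sub>i Q))\<close> over \<open>i\<close>. The term with the Laplacian of \<open>Q\<close> drops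
  out, and the gradient of the weight is radial, so Euler's identity for \<open>Q\<close> evaluates the last term.\<close>

lemma Green_weighted:
  fixes P Q :: "real^'n \<Rightarrow> complex"
  assumes P: "polynomial_function P"
    and Q: "polynomial_function Q" "\<And>t x. Q (t *\<^sub>R x) = of_real (t ^ n) * Q x" "\<And>x. laplacian Q x = 0"
  shows "(LINT x|lborel. of_real ((hat x)\<^sup>2) * (\<Sum>i\<in>UNIV. partial i P x * cnj (partial i Q x))) =
    4 * of_nat n * (LINT x|lborel. of_real (hat x) * (P x * cnj (Q x)))"
proof -
  note polyP = P polynomial_function_partial(1)[OF P]
  note polyQ = Q(1) polynomial_function_partial(1)[OF Q(1)]
    polynomial_function_partial(1)[OF polynomial_function_partial(1)[OF Q(1)]]
  note cont = continuous_on_polynomial[OF polyP(1)] continuous_on_polynomial[OF polyP(2)]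
    continuous_on_polynomial[OF polyQ(1)] continuous_on_polynomial[OF polyQ(2)]
        continuous_on_polynomial[OF polyQ(3)]
    continuous_on_hat
  let ?F = "\<lambda>i x. of_real ((hat x)\<^sup>2) * (P x * cnj (partial i Q x))"
  let ?F' = "\<lambda>i x. of_real ((hat x)\<^sup>2) * (P x * cnj (partial i (partial i Q) x)
      + partial i P x * cnj (partial i Q x)) +
      of_real (- 4 * x $ i * hat x) * (P x * cnj (partial i Q x))"
  have int: "integrable lborel f" if "continuous_on UNIV f" "\<And>x. norm x \<ge> 1 \<Longrightarrow> f x = 0"
      for f :: "real^'n \<Rightarrow> complex"
  proof -
    have "integrable lborel (\<lambda>x. indicator (cball 0 1) x *\<^sub>R f x)"
      using borel_integrable_compact[of "cball 0 1" f] continuous_on_subset[OF that(1)] by auto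
    moreover have "indicator (cball 0 1) x *\<^sub>R f x = f x" for x
      using that(2)[of x] by (cases "norm x \<le> 1") auto
    ultimately show ?thesis by simp
  qed
  have F'_cont: "continuous_on UNIV (?F' i)" for i by (intro continuous_intros cont)
  have F'0: "(LINT x|lborel. ?F' i x) = 0" for i
  proof -
    have F_cont: "continuous_on UNIV (?F i)" by (intro continuous_intros cont)
    obtain B where B: "B \<ge> 0" "\<And>x. norm x \<le> 1 \<Longrightarrow> cmod (?F i x) \<le> B"
      using continuous_on_UNIV_bounded_on_ball[OF F_cont] by blast
    obtain C where C: "C \<ge> 0" "\<And>x. norm x \<le> 1 \<Longrightarrow> cmod (?F' i x) \<le> C"
      using continuous_on_UNIV_bounded_on_ball[OF F'_cont] by blast
    show ?thesis
    proof (rule integral_partial_eq_0(2))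
      show "?F i \<in> borel_measurable borel" by (rule borel_measurable_continuous_onI[OF F_cont])
      show "?F i x = 0" if "norm x \<ge> 1" for x using hat_eq_0[OF that] by simp
      show "cmod (?F i x) \<le> B" for x
        using B hat_eq_0[of x] by (cases "norm x \<le> 1") auto
      show "cmod (?F' i x) \<le> C" for x
        using C hat_eq_0[of x] by (cases "norm x \<le> 1") auto
      show "has_partial (?F i) i x (?F' i x)" for x
        by (rule has_partial_mult[OF has_partial_hat_square has_partial_mult[OF
              polynomial_function_partial(2)[OF P]
                  has_partial_cnj[OF polynomial_function_partial(2)[OF polyQ(2)]]]])
    qed
  qed
  have F'_int: "integrable lborel (?F' i)" for i
    by (rule int[OF F'_cont]) (simp add: hat_eq_0)
  have "0 = (\<Sum>i\<in>UNIV. LINT x|lborel. ?F' i x)" by (simp only: F'0 sum.neutral_const)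
  also have "\<dots> = (LINT x|lborel. (\<Sum>i\<in>UNIV. ?F' i x))"
    by (rule Bochner_Integration.integral_sum[symmetric]) (rule F'_int)
  also have "(\<lambda>x. \<Sum>i\<in>UNIV. ?F' i x) =
      (\<lambda>x. of_real ((hat x)\<^sup>2) * (\<Sum>i\<in>UNIV. partial i P x * cnj (partial i Q x)) -
        (4 * of_nat n) * (of_real (hat x) * (P x * cnj (Q x))))"
  proof
    fix x
    have lap: "(\<Sum>i\<in>UNIV. P x * cnj (partial i (partial i Q) x)) = 0"
      using Q(3)[of x] unfolding laplacian_def by (simp flip: sum_distrib_left cnj_sum)
    have euler: "(\<Sum>i\<in>UNIV. of_real (- 4 * x $ i * hat x) * (P x * cnj (partial i Q x))) =
        - (4 * of_nat n * (of_real (hat x) * (P x * cnj (Q x))))"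
    proof -
      have "(\<Sum>i\<in>UNIV. of_real (- 4 * x $ i * hat x) * (P x * cnj (partial i Q x))) =
          - 4 * of_real (hat x) * P x * cnj (\<Sum>i\<in>UNIV. of_real (x $ i) * partial i Q x)"
        by (simp add: sum_distrib_left mult_ac)
      also have "\<dots> = - 4 * of_real (hat x) * P x * cnj (of_nat n * Q x)"
        by (simp only: Euler_homogeneous[OF Q(1,2)])
      finally show ?thesis by simp
    qed
    have "(\<Sum>i\<in>UNIV. ?F' i x) =
        of_real ((hat x)\<^sup>2) * ((\<Sum>i\<in>UNIV. P x * cnj (partial i (partial i Q) x))
            + (\<Sum>i\<in>UNIV. partial i P x * cnj (partial i Q x)))
        + (\<Sum>i\<in>UNIV. of_real (- 4 * x $ i * hat x) * (P x * cnj (partial i Q x)))"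
      by (simp only: sum.distrib sum_distrib_left distrib_left)
    then show "(\<Sum>i\<in>UNIV. ?F' i x) =
      of_real ((hat x)\<^sup>2) * (\<Sum>i\<in>UNIV. partial i P x * cnj (partial i Q x)) -
        (4 * of_nat n) * (of_real (hat x) * (P x * cnj (Q x)))"
      unfolding lap euler by simp
  qed
  also have "(LINT x|lborel. of_real ((hat x)\<^sup>2) * (\<Sum>i\<in>UNIV. partial i P x * cnj (partial i Q x)) -
        (4 * of_nat n) * (of_real (hat x) * (P x * cnj (Q x)))) =
      (LINT x|lborel. of_real ((hat x)\<^sup>2) * (\<Sum>i\<in>UNIV. partial i P x * cnj (partial i Q x))) -
      (LINT x|lborel. (4 * of_nat n) * (of_real (hat x) * (P x * cnj (Q x))))"
    by (intro Bochner_Integration.integral_diff int continuous_intros cont) (simp_all add: hat_eq_0)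
  finally show ?thesis by simp
qed

section \<open>Separation of radial and angular integration\<close>

lemma ball_in_sets_borel [measurable]: "ball (c::'a::metric_space) r \<in> sets borel"
  by (simp add: borel_open)

lemma emeasure_cone_scaling:
  fixes F :: "'a::euclidean_space \<Rightarrow> ennreal"
  assumes [measurable]: "F \<in> borel_measurable borel" and r: "r > 0"
  shows "(\<integral>\<^sup>+x. indicator (ball 0 r) x * F (sgn x) \<partial>lborel) =
    ennreal (r ^ DIM('a)) * (\<integral>\<^sup>+x. indicator (ball 0 1) x * F (sgn x) \<partial>lborel)"
proof -
  have [measurable]: "(sgn :: 'a \<Rightarrow> 'a) \<in> borel_measurable borel"
    unfolding sgn_div_norm[abs_def] by measurable
  have "(\<integral>\<^sup>+x. indicator (ball 0 r) x * F (sgn x) \<partial>lborel) =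
    (\<integral>\<^sup>+x. indicator (ball 0 r) x * F (sgn x) \<partial>density (distr lborel borel (\<lambda>x::'a. 0
        + r *\<^sub>R x)) (\<lambda>_. ennreal (\<bar>r\<bar> ^ DIM('a))))"
    using r by (subst lborel_affine[of r 0]) auto
  also have "\<dots>
      = (\<integral>\<^sup>+x. ennreal (r ^ DIM('a)) * (indicator (ball 0 r) (r *\<^sub>R x) * F (sgn (r *\<^sub>R x))) \<partial>lborel)"
    using r by (subst nn_integral_density) (auto simp: nn_integral_distr)
  also have "\<dots>
      = ennreal (r ^ DIM('a)) * (\<integral>\<^sup>+x. indicator (ball 0 r) (r *\<^sub>R x) * F (sgn (r *\<^sub>R x)) \<partial>lborel)"
    by (rule nn_integral_cmult) measurable
  also have "(\<lambda>x::'a. indicator (ball 0 r) (r *\<^sub>R x) * F (sgn (r *\<^sub>R x)))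
      = (\<lambda>x. indicator (ball 0 1) x * F (sgn x))"
    using r by (auto simp: fun_eq_iff indicator_def sgn_scaleR)
  finally show ?thesis .
qed

text \<open>The measures \<open>F (sgn x) dx\<close> and \<open>c dx\<close> on the unit ball have the same image under the norm: both give
  mass proportional to \<open>a^d\<close> to the ball of radius \<open>a \<le> 1\<close>, and \<open>c\<close> makes the constants agree. This separates
  the variables without polar coordinates.\<close>

lemma radial_integral_nonneg:
  fixes F :: "'a::euclidean_space \<Rightarrow> real" and f :: "real \<Rightarrow> complex"
  assumes [measurable]: "F \<in> borel_measurable borel" "f \<in> borel_measurable borel"
    and F: "\<And>x. norm x \<le> 1 \<Longrightarrow> 0 \<le> F x" "\<And>x. norm x \<le> 1 \<Longrightarrow> F x \<le> B"
  defines "c \<equiv> (LINT x:ball 0 1|lborel. F (sgn x)) / measure lborel (ball (0::'a) 1)"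
  shows "(LINT x:ball (0::'a) 1|lborel. F (sgn x) *\<^sub>R f (norm x))
      = (LINT x:ball (0::'a) 1|lborel. c *\<^sub>R f (norm x))"
proof -
  have [measurable]: "(sgn :: 'a \<Rightarrow> 'a) \<in> borel_measurable borel"
    unfolding sgn_div_norm[abs_def] by measurable
  have sgn_le: "norm (sgn x) \<le> 1" for x :: 'a by (simp add: norm_sgn)
  note Fs = F(1)[OF sgn_le] F(2)[OF sgn_le]
  let ?v = "measure lborel (ball (0::'a) 1)"
  have v: "?v > 0" using content_ball_pos[of 1 "0::'a"] by simp
  have v': "emeasure lborel (ball (0::'a) 1) = ennreal ?v"
    by (rule emeasure_eq_ennreal_measure) (use emeasure_lborel_ball_finite[of "0::'a" 1] in auto)
  have F_int: "integrable lborel (\<lambda>x. indicator (ball 0 1) x * F (sgn x))"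
  proof (rule Bochner_Integration.integrable_bound)
    show "integrable lborel (\<lambda>x::'a. indicator (ball 0 1) x * B)"
      using emeasure_lborel_ball_finite[of "0::'a" 1] by (auto simp: less_top)
    show "AE x in lborel. norm (indicator (ball 0 1) x * F (sgn x)) \<le> norm (indicator (ball 0 1) x * B)"
      using Fs(1) by (auto intro!: AE_I2 simp: indicator_def intro: order_trans[OF Fs(2) abs_ge_self])
  qed measurable
  have c: "c \<ge> 0"
    unfolding c_def set_lebesgue_integral_def using Fs v
    by (intro divide_nonneg_pos Bochner_Integration.integral_nonneg) auto
  have total: "(\<integral>\<^sup>+x. indicator (ball 0 1) x * ennreal (F (sgn x)) \<partial>lborel) = ennreal (c * ?v)"
  proof -
    have "(\<integral>\<^sup>+x. indicator (ball 0 1) x * ennreal (F (sgn x)) \<partial>lborel) =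
        (\<integral>\<^sup>+x. ennreal (indicator (ball 0 1) x * F (sgn x)) \<partial>lborel)"
      by (intro nn_integral_cong) (auto simp: indicator_def)
    also have "\<dots> = ennreal (LINT x|lborel. indicator (ball 0 1) x * F (sgn x))"
      using Fs by (intro nn_integral_eq_integral F_int) auto
    finally show ?thesis using v by (simp add: c_def set_lebesgue_integral_def)
  qed
  have total_c: "(\<integral>\<^sup>+x. indicator (ball 0 1) x * ennreal c \<partial>(lborel :: 'a measure)) = ennreal (c * ?v)"
    using c by (simp add: mult.commute[of "indicator _ _"] nn_integral_cmult_indicator v' ennreal_mult')
  define M where "M
      = (\<lambda>h::'a \<Rightarrow> real. distr (density lborel (\<lambda>x. ennreal (indicator (ball 0 1) x * h (sgn x)))) borel norm)"
  have M_ball: "emeasure (M h) {..<a} = (if a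
      \<le> 0 then 0 else ennreal (min a 1 ^ DIM('a)) * ennreal (c * ?v))"
    if [measurable]: "h \<in> borel_measurable borel"
      and h: "(\<integral>\<^sup>+x. indicator (ball 0 1) x * ennreal (h (sgn x)) \<partial>lborel) = ennreal (c * ?v)" for h a
  proof -
    have "open (norm -` {..<a} :: 'a set)" by (intro open_vimage continuous_intros)
    then have [measurable]: "(norm -` {..<a} :: 'a set) \<in> sets borel" by (rule borel_open)
    have "emeasure (M h) {..<a}
        = (\<integral>\<^sup>+x. ennreal (indicator (ball 0 1) x * h (sgn x)) * indicator (norm -` {..<a}) x \<partial>lborel)"
      unfolding M_def by (subst emeasure_distr) (auto simp: emeasure_density)
    also have "\<dots> = (\<integral>\<^sup>+x. indicator (ball 0 (min a 1)) x * ennreal (h (sgn x)) \<partial>lborel)"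
      by (intro nn_integral_cong) (auto simp: indicator_def)
    also have "\<dots> = (if a \<le> 0 then 0 else ennreal (min a 1 ^ DIM('a)) * ennreal (c * ?v))"
    proof (cases "a \<le> 0")
      case False
      then show ?thesis
        using emeasure_cone_scaling[of "\<lambda>x. ennreal (h x)" "min a 1"] h by simp
    qed (simp add: ball_empty)
    finally show ?thesis .
  qed
  have "M F = M (\<lambda>_. c)"
  proof (rule measure_eqI_generator_eq[where E = "range lessThan" and \<Omega> = UNIV and A
      = "\<lambda>i. {..<real i}"])
    show "Int_stable (range (lessThan :: real \<Rightarrow> _))"
    proof (rule Int_stableI_image)
      show "\<exists>k\<in>UNIV. {..<i} \<inter> {..<j} = {..<k}" for i j :: real
        by (intro bexI[of _ "min i j"]) auto
    qed
    show "emeasure (M F) X = emeasure (M (\<lambda>_. c)) X" if "X \<in> range lessThan" for X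
      using that M_ball[OF _ total] M_ball[of "\<lambda>_. c"] total_c by auto
    show "emeasure (M F) {..<real i} \<noteq> \<infinity>" for i
      using M_ball[OF _ total, of "real i"] by (auto simp: ennreal_mult_eq_top_iff)
    show "sets (M F) = sigma_sets UNIV (range lessThan)" "sets (M (\<lambda>_. c))
        = sigma_sets UNIV (range lessThan)"
      unfolding M_def sets_distr borel_Iio by simp_all
    show "(\<Union>i. {..<real i}) = UNIV" using reals_Archimedean2 by auto
  qed auto
  moreover have "(LINT t|M h. f t) = (LINT x:ball 0 1|lborel. h (sgn x) *\<^sub>R f (norm x))"
    if [measurable]: "h \<in> borel_measurable borel" and "\<And>x. 0 \<le> h (sgn x)" for h
  proof -
    have "(LINT t|M h. f t)
        = (LINT x|density lborel (\<lambda>x. ennreal (indicator (ball 0 1) x * h (sgn x))). f (norm x))"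
      unfolding M_def by (rule integral_distr) measurable
    also have "\<dots> = (LINT x|lborel. (indicator (ball 0 1) x * h (sgn x)) *\<^sub>R f (norm x))"
      using that by (intro integral_density) auto
    finally show ?thesis by (simp add: set_lebesgue_integral_def)
  qed
  from this[of F] this[of "\<lambda>_. c"] have "(LINT t|M F. f t)
      = (LINT x:ball 0 1|lborel. F (sgn x) *\<^sub>R f (norm x))"
    "(LINT t|M (\<lambda>_. c). f t) = (LINT x:ball (0::'a) 1|lborel. c *\<^sub>R f (norm x))"
    using Fs c by auto
  ultimately show ?thesis by simp
qed

text \<open>The mean over the unit sphere, expressed as the mean over the unit ball of the extension that is constant
  along rays.\<close>

definition sphere_mean :: "('a::euclidean_space \<Rightarrow> complex) \<Rightarrow> complex" where
  "sphere_mean G = (LINT x:ball 0 1|lborel. G (sgn x)) / of_real (measure lborel (ball (0::'a) 1))"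

lemma borel_measurable_sgn [measurable]:
  "(sgn :: 'a::euclidean_space \<Rightarrow> 'a) \<in> borel_measurable borel"
  unfolding sgn_div_norm[abs_def] by measurable

lemma measure_unit_ball_pos: "measure lborel (ball (0::'a::euclidean_space) 1) > 0"
  using content_ball_pos[of 1 "0::'a"] by simp

lemma set_integrable_ball_bounded:
  fixes f :: "'a::euclidean_space \<Rightarrow> 'b::{banach, second_countable_topology}"
  assumes [measurable]: "f \<in> borel_measurable borel"
    and bound: "\<And>x. norm x < 1 \<Longrightarrow> norm (f x) \<le> B"
  shows "set_integrable lborel (ball 0 1) f"
  unfolding set_integrable_def
proof (rule Bochner_Integration.integrable_bound)
  show "integrable lborel (\<lambda>x::'a. indicator (ball 0 1) x * B)"
    using emeasure_lborel_ball_finite[of "0::'a" 1] by (auto simp: less_top)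
  show "AE x in lborel. norm (indicator (ball 0 1) x *\<^sub>R f x) \<le> norm (indicator (ball 0 1) x * B)"
    by (intro AE_I2) (auto simp: indicator_def intro: order_trans[OF bound abs_ge_self])
qed measurable

text \<open>Write \<open>G\<close> as a combination of the nonnegative functions \<open>Re G + B\<close> and \<open>Im G + B\<close> and a constant. This
  gives a factor that does not depend on \<open>f\<close>, and \<open>f = 1\<close> shows that it is the mean of \<open>G\<close>.\<close>

lemma radial_integral:
  fixes G :: "'a::euclidean_space \<Rightarrow> complex" and f :: "real \<Rightarrow> complex"
  assumes [measurable]: "G \<in> borel_measurable borel" "f \<in> borel_measurable borel"
    and G: "\<And>x. norm x \<le> 1 \<Longrightarrow> cmod (G x) \<le> B"
    and f: "set_integrable lborel (ball (0::'a) 1) (\<lambda>x. f (norm x))"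
  shows "(LINT x:ball (0::'a) 1|lborel. G (sgn x) * f (norm x)) =
      sphere_mean G * (LINT x:ball (0::'a) 1|lborel. f (norm x))"
    "set_integrable lborel (ball (0::'a) 1) (\<lambda>x. G (sgn x) * f (norm x))"
proof -
  let ?b = "ball (0::'a) 1"
  have sgn_le: "norm (sgn x) \<le> 1" for x :: 'a by (simp add: norm_sgn)
  have B: "B \<ge> 0" using G[of 0] by (simp add: order_trans[OF norm_ge_zero])
  have int: "set_integrable lborel ?b (\<lambda>x. h (sgn x) * k (norm x))"
    if [measurable]: "h \<in> borel_measurable borel" "k \<in> borel_measurable borel"
      and h: "\<And>x. norm x \<le> 1 \<Longrightarrow> cmod (h x) \<le> M" and k: "set_integrable lborel ?b (\<lambda>x. k (norm x))"
    for h :: "'a \<Rightarrow> complex" and k :: "real \<Rightarrow> complex" and M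
    unfolding set_integrable_def
  proof (rule Bochner_Integration.integrable_bound)
    show "integrable lborel (\<lambda>x. M *\<^sub>R (indicator ?b x *\<^sub>R k (norm x)))"
      using k unfolding set_integrable_def by (rule integrable_scaleR_right)
    show "AE x in lborel. norm (indicator ?b x *\<^sub>R (h (sgn x) * k (norm x)))
        \<le> norm (M *\<^sub>R indicator ?b x *\<^sub>R k (norm x))"
      by (intro AE_I2)
        (auto simp: indicator_def norm_mult intro!: mult_right_mono order_trans[OF h[OF sgn_le]
            abs_ge_self])
  qed measurable
  show "set_integrable lborel ?b (\<lambda>x. G (sgn x) * f (norm x))"
    by (rule int[OF _ _ G f]) measurable
  define F1 where "F1 x = Re (G x) + B" for x
  define F2 where "F2 x = Im (G x) + B" for x
  have [measurable]: "F1 \<in> borel_measurable borel" "F2 \<in> borel_measurable borel"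
    unfolding F1_def[abs_def] F2_def[abs_def] by measurable
  have F: "0 \<le> F1 x" "F1 x \<le> 2 * B" "0 \<le> F2 x" "F2 x \<le> 2 * B" if "norm x \<le> 1" for x
    using G[OF that] abs_Re_le_cmod[of "G x"] abs_Im_le_cmod[of "G x"]
        by (auto simp: F1_def F2_def abs_le_iff)
  have Fc: "cmod (of_real (F1 x)) \<le> 2 * B" "cmod (of_real (F2 x)) \<le> 2 * B" if "norm x \<le> 1" for x
    using F[OF that] by auto
  have G_eq: "G x = of_real (F1 x) + \<i> * of_real (F2 x) - (1 + \<i>) * of_real B" for x
    by (simp add: F1_def F2_def complex_eq_iff)
  define c where "c F = (LINT x:?b|lborel. F (sgn x)) / measure lborel ?b" for F :: "'a \<Rightarrow> real"
  \<comment> \<open>\<open>K\<close> combines the factors of the nonnegative parts as in \<open>G_eq\<close>.\<close>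
  define K where "K = complex_of_real (c F1) + \<i> * of_real (c F2) - (1 + \<i>) * of_real B"
  have K: "(LINT x:?b|lborel. G (sgn x) * k (norm x)) = K * (LINT x:?b|lborel. k (norm x))"
    if k_meas: "k \<in> borel_measurable borel" and k: "set_integrable lborel ?b (\<lambda>x. k (norm x))" for k
  proof -
    have 1: "(LINT x:?b|lborel. of_real (F1 (sgn x)) * k (norm x))
        = of_real (c F1) * (LINT x:?b|lborel. k (norm x))"
      "(LINT x:?b|lborel. of_real (F2 (sgn x)) * k (norm x))
          = of_real (c F2) * (LINT x:?b|lborel. k (norm x))"
      using radial_integral_nonneg[of F1 k "2 * B"] radial_integral_nonneg[of F2 k "2 * B"] F k_meas
      by (simp_all add: c_def scaleR_conv_of_real)
    have i1: "set_integrable lborel ?b (\<lambda>x. of_real (F1 (sgn x)) * k (norm x))"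
      by (rule int[OF _ k_meas Fc(1) k]) measurable
    have i2: "set_integrable lborel ?b (\<lambda>x. of_real (F2 (sgn x)) * k (norm x))"
      by (rule int[OF _ k_meas Fc(2) k]) measurable
    have "(LINT x:?b|lborel. G (sgn x) * k (norm x)) =
        (LINT x:?b|lborel. (of_real (F1 (sgn x)) * k (norm x)
            + \<i> * (of_real (F2 (sgn x)) * k (norm x))) -
          (1 + \<i>) * of_real B * k (norm x))"
      unfolding G_eq[of "sgn _"] by (simp only: distrib_right left_diff_distrib mult.assoc)
    also have "\<dots> = (of_real (c F1) * (LINT x:?b|lborel. k (norm x))
        + \<i> * (of_real (c F2) * (LINT x:?b|lborel. k (norm x)))) -
        (1 + \<i>) * of_real B * (LINT x:?b|lborel. k (norm x))"
      using i1 i2 k by (simp add: 1 set_integral_diff set_integral_add)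
    finally show ?thesis by (simp add: K_def algebra_simps)
  qed
  have "(LINT x:?b|lborel. G (sgn x) * 1) = K * (LINT x:?b|lborel. 1)"
    by (rule K) (auto intro: set_integrable_ball_bounded[where B = 1])
  also have "(LINT x:?b|lborel. 1) = complex_of_real (measure lborel ?b)"
    using set_integral_complex_of_real[of lborel ?b "\<lambda>_. 1"] by (simp add: set_lebesgue_integral_def)
  finally have "sphere_mean G = K"
    using measure_unit_ball_pos[where 'a='a] by (simp add: sphere_mean_def)
  then show "(LINT x:?b|lborel. G (sgn x) * f (norm x))
      = sphere_mean G * (LINT x:?b|lborel. f (norm x))"
    using K f by simp
qed

section \<open>Spherical means of products of harmonics\<close>

lemma set_integral_ball_pos:
  fixes f :: "'a::euclidean_space \<Rightarrow> real"
  assumes int: "set_integrable lborel (ball 0 1) f"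
    and nonneg: "\<And>x. norm x < 1 \<Longrightarrow> 0 \<le> f x"
    and pos: "0 < \<delta>" "\<And>x. 0 < norm x \<Longrightarrow> norm x < \<delta> \<Longrightarrow> 0 < f x"
  shows "0 < (LINT x:ball 0 1|lborel. f x)"
proof (rule ccontr)
  let ?f = "\<lambda>x. indicator (ball 0 1) x *\<^sub>R f x"
  have nn: "0 \<le> ?f x" for x using nonneg by (simp add: indicator_def)
  assume "\<not> ?thesis"
  moreover have "0 \<le> (LINT x|lborel. ?f x)" by (rule Bochner_Integration.integral_nonneg) (rule nn)
  ultimately have "(LINT x|lborel. ?f x) = 0" by (simp add: set_lebesgue_integral_def)
  then have "AE x in lborel. ?f x = 0"
    using int nn unfolding set_integrable_def by (subst (asm) integral_nonneg_eq_0_iff_AE) auto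
  with AE_lborel_singleton[of 0] have "AE x in lborel. x \<notin> ball (0::'a) (min \<delta> 1)"
  proof eventually_elim
    case (elim x)
    then show ?case using pos(2)[of x] by (auto simp: indicator_def split: if_splits)
  qed
  then have "ball (0::'a) (min \<delta> 1) \<in> null_sets lborel" by (subst AE_iff_null_sets) auto
  then have "measure lborel (ball (0::'a) (min \<delta> 1)) = 0" by (simp add: null_sets_def measure_def)
  then show False using content_ball_pos[of "min \<delta> 1" "0::'a"] pos(1) by simp
qed

lemma homogeneous_harmonic_polysD:
  assumes "P \<in> homogeneous_harmonic_polys m"
  shows "polynomial_function P" "\<And>t x. P (t *\<^sub>R x) = of_real (t ^ m) * P x" "\<And>x. laplacian P x = 0"
  using assms unfolding homogeneous_harmonic_polys_def by blast+

lemma continuous_on_harmonic_product: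
  assumes "P \<in> homogeneous_harmonic_polys m" "Q \<in> homogeneous_harmonic_polys n"
  shows "continuous_on UNIV (\<lambda>x. P x * cnj (Q x))"
    "continuous_on UNIV (\<lambda>x. \<Sum>i\<in>UNIV. partial i P x * cnj (partial i Q x))"
proof -
  note PQ = assms[THEN homogeneous_harmonic_polysD(1)]
  show "continuous_on UNIV (\<lambda>x. P x * cnj (Q x))"
    by (intro continuous_intros continuous_on_polynomial PQ)
  show "continuous_on UNIV (\<lambda>x. \<Sum>i\<in>UNIV. partial i P x * cnj (partial i Q x))"
    by (intro continuous_intros continuous_on_polynomial polynomial_function_partial(1) PQ)
qed

text \<open>The Green identity in both orders gives the same integral with the factors \<open>n\<close> and \<open>m\<close>, so the mean of
  \<open>P cnj Q\<close> vanishes for different degrees. Once it vanishes, the Green identity makes the mean of the product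
  of the gradients vanish too. The weights enter only through positive radial integrals.\<close>

lemma harmonic_sphere_means:
  fixes P Q :: "real^'n \<Rightarrow> complex"
  assumes P: "P \<in> homogeneous_harmonic_polys m" and Q: "Q \<in> homogeneous_harmonic_polys n"
    and orth: "m \<noteq> n \<or> sphere_mean (\<lambda>x. P x * cnj (Q x)) = 0"
  shows "sphere_mean (\<lambda>x. P x * cnj (Q x)) = 0"
    "sphere_mean (\<lambda>x. \<Sum>i\<in>UNIV. partial i P x * cnj (partial i Q x)) = 0"
proof -
  note PD = homogeneous_harmonic_polysD[OF P]
  note QD = homogeneous_harmonic_polysD[OF Q]
  define G where "G x = P x * cnj (Q x)" for x
  define H where "H x = (\<Sum>i\<in>UNIV. partial i P x * cnj (partial i Q x))" for x
  note cont = continuous_on_harmonic_product[OF P Q, folded G_def H_def]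
  note [measurable] = cont[THEN borel_measurable_continuous_onI]
  obtain B where B: "\<And>x. norm x \<le> 1 \<Longrightarrow> cmod (G x) \<le> B"
    using continuous_on_UNIV_bounded_on_ball[OF cont(1)] by blast
  obtain C where C: "\<And>x. norm x \<le> 1 \<Longrightarrow> cmod (H x) \<le> C"
    using continuous_on_UNIV_bounded_on_ball[OF cont(2)] by blast
  define w where "w j k r = (max 0 (1 - r\<^sup>2)) ^ j * r ^ k" for j k and r :: real
  have w_meas [measurable]: "w j k \<in> borel_measurable borel" for j k
    unfolding w_def[abs_def] by measurable
  have w_int: "set_integrable lborel (ball (0::real^'n) 1) (\<lambda>x. w j k (norm x))" for j k
  proof (rule set_integrable_ball_bounded)
    show "norm (w j k (norm x)) \<le> 1" if "norm x < 1" for x :: "real^'n"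
      using that unfolding w_def by (auto simp: abs_mult power_abs intro!: mult_le_one power_le_one)
  qed measurable
  have w_pos: "0 < (LINT x:ball (0::real^'n) 1|lborel. w j k (norm x))" for j k
  proof (rule set_integral_ball_pos[OF w_int])
    show "0 \<le> w j k (norm x)" for x :: "real^'n" by (simp add: w_def)
    show "0 < w j k (norm x)" if "0 < norm x" "norm x < 1" for x :: "real^'n"
      using that by (simp add: w_def power_less_one_iff less_max_iff_disj)
  qed simp
  have w_int': "set_integrable lborel (ball (0::real^'n) 1) (\<lambda>x. complex_of_real (w j k (norm x)))"
      for j k
    using w_int[of j k] unfolding set_integrable_def
        by (simp flip: of_real_mult scaleR_conv_of_real) (simp add: scaleR_conv_of_real flip: of_real_mult)
  have w_nz: "(LINT x:ball (0::real^'n) 1|lborel. complex_of_real (w j k (norm x))) \<noteq> 0" for j k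
    using w_pos[of j k] by (simp add: set_integral_complex_of_real)
  have I1: "(LINT x|lborel. of_real (hat x) * (P x * cnj (Q x))) =
      sphere_mean G * (LINT x:ball (0::real^'n) 1|lborel. complex_of_real (w 1 (m + n) (norm x)))"
  proof -
    have "(LINT x|lborel. of_real (hat x) * (P x * cnj (Q x))) =
        (LINT x:ball 0 1|lborel. G (sgn x) * complex_of_real (w 1 (m + n) (norm x)))"
      unfolding set_lebesgue_integral_def
    proof (rule Bochner_Integration.integral_cong[OF refl])
      fix x
      show "of_real (hat x) * (P x * cnj (Q x)) =
          indicator (ball 0 1) x *\<^sub>R (G (sgn x) * complex_of_real (w 1 (m + n) (norm x)))"
        using homogeneous_sgn[OF PD(1,2), of x] homogeneous_sgn[OF QD(1,2), of x] hat_eq_0[of x]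
        by (cases "norm x < 1") (simp_all add: G_def w_def hat_def dot_square_norm power_add)
    qed
    also have "\<dots> = sphere_mean G * (LINT x:ball (0::real^'n) 1|lborel. complex_of_real (w 1 (m
        + n) (norm x)))"
      by (rule radial_integral(1)[OF _ _ B w_int']) measurable
    finally show ?thesis .
  qed
  have I2: "(LINT x|lborel. of_real ((hat x)\<^sup>2) * H x) =
      sphere_mean H * (LINT x:ball (0::real^'n) 1|lborel. complex_of_real (w 2 ((m - 1)
          + (n - 1)) (norm x)))"
  proof -
    have "(LINT x|lborel. of_real ((hat x)\<^sup>2) * H x) =
        (LINT x:ball 0 1|lborel. H (sgn x) * complex_of_real (w 2 ((m - 1) + (n - 1)) (norm x)))"
      unfolding set_lebesgue_integral_def
    proof (rule integral_cong_AE)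
      show "(\<lambda>x. complex_of_real ((hat x)\<^sup>2) * H x) \<in> borel_measurable lborel"
        using cont(2) continuous_on_hat
            by (auto intro!: borel_measurable_continuous_onI continuous_intros)
      show "(\<lambda>x. indicator (ball 0 1) x *\<^sub>R (H (sgn x) * complex_of_real (w 2 ((m - 1)
          + (n - 1)) (norm x)))) \<in> borel_measurable lborel"
        by measurable
      show "AE x in lborel. of_real ((hat x)\<^sup>2) * H x =
          indicator (ball 0 1) x *\<^sub>R (H (sgn x) * complex_of_real (w 2 ((m - 1) + (n - 1)) (norm x)))"
        using AE_lborel_singleton[of 0]
      proof eventually_elim
        case (elim x)
        have "H x = of_real (norm x ^ (m - 1) * norm x ^ (n - 1)) * H (sgn x)"
          unfolding H_def sum_distrib_left
          by (intro sum.cong refl)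
            (simp add: homogeneous_partial_sgn[OF PD(1,2) elim]
                homogeneous_partial_sgn[OF QD(1,2) elim])
        then show ?case
          using hat_eq_0[of x]
              by (cases "norm x < 1") (simp_all add: w_def hat_def dot_square_norm power_add)
      qed
    qed
    also have "\<dots> = sphere_mean H * (LINT x:ball (0::real^'n) 1|lborel. complex_of_real (w 2 ((m - 1)
        + (n - 1)) (norm x)))"
      by (rule radial_integral(1)[OF _ _ C w_int']) measurable
    finally show ?thesis .
  qed
  let ?I1 = "LINT x|lborel. of_real (hat x) * (P x * cnj (Q x))"
  have green1: "(LINT x|lborel. of_real ((hat x)\<^sup>2) * H x) = 4 * of_nat n * ?I1"
    unfolding H_def by (rule Green_weighted[OF PD(1) QD])
  have green2: "(LINT x|lborel. of_real ((hat x)\<^sup>2) * H x) = 4 * of_nat m * ?I1"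
  proof -
    have "(LINT x|lborel. of_real ((hat x)\<^sup>2) * H x) =
        cnj (LINT x|lborel. of_real ((hat x)\<^sup>2) * (\<Sum>i\<in>UNIV. partial i Q x * cnj (partial i P x)))"
      unfolding H_def Bochner_Integration.integral_cnj[symmetric]
          by (simp add: mult.commute del: Bochner_Integration.integral_cnj)
    also have "\<dots> = cnj (4 * of_nat m * (LINT x|lborel. of_real (hat x) * (Q x * cnj (P x))))"
      by (simp only: Green_weighted[OF QD(1) PD])
    also have "\<dots> = 4 * of_nat m * cnj (LINT x|lborel. of_real (hat x) * (Q x * cnj (P x)))" by simp
    also have "cnj (LINT x|lborel. of_real (hat x) * (Q x * cnj (P x))) = ?I1"
      unfolding Bochner_Integration.integral_cnj[symmetric]
      by (simp add: mult.commute del: Bochner_Integration.integral_cnj)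
    finally show ?thesis .
  qed
  have mean_G: "sphere_mean G = 0"
  proof (cases "m = n")
    case True
    then show ?thesis using orth by (simp add: G_def[abs_def])
  next
    case False
    then have "?I1 = 0" using green1 green2 by simp
    then show ?thesis using I1 w_nz by simp
  qed
  then show "sphere_mean (\<lambda>x. P x * cnj (Q x)) = 0" by (simp add: G_def[abs_def])
  have "(LINT x|lborel. of_real ((hat x)\<^sup>2) * H x) = 0"
    using green1 I1 mean_G by simp
  then have "sphere_mean H = 0" using I2 w_nz by simp
  then show "sphere_mean (\<lambda>x. \<Sum>i\<in>UNIV. partial i P x * cnj (partial i Q x)) = 0"
    by (simp add: H_def[abs_def])
qed

lemma integral_scale_measure:
  fixes f :: "'a \<Rightarrow> complex"
  assumes [measurable]: "f \<in> borel_measurable M"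
  shows "(LINT x|scale_measure (of_nat k) M. f x) = of_nat k * (LINT x|M. f x)"
proof -
  have "scale_measure (of_nat k) M = density M (\<lambda>_. ennreal (real k))"
    by (rule measure_eqI) (auto simp: emeasure_density_const ennreal_of_nat_eq_real_of_nat)
  then have "(LINT x|scale_measure (of_nat k) M. f x) = (LINT x|M. real k *\<^sub>R f x)"
    by (simp only:) (rule integral_density; simp)
  then show ?thesis by (simp add: scaleR_conv_of_real)
qed

lemma sphere_inner_eq_sphere_mean:
  fixes P Q :: "real^'n \<Rightarrow> complex"
  assumes P: "P \<in> homogeneous_harmonic_polys m" and Q: "Q \<in> homogeneous_harmonic_polys n"
  shows "sphere_inner (\<lambda>\<xi>. if \<xi> \<in> sphere 0 1 then P \<xi> else 0) (\<lambda>\<xi>. if \<xi> \<in> sphere 0 1 then Q \<xi> else 0) =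
    of_real (real CARD('n) * measure lborel (ball (0::real^'n) 1)) * sphere_mean (\<lambda>x. P x * cnj (Q x))"
proof -
  let ?G = "\<lambda>x. P x * cnj (Q x)"
  let ?S = "restrict_space borel (sphere (0::real^'n) 1)"
  let ?B = "restrict_space lborel (ball (0::real^'n) 1 - {0})"
  have [measurable]: "?G \<in> borel_measurable borel"
    by (rule borel_measurable_continuous_onI[OF continuous_on_harmonic_product(1)[OF P Q]])
  let ?g = "\<lambda>\<xi>. (if \<xi> \<in> sphere 0 1 then P \<xi> else 0) * cnj (if \<xi> \<in> sphere 0 1 then Q \<xi> else 0)"
  have g: "?g \<in> borel_measurable ?S"
  proof -
    have "?G \<in> borel_measurable ?S" by (rule measurable_restrict_space1) measurable
    then show ?thesis by (rule measurable_cong[THEN iffD1, rotated]) (auto simp: space_restrict_space)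
  qed
  have sgn_eq: "(\<lambda>x::real^'n. x /\<^sub>R norm x) = sgn" by (simp add: sgn_div_norm fun_eq_iff)
  have sgn_meas: "sgn \<in> measurable ?B ?S"
    by (rule measurable_restrict_space3) (auto simp: norm_sgn)
  have "sphere_inner (\<lambda>\<xi>. if \<xi> \<in> sphere 0 1 then P \<xi> else 0) (\<lambda>\<xi>. if \<xi> \<in> sphere 0 1 then Q \<xi> else 0) =
      of_nat CARD('n) * (LINT \<xi>|distr ?B ?S sgn. ?g \<xi>)"
    unfolding sphere_inner_def surface_measure_def sgn_eq
    by (rule integral_scale_measure) (use g in simp)
  also have "(LINT \<xi>|distr ?B ?S sgn. ?g \<xi>) = (LINT x|?B. ?g (sgn x))"
    by (rule integral_distr[OF sgn_meas g])
  also have "\<dots> = (LINT x:ball 0 1 - {0}|lborel. ?g (sgn x))"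
    by (subst integral_restrict_space) (auto simp: set_lebesgue_integral_def borel_open)
  also have "\<dots> = (LINT x:ball 0 1|lborel. ?G (sgn x))"
    unfolding set_lebesgue_integral_def
  proof (rule integral_cong_AE)
    show "(\<lambda>x. indicator (ball 0 1) x *\<^sub>R ?G (sgn x)) \<in> borel_measurable lborel" by measurable
    have "(\<lambda>x. indicator (ball 0 1 - {0}) x *\<^sub>R ?g (sgn x))
        = (\<lambda>x. indicator (ball 0 1 - {0}) x *\<^sub>R ?G (sgn x))"
      by (auto simp: fun_eq_iff indicator_def norm_sgn)
    also have "\<dots> \<in> borel_measurable lborel" by measurable
    finally show "(\<lambda>x. indicator (ball 0 1 - {0}) x *\<^sub>R ?g (sgn x)) \<in> borel_measurable lborel" .
    show "AE x in lborel. indicator (ball 0 1 - {0}) x *\<^sub>R ?g (sgn x)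
        = indicator (ball 0 1) x *\<^sub>R ?G (sgn x)"
      using AE_lborel_singleton[of 0] by eventually_elim (auto simp: indicator_def norm_sgn)
  qed
  also have "\<dots> = of_real (measure lborel (ball (0::real^'n) 1)) * sphere_mean ?G"
    using measure_unit_ball_pos[where 'a="real^'n"] by (simp add: sphere_mean_def)
  finally show ?thesis by simp
qed

section \<open>Formal spherical polynomials in the Sobolev space\<close>

definition on_sphere :: "(real^'n \<Rightarrow> complex) \<Rightarrow> real^'n \<Rightarrow> complex" where
  "on_sphere P = (\<lambda>\<xi>. if \<xi> \<in> sphere 0 1 then P \<xi> else 0)"

lemma spherical_harmonics_eq: "spherical_harmonics m = on_sphere ` homogeneous_harmonic_polys m"
  by (simp add: spherical_harmonics_def on_sphere_def image_def)

lemma formal_sph_fun_on_sphere: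
  fixes P :: "real^'n \<Rightarrow> complex"
  assumes P: "P \<in> homogeneous_harmonic_polys m" and x: "norm x < 1"
  shows "formal_sph_fun V m (on_sphere P) x = alpha CARD('n) V m (norm x) * P x"
proof -
  have "P x = of_real (norm x ^ m) * P (direction x)"
    using homogeneous_harmonic_polysD(2)[OF P, of "norm x" "direction x"] direction_polar[of x] by simp
  then show ?thesis
    using x direction_polar[of x] by (simp add: formal_sph_fun_def on_sphere_def)
qed

lemma borel_measurable_lebesgue_on_AE:
  fixes f :: "'a::euclidean_space \<Rightarrow> 'b::euclidean_space"
  assumes f: "f \<in> borel_measurable (lebesgue_on S)" and S: "S \<in> sets lebesgue"
    and AE: "AE x in lebesgue_on S. f x = g x"
  shows "g \<in> borel_measurable (lebesgue_on S)"
proof -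
  have "(\<lambda>x. indicator S x *\<^sub>R f x) \<in> borel_measurable lebesgue"
    using f S by (simp add: borel_measurable_restrict_space_iff)
  moreover have "AE x in lebesgue. indicator S x *\<^sub>R f x = indicator S x *\<^sub>R g x"
    using AE S by (subst (asm) AE_restrict_space_iff) (auto elim!: eventually_mono simp: indicator_def)
  ultimately have "(\<lambda>x. indicator S x *\<^sub>R g x) \<in> borel_measurable lebesgue"
    by (rule borel_measurable_AE)
  then show ?thesis using S by (simp add: borel_measurable_restrict_space_iff)
qed

text \<open>The dimension is a number here, so that the radial functions do not depend on a type variable.\<close>

locale integrable_potential =
  fixes V :: "real \<Rightarrow> complex" and d :: nat
  assumes d: "d \<ge> 3"
    and V: "V \<in> borel_measurable (lebesgue_on {0<..<1})"
    and V_int: "integrable (lebesgue_on {0<..<1}) (\<lambda>r. r * cmod (V r))"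
begin

abbreviation \<alpha> :: "nat \<Rightarrow> real \<Rightarrow> complex" where
  "\<alpha> m \<equiv> alpha d V m"

definition \<beta> :: "nat \<Rightarrow> real \<Rightarrow> complex" where
  "\<beta> m r = vector_derivative (\<alpha> m) (at r)"

lemma alpha_facts:
  obtains C where "C \<ge> 0"
    "\<And>r. r \<in> {0<..<1} \<Longrightarrow> cmod (\<alpha> m r) \<le> C"
    "\<And>r. r \<in> {0<..<1} \<Longrightarrow> cmod (\<beta> m r) \<le> C / r"
    "\<And>r. r \<in> {0<..<1} \<Longrightarrow> (\<alpha> m has_vector_derivative \<beta> m r) (at r)"
    "(\<alpha> m \<longlongrightarrow> 1) (at_right 0)"
    "continuous_on {0<..<1} (\<alpha> m)" "continuous_on {0<..<1} (\<beta> m)"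
proof -
  obtain b C where C: "C \<ge> 0"
    "\<And>r. r \<in> {0<..<1} \<Longrightarrow> cmod (\<alpha> m r) \<le> C"
    "\<And>r. r \<in> {0<..<1} \<Longrightarrow> cmod (b r) \<le> C / r"
    "\<And>r. r \<in> {0<..<1} \<Longrightarrow> (\<alpha> m has_vector_derivative b r) (at r)"
    "continuous_on {0<..<1} b"
    "(\<alpha> m \<longlongrightarrow> 1) (at_right 0)"
    by (rule alpha_properties[OF d V V_int, of m], rule that)
  have b: "\<beta> m r = b r" if "r \<in> {0<..<1}" for r
    unfolding \<beta>_def by (rule vector_derivative_at[OF C(4)[OF that]])
  show thesis
  proof (rule that[of C])
    show "continuous_on {0<..<1} (\<alpha> m)"
    proof (intro continuous_at_imp_continuous_on ballI)
      fix r :: real assume "r \<in> {0<..<1}"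
      then show "isCont (\<alpha> m) r" by (rule has_vector_derivative_continuous[OF C(4)])
    qed
    have "continuous_on {0<..<1} (\<beta> m) \<longleftrightarrow> continuous_on {0<..<1} b"
      by (rule continuous_on_cong) (use b in auto)
    then show "continuous_on {0<..<1} (\<beta> m)" using C(5) by simp
  qed (use C b in auto)
qed

text \<open>Extension by zero gives Borel functions on the whole line.\<close>

definition alpha_ext :: "nat \<Rightarrow> real \<Rightarrow> complex" where
  "alpha_ext m r = indicator {0<..<1} r *\<^sub>R \<alpha> m r"

definition beta_ext :: "nat \<Rightarrow> real \<Rightarrow> complex" where
  "beta_ext m r = indicator {0<..<1} r *\<^sub>R \<beta> m r"

lemma ext_measurable [measurable]: "alpha_ext m \<in> borel_measurable borel" "beta_ext m
    \<in> borel_measurable borel"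
proof -
  have "continuous_on {0<..<1} (\<alpha> m)" "continuous_on {0<..<1} (\<beta> m)"
    by (rule alpha_facts[of m]; assumption)+
  then show "alpha_ext m \<in> borel_measurable borel" "beta_ext m \<in> borel_measurable borel"
    unfolding alpha_ext_def[abs_def] beta_ext_def[abs_def]
        by (auto intro!: borel_measurable_continuous_on_indicator)
qed

text \<open>The classical gradient on the punctured ball. It is zero at the origin and outside the ball, where the
  radial factors are.\<close>

definition grad :: "nat \<Rightarrow> (real^'n \<Rightarrow> complex) \<Rightarrow> real^'n \<Rightarrow> complex^'n" where
  "grad m P x = (\<chi> i. beta_ext m (norm x) * of_real (x $ i / norm x) * P x
      + alpha_ext m (norm x) * partial i P x)"

lemma
  fixes P :: "real^'n \<Rightarrow> complex"
  assumes d_eq: "CARD('n) = d" and P: "P \<in> homogeneous_harmonic_polys m"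
  shows is_weak_gradient_grad: "is_weak_gradient (formal_sph_fun V m (on_sphere P)) (grad m P)"
    and formal_sph_fun_W12: "formal_sph_fun V m (on_sphere P) \<in> W12_ball"
    and formal_sph_fun_measurable: "formal_sph_fun V m (on_sphere P) \<in> borel_measurable borel"
    and grad_measurable: "(\<lambda>x. grad m P x $ i) \<in> borel_measurable borel"
proof -
  note PD = homogeneous_harmonic_polysD[OF P]
  note cont = continuous_on_polynomial[OF PD(1)]
      continuous_on_polynomial[OF polynomial_function_partial(1)[OF PD(1)]]
  note [measurable] = cont[THEN borel_measurable_continuous_onI]
  let ?u = "formal_sph_fun V m (on_sphere P)"
  have u: "?u x = alpha_ext m (norm x) * P x + indicator {0} x *\<^sub>R P 0" for x
  proof (cases "norm x < 1")
    case True
    then show ?thesis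
      using formal_sph_fun_on_sphere[OF P True, of V] d_eq
      by (cases "x = 0") (auto simp: alpha_ext_def alpha_def)
  next
    case False
    then have "x \<noteq> 0" by auto
    then show ?thesis using False by (simp add: formal_sph_fun_def alpha_ext_def)
  qed
  show u_meas: "?u \<in> borel_measurable borel"
    unfolding u[abs_def] by measurable
  show grad_meas: "(\<lambda>x. grad m P x $ i) \<in> borel_measurable borel" for i
    unfolding grad_def vec_lambda_beta by measurable
  obtain C where C: "C \<ge> 0"
    "\<And>r. r \<in> {0<..<1} \<Longrightarrow> cmod (\<alpha> m r) \<le> C"
    "\<And>r. r \<in> {0<..<1} \<Longrightarrow> cmod (\<beta> m r) \<le> C / r"
    "\<And>r. r \<in> {0<..<1} \<Longrightarrow> (\<alpha> m has_vector_derivative \<beta> m r) (at r)"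
    "(\<alpha> m \<longlongrightarrow> 1) (at_right 0)" "continuous_on {0<..<1} (\<alpha> m)" "continuous_on {0<..<1} (\<beta> m)"
    by (rule alpha_facts[of m], rule that)
  obtain B where B: "B \<ge> 0" "\<And>x. norm x \<le> 1 \<Longrightarrow> cmod (P x) \<le> B"
    using continuous_on_UNIV_bounded_on_ball[OF cont(1)] by blast
  have "\<forall>i. \<exists>K\<ge>0. \<forall>x. norm x \<le> 1 \<longrightarrow> cmod (partial i P x) \<le> K"
  proof
    fix i
    obtain K where "K \<ge> 0" "\<And>x. norm x \<le> 1 \<Longrightarrow> cmod (partial i P x) \<le> K"
      using continuous_on_UNIV_bounded_on_ball[OF cont(2)] by blast
    then show "\<exists>K\<ge>0. \<forall>x. norm x \<le> 1 \<longrightarrow> cmod (partial i P x) \<le> K" by blast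
  qed
  then obtain K where K: "\<And>i. K i \<ge> 0" "\<And>i x. norm x \<le> 1 \<Longrightarrow> cmod (partial i P x) \<le> K i" by metis
  \<comment> \<open>One bound for all partial derivatives of \<open>P\<close>.\<close>
  define L where "L = (\<Sum>i\<in>UNIV. K i)"
  have KL: "K i \<le> L" for i unfolding L_def by (rule member_le_sum) (auto simp: K)
  have L: "L \<ge> 0" unfolding L_def by (intro sum_nonneg K)
  have h1: "CARD('n) \<ge> 3" using d d_eq by simp
  have h2: "?u x = 0" if "1 \<le> norm x" for x using that by (simp add: formal_sph_fun_def)
  have h3: "grad m P x = 0" if "1 \<le> norm x" for x using that
      by (simp add: grad_def alpha_ext_def beta_ext_def vec_eq_iff)
  have h4: "grad m P 0 = 0" by (simp add: grad_def alpha_ext_def beta_ext_def vec_eq_iff)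
  have h5: "cmod (?u x) \<le> C * B + B" for x
    proof -
      have "cmod (alpha_ext m (norm x) * P x) \<le> C * B"
        using mult_mono[OF C(2)[of "norm x"] B(2)[of x]] B(1) C(1)
        by (cases "norm x \<in> {0<..<1}") (auto simp: alpha_ext_def norm_mult)
      moreover have "cmod (indicator {0} x *\<^sub>R P 0) \<le> B"
        using B by (cases "x = 0") auto
      ultimately show ?thesis unfolding u by (rule norm_triangle_le[OF add_mono])
    qed
  have h6: "has_partial ?u i x (grad m P x $ i)" if x: "0 < norm x" "norm x < 1" for x i
    proof -
      have r: "norm x \<in> {0<..<1}" "x \<noteq> 0" using x by auto
      have "has_partial (\<lambda>x. \<alpha> m (norm x) * P x) i x
          (\<alpha> m (norm x) * partial i P x + of_real (x $ i / norm x) * \<beta> m (norm x) * P x)"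
        by (intro has_partial_mult has_partial_radial C(4) r polynomial_function_partial(2) PD(1))
      then have "has_partial ?u i x
          (\<alpha> m (norm x) * partial i P x + of_real (x $ i / norm x) * \<beta> m (norm x) * P x)"
        by (rule has_partial_cong_open[of _ _ _ _ "ball 0 1"])
          (use x formal_sph_fun_on_sphere[OF P] d_eq in auto)
      then show ?thesis using r by (simp add: grad_def alpha_ext_def beta_ext_def mult_ac add.commute)
    qed
  have h7: "cmod (grad m P x $ i) \<le> (C * B + C * L) / norm x" if x: "0 < norm x" "norm x < 1" for x i
    proof -
      have r: "norm x \<in> {0<..<1}" "x \<noteq> 0" using x by auto
      have "cmod (of_real (x $ i / norm x)) \<le> 1"
        using component_le_norm_cart[of x i] x by (simp add: norm_divide divide_le_eq_1)
      then have "cmod (\<beta> m (norm x) * of_real (x $ i / norm x) * P x) \<le> C / norm x * 1 * B"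
        unfolding norm_mult using B C x r by (intro mult_mono) auto
      moreover have "cmod (\<alpha> m (norm x) * partial i P x) \<le> C * L"
        unfolding norm_mult using C(1,2) K(2)[of x i] KL[of i] x r L by (intro mult_mono) auto
      moreover have "C * L \<le> C * L / norm x"
        using x C(1) L by (simp add: le_divide_eq mult_left_le)
      ultimately have "cmod (\<beta> m (norm x) * of_real (x $ i / norm x) * P x
          + \<alpha> m (norm x) * partial i P x) \<le>
          C * B / norm x + C * L / norm x"
        by (intro norm_triangle_le) simp
      then show ?thesis using r by (simp add: grad_def alpha_ext_def beta_ext_def add_divide_distrib)
    qed
  note pb = punctured_ball_gradient[OF h1 u_meas grad_meas h2 h3 h4 h5 h6 h7]
  show "is_weak_gradient ?u (grad m P)" "?u \<in> W12_ball" by (rule pb; assumption)+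
qed

lemma W12_inner_grad:
  fixes P Q :: "real^'n \<Rightarrow> complex"
  assumes d_eq: "CARD('n)
      = d" and P: "P \<in> homogeneous_harmonic_polys m" and Q: "Q \<in> homogeneous_harmonic_polys n"
  shows "W12_inner (formal_sph_fun V m (on_sphere P)) (formal_sph_fun V n (on_sphere Q)) =
    (LINT x:ball 0 1|lborel. formal_sph_fun V m (on_sphere P) x * cnj (formal_sph_fun V n (on_sphere Q) x)) +
    (LINT x:ball 0 1|lborel. (\<Sum>i\<in>UNIV. grad m P x $ i * cnj (grad n Q x $ i)))"
proof -
  let ?u = "formal_sph_fun V m (on_sphere P)" and ?v = "formal_sph_fun V n (on_sphere Q)"
  note [measurable] = formal_sph_fun_measurable[OF d_eq P] formal_sph_fun_measurable[OF d_eq Q]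
    grad_measurable[OF d_eq P] grad_measurable[OF d_eq Q]
  have AE: "AE x in lebesgue_on (ball 0 1). weak_gradient ?u x = grad m P x"
    "AE x in lebesgue_on (ball 0 1). weak_gradient ?v x = grad n Q x"
    by (intro weak_gradient_AE_eq is_weak_gradient_grad d_eq P Q)+
  have [measurable]: "cnj \<in> borel_measurable borel"
    by (intro borel_measurable_continuous_onI continuous_intros)
  have s_meas: "(\<lambda>x. \<Sum>i\<in>UNIV. grad m P x $ i * cnj (grad n Q x $ i)) \<in> borel_measurable borel"
    by measurable
  note s_meas' = borel_measurable_lebesgue_on_borel[OF s_meas, of "ball 0 1"]
  have s_AE: "AE x in lebesgue_on (ball 0 1). (\<Sum>i\<in>UNIV. grad m P x $ i * cnj (grad n Q x $ i)) =
      (\<Sum>i\<in>UNIV. weak_gradient ?u x $ i * cnj (weak_gradient ?v x $ i))"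
    using AE by eventually_elim simp
  have "(LINT x|lebesgue_on (ball 0 1). (\<Sum>i\<in>UNIV. weak_gradient ?u x $ i * cnj (weak_gradient ?v x $ i))) =
      (LINT x|lebesgue_on (ball 0 1). (\<Sum>i\<in>UNIV. grad m P x $ i * cnj (grad n Q x $ i)))"
  proof (rule integral_cong_AE[symmetric])
    show "(\<lambda>x. \<Sum>i\<in>UNIV. weak_gradient ?u x $ i * cnj (weak_gradient ?v x $ i))
        \<in> borel_measurable (lebesgue_on (ball 0 1))"
      by (rule borel_measurable_lebesgue_on_AE[OF s_meas' _ s_AE]) simp
  qed (rule s_meas' s_AE)+
  also have "\<dots> = (LINT x:ball 0 1|lborel. (\<Sum>i\<in>UNIV. grad m P x $ i * cnj (grad n Q x $ i)))"
    by (rule integral_lebesgue_on_eq_lborel(1)[OF s_meas]) measurable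
  finally have grad_part: "(LINT x|lebesgue_on (ball 0 1). (\<Sum>i\<in>UNIV. weak_gradient ?u x $ i * cnj (weak_gradient ?v x $ i))) =
      (LINT x:ball 0 1|lborel. (\<Sum>i\<in>UNIV. grad m P x $ i * cnj (grad n Q x $ i)))" .
  have "(LINT x|lebesgue_on (ball 0 1). ?u x * cnj (?v x))
      = (LINT x:ball 0 1|lborel. ?u x * cnj (?v x))"
    by (rule integral_lebesgue_on_eq_lborel(1)) measurable
  then show ?thesis unfolding W12_inner_def grad_part by (simp only:)
qed

end

lemma set_integrable_radial:
  fixes f :: "real \<Rightarrow> complex"
  assumes d: "CARD('n::finite) \<ge> 3" and [measurable]: "f \<in> borel_measurable borel"
    and bound: "\<And>r. 0 < r \<Longrightarrow> r < 1 \<Longrightarrow> cmod (f r) \<le> K / r\<^sup>2"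
  shows "set_integrable lborel (ball (0::real^'n) 1) (\<lambda>x. f (norm x))"
  unfolding set_integrable_def
proof (rule integrable_if_inverse_square_bound[OF d])
  show "norm (indicator (ball 0 1) x *\<^sub>R f (norm x)) \<le> K / (norm x)\<^sup>2"
    if "0 < norm x" "norm x < 1" for x :: "real^'n"
    using bound[of "norm x"] that by simp
  show "(\<lambda>x::real^'n. indicator (ball 0 1) x *\<^sub>R f (norm x)) \<in> borel_measurable borel" by measurable
qed simp

context integrable_potential
begin

lemma alpha_nonzero_near_0:
  obtains \<delta> where "0 < \<delta>" "\<delta> \<le> 1" "\<And>r. 0 < r \<Longrightarrow> r < \<delta> \<Longrightarrow> \<alpha> m r \<noteq> 0"
proof -
  have "(\<alpha> m \<longlongrightarrow> 1) (at_right 0)" by (rule alpha_facts[of m])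
  then have "\<forall>\<^sub>F r in at_right 0. \<alpha> m r \<noteq> 0" by (rule tendsto_imp_eventually_ne) simp
  then obtain \<delta> where "0 < \<delta>" "\<And>r. 0 < r \<Longrightarrow> r < \<delta> \<Longrightarrow> \<alpha> m r \<noteq> 0"
    unfolding eventually_at_right_field by auto
  then show thesis by (intro that[of "min \<delta> 1"]) auto
qed

lemma ext_bounds:
  obtains C where "C \<ge> 0"
    "\<And>r. 0 < r \<Longrightarrow> r < 1 \<Longrightarrow> cmod (alpha_ext m r) \<le> C / r" "\<And>r. 0 < r \<Longrightarrow> r < 1 \<Longrightarrow> cmod (alpha_ext m r) \<le> C"
    "\<And>r. 0 < r \<Longrightarrow> r < 1 \<Longrightarrow> cmod (beta_ext m r) \<le> C / r"
proof -
  obtain C where C: "C \<ge> 0"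
    "\<And>r. r \<in> {0<..<1} \<Longrightarrow> cmod (\<alpha> m r) \<le> C"
    "\<And>r. r \<in> {0<..<1} \<Longrightarrow> cmod (\<beta> m r) \<le> C / r"
    "\<And>r. r \<in> {0<..<1} \<Longrightarrow> (\<alpha> m has_vector_derivative \<beta> m r) (at r)"
    "(\<alpha> m \<longlongrightarrow> 1) (at_right 0)" "continuous_on {0<..<1} (\<alpha> m)" "continuous_on {0<..<1} (\<beta> m)"
    by (rule alpha_facts[of m], rule that)
  show thesis
  proof (rule that[OF C(1)])
    fix r :: real assume r: "0 < r" "r < 1"
    then show a: "cmod (alpha_ext m r) \<le> C" "cmod (beta_ext m r) \<le> C / r"
      using C(2,3)[of r] by (auto simp: alpha_ext_def beta_ext_def)
    have "C \<le> C / r" using r C(1) by (simp add: le_divide_eq mult_left_le)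
    with a(1) show "cmod (alpha_ext m r) \<le> C / r" by simp
  qed
qed

text \<open>After the product rule, Euler's identity turns \<open>x \<cdot> \<nabla>P\<close> and \<open>x \<cdot> \<nabla>Q\<close> into multiples of \<open>P\<close> and \<open>Q\<close>.
  Both integrands thus become radial functions times the two angular functions with mean zero.\<close>

lemma W12_inner_eq_0:
  fixes P Q :: "real^'n \<Rightarrow> complex"
  assumes d_eq: "CARD('n) = d"
    and P: "P \<in> homogeneous_harmonic_polys m" and Q: "Q \<in> homogeneous_harmonic_polys n"
    and orth: "m \<noteq> n \<or> sphere_mean (\<lambda>x. P x * cnj (Q x)) = 0"
  shows "W12_inner (formal_sph_fun V m (on_sphere P)) (formal_sph_fun V n (on_sphere Q)) = 0"
proof -
  note PD = homogeneous_harmonic_polysD[OF P]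
  note QD = homogeneous_harmonic_polysD[OF Q]
  define G where "G x = P x * cnj (Q x)" for x
  define H where "H x = (\<Sum>i\<in>UNIV. partial i P x * cnj (partial i Q x))" for x
  note means = harmonic_sphere_means[OF P Q orth, folded G_def H_def]
  note cont = continuous_on_harmonic_product[OF P Q, folded G_def H_def]
  note GH_meas [measurable] = cont[THEN borel_measurable_continuous_onI]
  have [measurable]: "cnj \<in> borel_measurable borel"
    by (intro borel_measurable_continuous_onI continuous_intros)
  note [measurable] = formal_sph_fun_measurable[OF d_eq P] formal_sph_fun_measurable[OF d_eq Q]
    grad_measurable[OF d_eq P] grad_measurable[OF d_eq Q]
  obtain BG where BG: "\<And>x. norm x \<le> 1 \<Longrightarrow> cmod (G x) \<le> BG"
    using continuous_on_UNIV_bounded_on_ball[OF cont(1)] by blast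
  obtain BH where BH: "\<And>x. norm x \<le> 1 \<Longrightarrow> cmod (H x) \<le> BH"
    using continuous_on_UNIV_bounded_on_ball[OF cont(2)] by blast
  obtain C where C: "C \<ge> 0"
    "\<And>r. 0 < r \<Longrightarrow> r < 1 \<Longrightarrow> cmod (alpha_ext m r) \<le> C / r" "\<And>r. 0 < r \<Longrightarrow> r < 1 \<Longrightarrow> cmod (alpha_ext m r) \<le> C"
    "\<And>r. 0 < r \<Longrightarrow> r < 1 \<Longrightarrow> cmod (beta_ext m r) \<le> C / r"
    by (rule ext_bounds[of m], rule that)
  obtain C' where C': "C' \<ge> 0"
    "\<And>r. 0 < r \<Longrightarrow> r < 1 \<Longrightarrow> cmod (alpha_ext n r) \<le> C' / r" "\<And>r. 0 < r \<Longrightarrow> r < 1 \<Longrightarrow> cmod (alpha_ext n r) \<le> C'"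
    "\<And>r. 0 < r \<Longrightarrow> r < 1 \<Longrightarrow> cmod (beta_ext n r) \<le> C' / r"
    by (rule ext_bounds[of n], rule that)
  have d3: "CARD('n) \<ge> 3" using d d_eq by simp
  have vanish: "set_integrable lborel (ball (0::real^'n) 1) (\<lambda>x. G (sgn x) * f (norm x)) \<and>
      (LINT x:ball (0::real^'n) 1|lborel. G (sgn x) * f (norm x)) = 0"
    "set_integrable lborel (ball (0::real^'n) 1) (\<lambda>x. H (sgn x) * f (norm x)) \<and>
      (LINT x:ball (0::real^'n) 1|lborel. H (sgn x) * f (norm x)) = 0"
    if [measurable]: "f \<in> borel_measurable borel"
      and f: "\<And>r. 0 < r \<Longrightarrow> r < 1 \<Longrightarrow> cmod (f r) \<le> K / r\<^sup>2" for f :: "real \<Rightarrow> complex" and K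
  proof -
    note f_int = set_integrable_radial[OF d3 that(1) f]
    show "set_integrable lborel (ball (0::real^'n) 1) (\<lambda>x. G (sgn x) * f (norm x)) \<and>
        (LINT x:ball (0::real^'n) 1|lborel. G (sgn x) * f (norm x)) = 0"
      using radial_integral[OF GH_meas(1) that(1) BG f_int] means by simp
    show "set_integrable lborel (ball (0::real^'n) 1) (\<lambda>x. H (sgn x) * f (norm x)) \<and>
        (LINT x:ball (0::real^'n) 1|lborel. H (sgn x) * f (norm x)) = 0"
      using radial_integral[OF GH_meas(2) that(1) BH f_int] means by simp
  qed
  define f0 where "f0 r = alpha_ext m r * cnj (alpha_ext n r) * of_real (r ^ m * r ^ n)" for r
  define f1 where "f1 r = (beta_ext m r * cnj (beta_ext n r)
      + of_real (real n / r) * beta_ext m r * cnj (alpha_ext n r) +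
      of_real (real m / r) * alpha_ext m r * cnj (beta_ext n r)) * of_real (r ^ m * r ^ n)" for r
  define f2 where "f2 r = alpha_ext m r * cnj (alpha_ext n r) * of_real (r ^ (m - 1) * r ^ (n - 1))"
      for r
  have f_meas: "f0 \<in> borel_measurable borel" "f1 \<in> borel_measurable borel" "f2 \<in> borel_measurable borel"
    unfolding f0_def[abs_def] f1_def[abs_def] f2_def[abs_def] by measurable
  have prod_le: "cmod (z * cnj w) \<le> C * C' / r\<^sup>2" if "cmod z \<le> C / r" "cmod w \<le> C' / r" "0 < r"
      for z w r
    using mult_mono[OF that(1,2)] C(1) that(3) by (simp add: norm_mult power2_eq_square)
  have pow_le: "cmod (of_real (r ^ j * r ^ k)) \<le> 1" if "0 < r" "r < 1" for r :: real and j k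
    using that by (simp add: norm_mult norm_power mult_le_one power_le_one)
  have scale: "cmod (z * of_real (r ^ j * r ^ k)) \<le> M" if "cmod z \<le> M" "0 < r" "r < 1" for z r M j k
    using mult_mono[OF that(1) pow_le[OF that(2,3), of j k]] order_trans[OF norm_ge_zero that(1)]
    by (simp add: norm_mult)
  have f0_le: "cmod (f0 r) \<le> C * C' / r\<^sup>2" and f2_le: "cmod (f2 r) \<le> C * C' / r\<^sup>2"
    if "0 < r" "r < 1" for r
    unfolding f0_def f2_def by (intro scale prod_le C C' that)+
  have f1_le: "cmod (f1 r) \<le> (C * C' + real n * (C * C') + real m * (C * C')) / r\<^sup>2" if r: "0 < r"
      "r < 1" for r
  proof -
    have 1: "cmod (beta_ext m r * cnj (beta_ext n r)) \<le> C * C' / r\<^sup>2" by (intro prod_le C C' r)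
    have 2: "cmod (of_real (real n / r) * beta_ext m r * cnj (alpha_ext n r)) \<le> real n * (C * C') / r\<^sup>2"
    proof -
      have "cmod (of_real (real n / r) * beta_ext m r * cnj (alpha_ext n r))
          = real n / r * (cmod (beta_ext m r) * cmod (alpha_ext n r))"
        using r by (simp add: norm_mult norm_divide)
      also have "\<dots> \<le> real n / r * (C / r * C')"
        using r C C' by (intro mult_left_mono mult_mono) auto
      finally show ?thesis using r by (simp add: power2_eq_square)
    qed
    have 3: "cmod (of_real (real m / r) * alpha_ext m r * cnj (beta_ext n r)) \<le> real m * (C * C') / r\<^sup>2"
    proof -
      have "cmod (of_real (real m / r) * alpha_ext m r * cnj (beta_ext n r))
          = real m / r * (cmod (alpha_ext m r) * cmod (beta_ext n r))"
        using r by (simp add: norm_mult norm_divide)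
      also have "\<dots> \<le> real m / r * (C * (C' / r))"
        using r C C' by (intro mult_left_mono mult_mono) auto
      finally show ?thesis using r by (simp add: power2_eq_square)
    qed
    show ?thesis
      unfolding f1_def add_divide_distrib by (intro scale norm_triangle_le add_mono 1 2 3 r)
  qed
  have P_sgn: "P x = of_real (norm x ^ m) * P (sgn x)" for x by (rule homogeneous_sgn[OF PD(1,2)])
  have Q_sgn: "Q x = of_real (norm x ^ n) * Q (sgn x)" for x by (rule homogeneous_sgn[OF QD(1,2)])
  have G_sgn: "G x = G (sgn x) * of_real (norm x ^ m * norm x ^ n)" for x
    unfolding G_def using P_sgn[of x] Q_sgn[of x] by simp
  have H_sgn: "H x = H (sgn x) * of_real (norm x ^ (m - 1) * norm x ^ (n - 1))" if "x \<noteq> 0" for x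
    unfolding H_def sum_distrib_right
    by (intro sum.cong refl)
      (simp add: homogeneous_partial_sgn[OF PD(1,2) that] homogeneous_partial_sgn[OF QD(1,2) that])
  have "(LINT x:ball 0 1|lborel. formal_sph_fun V m (on_sphere P) x * cnj (formal_sph_fun V n (on_sphere Q) x)) =
      (LINT x:ball (0::real^'n) 1|lborel. G (sgn x) * f0 (norm x))"
    unfolding set_lebesgue_integral_def
  proof (rule integral_cong_AE)
    show "AE x in lborel. indicator (ball 0 1) x *\<^sub>R (formal_sph_fun V m (on_sphere P) x * cnj (formal_sph_fun V n (on_sphere Q) x)) =
        indicator (ball 0 1) x *\<^sub>R (G (sgn x) * f0 (norm x))"
      using AE_lborel_singleton[of 0]
    proof eventually_elim
      case (elim x)
      show ?case
      proof (cases "norm x < 1")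
        case True
        have "formal_sph_fun V m (on_sphere P) x * cnj (formal_sph_fun V n (on_sphere Q) x) =
            alpha_ext m (norm x) * cnj (alpha_ext n (norm x)) * G x"
          using elim True formal_sph_fun_on_sphere[OF P True, of V] formal_sph_fun_on_sphere[OF Q True,
              of V] d_eq
          by (simp add: alpha_ext_def G_def)
        then show ?thesis unfolding G_sgn[of x] by (simp add: f0_def mult_ac)
      qed simp
    qed
    show "(\<lambda>x. indicator (ball 0 1) x *\<^sub>R (G (sgn x) * f0 (norm x))) \<in> borel_measurable lborel"
      using f_meas by measurable
  qed measurable
  also have "\<dots> = 0" using vanish(1)[OF f_meas(1) f0_le] by blast
  finally have L2_part: "(LINT x:ball 0 1|lborel. formal_sph_fun V m (on_sphere P) x * cnj (formal_sph_fun V n (on_sphere Q) x)) = 0" .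
  have "(LINT x:ball 0 1|lborel. (\<Sum>i\<in>UNIV. grad m P x $ i * cnj (grad n Q x $ i))) =
      (LINT x:ball (0::real^'n) 1|lborel. G (sgn x) * f1 (norm x) + H (sgn x) * f2 (norm x))"
    unfolding set_lebesgue_integral_def
  proof (rule integral_cong_AE)
    show "AE x in lborel. indicator (ball 0 1) x *\<^sub>R (\<Sum>i\<in>UNIV. grad m P x $ i * cnj (grad n Q x $ i)) =
        indicator (ball 0 1) x *\<^sub>R (G (sgn x) * f1 (norm x) + H (sgn x) * f2 (norm x))"
      using AE_lborel_singleton[of 0]
    proof eventually_elim
      case (elim x)
      define r where "r = norm x"
      have r: "r > 0" using elim by (simp add: r_def)
      \<comment> \<open>\<open>c\<close> is the radial unit vector at \<open>x\<close>.\<close>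
      define c where "c i = complex_of_real (x $ i / r)" for i
      have c1: "(\<Sum>i\<in>UNIV. c i * c i) = 1"
      proof -
        have "(\<Sum>i\<in>UNIV. x $ i / r * (x $ i / r)) = (\<Sum>i\<in>UNIV. x $ i * x $ i) / (r * r)"
          by (simp add: sum_divide_distrib)
        also have "(\<Sum>i\<in>UNIV. x $ i * x $ i) = r * r"
          by (simp add: r_def norm_eq_sqrt_inner inner_vec_def flip: power2_eq_square) (simp add: power2_eq_square sum_nonneg)
        finally have "(\<Sum>i\<in>UNIV. x $ i / r * (x $ i / r)) = 1" using r by simp
        then show ?thesis
          by (simp only: c_def of_real_mult[symmetric] of_real_sum[symmetric] of_real_1)
      qed
      have cP: "(\<Sum>i\<in>UNIV. c i * partial i P x) = of_real (real m / r) * P x"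
      proof -
        have "(\<Sum>i\<in>UNIV. c i * partial i P x) = (\<Sum>i\<in>UNIV. of_real (x $ i) * partial i P x) / of_real r"
          by (simp add: c_def sum_divide_distrib)
        then show ?thesis by (simp add: Euler_homogeneous[OF PD(1,2)])
      qed
      have cQ: "(\<Sum>i\<in>UNIV. c i * cnj (partial i Q x)) = of_real (real n / r) * cnj (Q x)"
      proof -
        have "(\<Sum>i\<in>UNIV. c i * cnj (partial i Q x))
            = cnj ((\<Sum>i\<in>UNIV. of_real (x $ i) * partial i Q x) / of_real r)"
          by (simp add: c_def sum_divide_distrib)
        then show ?thesis by (simp add: Euler_homogeneous[OF QD(1,2)])
      qed
      have "(\<Sum>i\<in>UNIV. grad m P x $ i * cnj (grad n Q x $ i)) =
          (\<Sum>i\<in>UNIV. beta_ext m r * cnj (beta_ext n r) * (P x * cnj (Q x)) * (c i * c i) +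
            beta_ext m r * cnj (alpha_ext n r) * P x * (c i * cnj (partial i Q x)) +
            alpha_ext m r * cnj (beta_ext n r) * cnj (Q x) * (c i * partial i P x) +
            alpha_ext m r * cnj (alpha_ext n r) * (partial i P x * cnj (partial i Q x)))"
        by (intro sum.cong refl) (simp add: grad_def c_def r_def algebra_simps)
      also have "\<dots> = beta_ext m r * cnj (beta_ext n r) * (P x * cnj (Q x)) * (\<Sum>i\<in>UNIV. c i * c i) +
            beta_ext m r * cnj (alpha_ext n r) * P x * (\<Sum>i\<in>UNIV. c i * cnj (partial i Q x)) +
            alpha_ext m r * cnj (beta_ext n r) * cnj (Q x) * (\<Sum>i\<in>UNIV. c i * partial i P x) +
            alpha_ext m r * cnj (alpha_ext n r) * H x"
        by (simp only: sum.distrib sum_distrib_left H_def)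
      also have "\<dots> = (beta_ext m r * cnj (beta_ext n r)
          + of_real (real n / r) * beta_ext m r * cnj (alpha_ext n r) +
          of_real (real m / r) * alpha_ext m r * cnj (beta_ext n r)) * G x
              + alpha_ext m r * cnj (alpha_ext n r) * H x"
        unfolding c1 cP cQ by (simp add: G_def algebra_simps)
      also have "\<dots> = G (sgn x) * f1 r + H (sgn x) * f2 r"
        unfolding G_sgn[of x] H_sgn[OF elim] by (simp add: f1_def f2_def r_def mult_ac)
      finally show ?case by (simp add: r_def)
    qed
    show "(\<lambda>x. indicator (ball 0 1) x *\<^sub>R (G (sgn x) * f1 (norm x) + H (sgn x) * f2 (norm x)))
        \<in> borel_measurable lborel"
      using f_meas by measurable
  qed measurable
  also have "\<dots> = 0"
    using vanish(1)[OF f_meas(2) f1_le] vanish(2)[OF f_meas(3) f2_le] by (subst set_integral_add) auto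
  finally have grad_part: "(LINT x:ball 0 1|lborel. (\<Sum>i\<in>UNIV. grad m P x $ i * cnj (grad n Q x $ i)))
      = 0" .
  show ?thesis unfolding W12_inner_grad[OF d_eq P Q] L2_part grad_part by simp
qed

text \<open>The \<open>L\<^sup>2\<close> part alone is positive: it is the mean of \<open>|P|\<^sup>2\<close> times the integral of \<open>|\<alpha>|\<^sup>2 r\<^sup>2\<^sup>m\<close>, and
  \<open>\<alpha>\<close> does not vanish near \<open>0\<close>.\<close>

lemma W12_inner_self_nonzero:
  fixes P :: "real^'n \<Rightarrow> complex"
  assumes d_eq: "CARD('n) = d" and P: "P \<in> homogeneous_harmonic_polys m"
    and nz: "sphere_mean (\<lambda>x. P x * cnj (P x)) \<noteq> 0"
  shows "W12_inner (formal_sph_fun V m (on_sphere P)) (formal_sph_fun V m (on_sphere P)) \<noteq> 0"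
proof -
  note PD = homogeneous_harmonic_polysD[OF P]
  let ?u = "formal_sph_fun V m (on_sphere P)"
  define G where "G x = P x * cnj (P x)" for x
  note cont = continuous_on_harmonic_product(1)[OF P P, folded G_def]
  note [measurable] = cont[THEN borel_measurable_continuous_onI]
  note [measurable] = formal_sph_fun_measurable[OF d_eq P]
  obtain B where B: "\<And>x. norm x \<le> 1 \<Longrightarrow> cmod (G x) \<le> B"
    using continuous_on_UNIV_bounded_on_ball[OF cont] by blast
  obtain C where C: "C \<ge> 0"
    "\<And>r. 0 < r \<Longrightarrow> r < 1 \<Longrightarrow> cmod (alpha_ext m r) \<le> C / r" "\<And>r. 0 < r \<Longrightarrow> r < 1 \<Longrightarrow> cmod (alpha_ext m r) \<le> C"
    "\<And>r. 0 < r \<Longrightarrow> r < 1 \<Longrightarrow> cmod (beta_ext m r) \<le> C / r"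
    by (rule ext_bounds[of m], rule that)
  define f where "f r = (cmod (alpha_ext m r))\<^sup>2 * (r ^ m)\<^sup>2" for r
  have f_meas [measurable]: "f \<in> borel_measurable borel" unfolding f_def[abs_def] by measurable
  have f_int: "set_integrable lborel (ball (0::real^'n) 1) (\<lambda>x. f (norm x))"
  proof (rule set_integrable_ball_bounded)
    show "norm (f (norm x)) \<le> C\<^sup>2" if "norm x < 1" for x :: "real^'n"
    proof -
      have "cmod (alpha_ext m (norm x)) \<le> C"
        using C(1) C(3)[of "norm x"] that by (cases "x = 0") (auto simp: alpha_ext_def)
      then have "f (norm x) \<le> C\<^sup>2 * 1"
        unfolding f_def using that by (intro mult_mono power_mono) (auto simp: power_le_one)
      then show ?thesis by (simp add: f_def)
    qed
  qed measurable
  have f_int': "set_integrable lborel (ball (0::real^'n) 1) (\<lambda>x. complex_of_real (f (norm x)))"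
    using f_int unfolding set_integrable_def by (simp add: scaleR_conv_of_real flip: of_real_mult)
  obtain \<delta> where \<delta>: "0 < \<delta>" "\<delta> \<le> 1" "\<And>r. 0 < r \<Longrightarrow> r < \<delta> \<Longrightarrow> \<alpha> m r \<noteq> 0"
    by (rule alpha_nonzero_near_0[of m], rule that)
  have f_pos: "0 < (LINT x:ball (0::real^'n) 1|lborel. f (norm x))"
  proof (rule set_integral_ball_pos[OF f_int _ \<delta>(1)])
    show "0 \<le> f (norm x)" for x :: "real^'n" by (simp add: f_def)
    show "0 < f (norm x)" if "0 < norm x" "norm x < \<delta>" for x :: "real^'n"
      using that \<delta> by (simp add: f_def alpha_ext_def)
  qed
  have "(LINT x:ball 0 1|lborel. ?u x * cnj (?u x))
      = (LINT x:ball (0::real^'n) 1|lborel. G (sgn x) * complex_of_real (f (norm x)))"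
    unfolding set_lebesgue_integral_def
  proof (rule integral_cong_AE)
    show "AE x in lborel. indicator (ball 0 1) x *\<^sub>R (?u x * cnj (?u x)) =
        indicator (ball 0 1) x *\<^sub>R (G (sgn x) * complex_of_real (f (norm x)))"
      using AE_lborel_singleton[of 0]
    proof eventually_elim
      case (elim x)
      show ?case
      proof (cases "norm x < 1")
        case True
        have "?u x = alpha_ext m (norm x) * (of_real (norm x ^ m) * P (sgn x))"
          using elim True formal_sph_fun_on_sphere[OF P True, of V] homogeneous_sgn[OF PD(1,2), of x]
              d_eq
          by (simp add: alpha_ext_def)
        moreover have "complex_of_real (f (norm x)) =
            alpha_ext m (norm x) * cnj (alpha_ext m (norm x)) * (of_real (norm x ^ m) * of_real (norm x ^ m))"
          unfolding f_def of_real_mult complex_norm_square by (simp add: power2_eq_square)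
        ultimately show ?thesis by (simp add: G_def mult_ac)
      qed simp
    qed
    have [measurable]: "cnj \<in> borel_measurable borel"
      by (intro borel_measurable_continuous_onI continuous_intros)
    show "(\<lambda>x. indicator (ball 0 1) x *\<^sub>R (?u x * cnj (?u x))) \<in> borel_measurable lborel" by measurable
  qed measurable
  also have "\<dots> = sphere_mean G * (LINT x:ball (0::real^'n) 1|lborel. complex_of_real (f (norm x)))"
    by (rule radial_integral(1)[OF _ _ B f_int']) measurable
  also have "\<dots> \<noteq> 0"
    using nz f_pos by (simp add: G_def[abs_def] set_integral_complex_of_real)
  finally have L2_nz: "(LINT x:ball 0 1|lborel. ?u x * cnj (?u x)) \<noteq> 0" .
  have L2_eq: "(LINT x:ball 0 1|lborel. ?u x * cnj (?u x))
      = of_real (LINT x:ball 0 1|lborel. (cmod (?u x))\<^sup>2)"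
    by (simp only: complex_norm_square[symmetric] set_integral_complex_of_real)
  have grad_eq: "(LINT x:ball 0 1|lborel. (\<Sum>i\<in>UNIV. grad m P x $ i * cnj (grad m P x $ i))) =
      of_real (LINT x:ball 0 1|lborel. (\<Sum>i\<in>UNIV. (cmod (grad m P x $ i))\<^sup>2))"
    by (simp only: complex_norm_square[symmetric] of_real_sum[symmetric] set_integral_complex_of_real)
  have "0 \<le> (LINT x:ball 0 1|lborel. (cmod (?u x))\<^sup>2)" "0
      \<le> (LINT x:ball 0 1|lborel. (\<Sum>i\<in>UNIV. (cmod (grad m P x $ i))\<^sup>2))"
    unfolding set_lebesgue_integral_def
    by (intro Bochner_Integration.integral_nonneg; simp add: sum_nonneg)+
  moreover have "(LINT x:ball 0 1|lborel. (cmod (?u x))\<^sup>2) \<noteq> 0" using L2_nz L2_eq by auto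
  ultimately show ?thesis
    unfolding W12_inner_grad[OF d_eq P P] L2_eq grad_eq of_real_add[symmetric] of_real_eq_0_iff
        by linarith
qed

text \<open>A spherical harmonic is determined by the values of its formal spherical polynomial on a sphere of small
  radius, where \<open>\<alpha>\<close> does not vanish.\<close>

lemma formal_sph_fun_inj:
  assumes d_eq: "CARD('n) = d"
  shows "inj_on (formal_sph_fun V m) (spherical_harmonics m :: (real^'n \<Rightarrow> complex) set)"
proof (rule inj_onI)
  fix p q :: "real^'n \<Rightarrow> complex"
  assume "p \<in> spherical_harmonics m" "q \<in> spherical_harmonics m"
    and eq: "formal_sph_fun V m p = formal_sph_fun V m q"
  then obtain P Q where P: "P \<in> homogeneous_harmonic_polys m" "p = on_sphere P"
    and Q: "Q \<in> homogeneous_harmonic_polys m" "q = on_sphere Q"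
    unfolding spherical_harmonics_eq by blast
  obtain \<delta> where \<delta>: "0 < \<delta>" "\<delta> \<le> 1" "\<And>r. 0 < r \<Longrightarrow> r < \<delta> \<Longrightarrow> \<alpha> m r \<noteq> 0"
    by (rule alpha_nonzero_near_0[of m], rule that)
  have "P \<xi> = Q \<xi>" if \<xi>: "norm \<xi> = 1" for \<xi>
  proof -
    let ?x = "(\<delta> / 2) *\<^sub>R \<xi>"
    have x: "norm ?x = \<delta> / 2" using \<delta> \<xi> by simp
    then have "norm ?x < 1" using \<delta> by simp
    then have "\<alpha> m (\<delta> / 2) * P ?x = \<alpha> m (\<delta> / 2) * Q ?x"
      using fun_cong[OF eq, of ?x] formal_sph_fun_on_sphere[OF P(1), of ?x V]
        formal_sph_fun_on_sphere[OF Q(1), of ?x V] x d_eq by (simp add: P Q)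
    then have "P ?x = Q ?x" using \<delta> by simp
    then show ?thesis
      using \<delta> by (simp add: homogeneous_harmonic_polysD(2)[OF P(1)]
          homogeneous_harmonic_polysD(2)[OF Q(1)])
  qed
  then show "p = q" unfolding P Q by (auto simp: on_sphere_def fun_eq_iff)
qed

end

lemma linear_formal_sph_fun: "Vector_Spaces.linear cscale cscale (formal_sph_fun V m)"
  unfolding Vector_Spaces.linear_iff
  by (auto simp: formal_sph_fun_def cscale_def fun_eq_iff algebra_simps cfun.vector_space_axioms)

theorem proposition11:
  fixes V :: "real \<Rightarrow> complex"
    and Y :: "nat \<Rightarrow> nat \<Rightarrow> real^'n \<Rightarrow> complex"
  assumes "CARD('n) \<ge> 3"
    and "V \<in> borel_measurable (lebesgue_on {0<..<1})"
    and "integrable (lebesgue_on {0<..<1}) (\<lambda>r. r * cmod (V r))"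
    and "\<And>m. orthonormal_basis sphere_inner
           {1..cfun.dim (spherical_harmonics m :: (real^'n \<Rightarrow> complex) set)}
           (Y m) (spherical_harmonics m)"
  shows "(\<forall>m. (formal_sph_polys V m :: (real^'n \<Rightarrow> complex) set) \<subseteq> W12_ball) \<and>
         (\<forall>m n. m \<noteq> n \<longrightarrow>
            (\<forall>u \<in> (formal_sph_polys V m :: (real^'n \<Rightarrow> complex) set).
             \<forall>v \<in> formal_sph_polys V n. W12_inner u v = 0)) \<and>
         (\<forall>m. orthogonal_basis W12_inner
            {1..cfun.dim (spherical_harmonics m :: (real^'n \<Rightarrow> complex) set)}
            (\<lambda>j. formal_sph_fun V m (Y m j)) (formal_sph_polys V m))"
proof -
  interpret integrable_potential V "CARD('n)" by standard (rule assms)+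
  have polys_eq: "(formal_sph_polys V m :: (real^'n \<Rightarrow> complex) set) =
      (\<lambda>P. formal_sph_fun V m (on_sphere P)) ` homogeneous_harmonic_polys m" for m
    by (simp add: formal_sph_polys_def spherical_harmonics_eq image_image)
  have basis: "orthogonal_basis W12_inner
      {1..cfun.dim (spherical_harmonics m :: (real^'n \<Rightarrow> complex) set)}
      (\<lambda>j. formal_sph_fun V m (Y m j)) (formal_sph_polys V m)" for m
  proof -
    let ?I = "{1..cfun.dim (spherical_harmonics m :: (real^'n \<Rightarrow> complex) set)}"
    let ?F = "formal_sph_fun V m :: (real^'n \<Rightarrow> complex) \<Rightarrow> _"
    interpret vector_space_pair "cscale :: complex \<Rightarrow> ((real^'n) \<Rightarrow> complex) \<Rightarrow> _"
        "cscale :: complex \<Rightarrow> ((real^'n) \<Rightarrow> complex) \<Rightarrow> _" ..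
    interpret L: Vector_Spaces.linear cscale cscale ?F by (rule linear_formal_sph_fun)
    have Y: "inj_on (Y m) ?I" "cfun.independent (Y m ` ?I)" "cfun.span (Y m ` ?I)
        = spherical_harmonics m"
      "\<And>i j. i \<in> ?I \<Longrightarrow> j \<in> ?I \<Longrightarrow> i \<noteq> j \<Longrightarrow> sphere_inner (Y m i) (Y m j) = 0"
      "\<And>i. i \<in> ?I \<Longrightarrow> sphere_inner (Y m i) (Y m i) = 1"
      using assms(4)[of m] unfolding orthonormal_basis_def orthogonal_basis_def by blast+
    have "Y m ` ?I \<subseteq> spherical_harmonics m" using cfun.span_superset[of "Y m ` ?I"] Y(3) by blast
    then have "\<forall>j\<in>?I. \<exists>P\<in>homogeneous_harmonic_polys m. Y m j = on_sphere P"
      unfolding spherical_harmonics_eq by blast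
    then obtain P where P: "\<And>j. j \<in> ?I \<Longrightarrow> P j \<in> homogeneous_harmonic_polys m"
      "\<And>j. j \<in> ?I \<Longrightarrow> Y m j = on_sphere (P j)" by metis
    have mean: "sphere_mean (\<lambda>x. P i x * cnj (P j x)) = 0 \<longleftrightarrow> sphere_inner (Y m i) (Y m j) = 0"
      if "i \<in> ?I" "j \<in> ?I" for i j
      using sphere_inner_eq_sphere_mean[OF P(1)[OF that(1)] P(1)[OF that(2)]]
        measure_unit_ball_pos[where 'a="real^'n"]
      unfolding P(2)[OF that(1)] P(2)[OF that(2)] on_sphere_def by simp
    have inj: "inj_on ?F (spherical_harmonics m)" by (rule formal_sph_fun_inj) (rule refl)
    have sub: "Y m ` ?I \<subseteq> spherical_harmonics m" by fact
    have img: "(\<lambda>j. ?F (Y m j)) ` ?I = ?F ` (Y m ` ?I)" by (simp add: image_image)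
    show ?thesis
      unfolding orthogonal_basis_def img
    proof (intro conjI ballI impI)
      show "inj_on (\<lambda>j. ?F (Y m j)) ?I"
        using comp_inj_on[OF Y(1) inj_on_subset[OF inj sub]] by (simp add: o_def)
      show "cfun.independent (?F ` (Y m ` ?I))"
        using linear_independent_injective_image[OF linear_formal_sph_fun Y(2)] inj Y(3) by simp
      show "cfun.span (?F ` (Y m ` ?I)) = formal_sph_polys V m"
        using L.span_image[of "Y m ` ?I"] Y(3) by (simp add: formal_sph_polys_def)
      fix i assume i: "i \<in> ?I"
      show "W12_inner (?F (Y m i)) (?F (Y m i)) \<noteq> 0"
        unfolding P(2)[OF i] using mean[OF i i] Y(5)[OF i]
        by (intro W12_inner_self_nonzero P(1)[OF i]) auto
      fix j assume j: "j \<in> ?I" and ij: "i \<noteq> j"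
      show "W12_inner (?F (Y m i)) (?F (Y m j)) = 0"
        unfolding P(2)[OF i] P(2)[OF j] using mean[OF i j] Y(4)[OF i j ij]
        by (intro W12_inner_eq_0 P(1) i j) auto
    qed
  qed
  show ?thesis
  proof (intro conjI allI impI ballI)
    show "(formal_sph_polys V m :: (real^'n \<Rightarrow> complex) set) \<subseteq> W12_ball" for m
      unfolding polys_eq using formal_sph_fun_W12 by blast
    show "W12_inner u v = 0" if "m \<noteq> n" "u \<in> formal_sph_polys V m" "v \<in> formal_sph_polys V n"
      for m n and u v :: "real^'n \<Rightarrow> complex"
      using that unfolding polys_eq by (auto intro!: W12_inner_eq_0)
  qed (rule basis)
qed

end
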